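(* Let $S$ be a non-exceptional oriented surface of finite type. The action of the mapping class group $\mathcal{MCG}(S)$ on the train track complex $\mathcal{TT}$ of $S$ is proper.
   Context: Surface: $S$ is an oriented surface of genus $g\ge 0$ with $k\ge 0$ punctures and $3g-3+k\ge 2$. $\mathcal{MCG}(S)$ is the group of isotopy classes of orientation preserving self-homeomorphisms of $S$. Train tracks: A train track on $S$ is an embedded 1-complex $\tau\subset S$ whose edges (branches) are smooth arcs with well-defined tangent vectors at the endpoints; at each vertex (switch) the incident edges are mutually tangent, and through each switch there is an embedded $C^1$-path in $\tau$ containing the switch in its interior. Thus the half-branches at a switch fall into two classes according to the direction of the inward pointing tangent. Each closed curve component has a unique bivalent switch and all other switches are at least trivalent; complementary regions are not discs with 0, 1 or 2 cusps at the boundary, and not annuli or once-punctured discs without cusps. Isotopic train tracks are identified. $\tau$ is generic if all switches are at most trivalent; maximal if each complementary component is a trigon (disc with three cusps) or a once punctured disc with one cusp; recurrent if there is a strictly positive weight function on the branches such that at each switch the sums of weights over the two classes agree; transversely recurrent if every branch is intersected by an embedded simple closed curve $c$ transverse to $\tau$ such that $S-\tau-c$ contains no embedded bigon. A train track is complete if it is generic, maximal, recurrent and transversely recurrent. Splits: At a trivalent switch, the half-branch alone in its class is large, the two others are small. A branch is large if both its half-branches are large. Let $e$ be a large branch, drawn horizontally, with upper/lower left small half-branches at its left endpoint and upper/lower right small half-branches at its right endpoint. A split at $e$ replaces $e$ by two disjoint parallel strands (upper left to upper right, lower left to lower right) together with a new diagonal branch joining them, permitting smooth paths either from upper left to lower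 right or from lower left to upper right. $\mathcal{TT}$ is the locally finite connected metric graph whose vertices are the isotopy classes of complete train tracks on $S$, with an edge of length one from $\tau$ to $\tau'$ whenever $\tau'$ is obtained from $\tau$ by a single split. $\mathcal{MCG}(S)$ acts on $\mathcal{TT}$ by simplicial isometries in the natural way. Proper means that for every compact $K\subset\mathcal{TT}$ the set $\{g\in\mathcal{MCG}(S): gK\cap K\neq\emptyset\}$ is finite. *)

theory Defs
  imports "HOL-Complex_Analysis.Complex_Analysis"
begin

section \<open>Smoothness\<close>

text \<open>Derivatives are taken within \<^term>\<open>X\<close>, hence one-sided at the end points of a closed
  interval. Only used for open sets and non-degenerate intervals, where they are unique.\<close>

primrec C_k_on :: "nat \<Rightarrow> 'a::euclidean_space set \<Rightarrow> ('a \<Rightarrow> 'b::real_normed_vector) \<Rightarrow> bool" where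
  "C_k_on 0 X f \<longleftrightarrow> continuous_on X f"
| "C_k_on (Suc n) X f \<longleftrightarrow> f differentiable_on X \<and>
     (\<forall>b\<in>Basis. C_k_on n X (\<lambda>x. frechet_derivative f (at x within X) b))"

definition smooth_on :: "'a::euclidean_space set \<Rightarrow> ('a \<Rightarrow> 'b::real_normed_vector) \<Rightarrow> bool" where
  "smooth_on X f \<longleftrightarrow> (\<forall>n. C_k_on n X f)"

definition cross :: "complex \<Rightarrow> complex \<Rightarrow> real" where
  "cross a b = Re a * Im b - Im a * Re b"

definition jacobian :: "(complex \<Rightarrow> complex) \<Rightarrow> complex \<Rightarrow> real" where
  "jacobian f z = cross (frechet_derivative f (at z) 1) (frechet_derivative f (at z) \<i>)"


section \<open>Oriented surfaces of finite type\<close>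

text \<open>A surface with punctures is a closed surface with an oriented smooth atlas from which
  finitely many points are removed; the atlas is kept on the closed surface.\<close>

record 'a punctured_surface =
  closed_surf :: "'a topology"
  charts :: "('a set \<times> ('a \<Rightarrow> complex)) set"
  punctures :: "'a set"

definition surf :: "'a punctured_surface \<Rightarrow> 'a topology" where
  "surf S = subtopology (closed_surf S) (topspace (closed_surf S) - punctures S)"

definition oriented_smooth_atlas :: "'a topology \<Rightarrow> ('a set \<times> ('a \<Rightarrow> complex)) set \<Rightarrow> bool" where
  "oriented_smooth_atlas X A \<longleftrightarrow>
     (\<Union>(U, \<phi>)\<in>A. U) = topspace X \<and>
     (\<forall>(U, \<phi>)\<in>A. openin X U \<and> open (\<phi> ` U) \<and>
        homeomorphic_map (subtopology X U) (top_of_set (\<phi> ` U)) \<phi>) \<and>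
     (\<forall>(U, \<phi>)\<in>A. \<forall>(V, \<psi>)\<in>A.
        smooth_on (\<phi> ` (U \<inter> V)) (\<psi> \<circ> inv_into U \<phi>) \<and>
        (\<forall>z\<in>\<phi> ` (U \<inter> V). jacobian (\<psi> \<circ> inv_into U \<phi>) z > 0))"

definition nonseparating_curves :: "'a topology \<Rightarrow> nat \<Rightarrow> bool" where
  "nonseparating_curves X n \<longleftrightarrow>
     (\<exists>c :: nat \<Rightarrow> real \<Rightarrow> 'a.
        (\<forall>i<n. pathin X (c i) \<and> c i 1 = c i 0 \<and> inj_on (c i) {0..<1}) \<and>
        (\<forall>i<n. \<forall>j<n. i \<noteq> j \<longrightarrow> c i ` {0..1} \<inter> c j ` {0..1} = {}) \<and>
        connectedin X (topspace X - (\<Union>i<n. c i ` {0..1})))"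

text \<open>The genus is the maximal number of disjoint simple closed curves with connected complement.\<close>

definition has_genus :: "'a topology \<Rightarrow> nat \<Rightarrow> bool" where
  "has_genus X g \<longleftrightarrow> (\<forall>n. nonseparating_curves X n \<longleftrightarrow> n \<le> g)"

definition oriented_surface :: "'a punctured_surface \<Rightarrow> nat \<Rightarrow> nat \<Rightarrow> bool" where
  "oriented_surface S g k \<longleftrightarrow>
     topspace (closed_surf S) \<noteq> {} \<and>
     Hausdorff_space (closed_surf S) \<and> compact_space (closed_surf S) \<and>
     connected_space (closed_surf S) \<and>
     oriented_smooth_atlas (closed_surf S) (charts S) \<and>
     has_genus (closed_surf S) g \<and>
     punctures S \<subseteq> topspace (closed_surf S) \<and> finite (punctures S) \<and> card (punctures S) = k"


section \<open>The mapping class group\<close>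

text \<open>A homeomorphism need not be differentiable, so the local degree is read off in oriented
  charts as the winding number of the image of a small circle.\<close>

definition orientation_preserving :: "'a punctured_surface \<Rightarrow> ('a \<Rightarrow> 'a) \<Rightarrow> bool" where
  "orientation_preserving S f \<longleftrightarrow>
     (\<forall>x\<in>topspace (surf S). \<forall>(U, \<phi>)\<in>charts S. \<forall>(V, \<psi>)\<in>charts S. x \<in> U \<and> f x \<in> V \<longrightarrow>
        (\<forall>\<^sub>F r in at_right 0.
           winding_number (\<psi> \<circ> f \<circ> inv_into U \<phi> \<circ> circlepath (\<phi> x) r) (\<psi> (f x)) = 1))"

definition isotopic_homeos :: "'a punctured_surface \<Rightarrow> ('a \<Rightarrow> 'a) \<Rightarrow> ('a \<Rightarrow> 'a) \<Rightarrow> bool" where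
  "isotopic_homeos S f g \<longleftrightarrow>
     homotopic_with (homeomorphic_map (surf S) (surf S)) (surf S) (surf S) f g"

text \<open>Values of maps outside the surface are irrelevant: maps which agree on it are isotopic.\<close>

definition MCG :: "'a punctured_surface \<Rightarrow> ('a \<Rightarrow> 'a) set set" where
  "MCG S = {f. homeomorphic_map (surf S) (surf S) f \<and> orientation_preserving S f} //
     {(f, g). isotopic_homeos S f g}"


section \<open>Train tracks\<close>

text \<open>A curve with nowhere vanishing velocity which is of class \<open>C\<^sup>k\<close>.\<close>

definition regular_curve :: "'a punctured_surface \<Rightarrow> nat \<Rightarrow> real set \<Rightarrow> (real \<Rightarrow> 'a) \<Rightarrow> bool" where
  "regular_curve S k I c \<longleftrightarrow>
     continuous_map (top_of_set I) (surf S) c \<and>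
     (\<forall>(U, \<phi>)\<in>charts S. let J = {t \<in> I. c t \<in> U} in
        C_k_on k J (\<phi> \<circ> c) \<and>
        (\<forall>t\<in>J. \<phi> \<circ> c differentiable (at t within J) \<and>
               vector_derivative (\<phi> \<circ> c) (at t within J) \<noteq> 0))"

text \<open>A 1-complex is given by the finite set of its branches, each with a chosen
  parametrisation over the unit interval. Parametrisations (and the directions of branches)
  carry no information, since they are forgotten by the isotopy relation below.
  A half-branch is a branch with one of its ends: \<^term>\<open>(b, False)\<close> is based at
  \<^term>\<open>b 0\<close> and \<^term>\<open>(b, True)\<close> at \<^term>\<open>b 1\<close>.\<close>

type_synonym 'a track = "(real \<Rightarrow> 'a) set"
type_synonym 'a half_branch = "(real \<Rightarrow> 'a) \<times> bool"

definition half_branches :: "'a track \<Rightarrow> 'a half_branch set" where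
  "half_branches \<tau> = \<tau> \<times> UNIV"

definition other_half :: "'a half_branch \<Rightarrow> 'a half_branch" where
  "other_half h = (fst h, \<not> snd h)"

definition half_path :: "'a half_branch \<Rightarrow> real \<Rightarrow> 'a" where
  "half_path h s = fst h (if snd h then 1 - s else s)"

definition base :: "'a half_branch \<Rightarrow> 'a" where
  "base h = half_path h 0"

definition switches :: "'a track \<Rightarrow> 'a set" where
  "switches \<tau> = base ` half_branches \<tau>"

definition halves_at :: "'a track \<Rightarrow> 'a \<Rightarrow> 'a half_branch set" where
  "halves_at \<tau> v = {h \<in> half_branches \<tau>. base h = v}"

definition support :: "'a track \<Rightarrow> 'a set" where
  "support \<tau> = (\<Union>b\<in>\<tau>. b ` {0..1})"

definition inward_tangent :: "('a \<Rightarrow> complex) \<Rightarrow> 'a half_branch \<Rightarrow> complex" where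
  "inward_tangent \<phi> h = vector_derivative (\<phi> \<circ> half_path h) (at_right 0)"

definition same_class :: "'a punctured_surface \<Rightarrow> 'a half_branch \<Rightarrow> 'a half_branch \<Rightarrow> bool" where
  "same_class S h h' \<longleftrightarrow> base h = base h' \<and>
     (\<exists>(U, \<phi>)\<in>charts S. base h \<in> U \<and>
        (\<exists>r>0. inward_tangent \<phi> h' = r *\<^sub>R inward_tangent \<phi> h))"

definition opposite_class :: "'a punctured_surface \<Rightarrow> 'a half_branch \<Rightarrow> 'a half_branch \<Rightarrow> bool" where
  "opposite_class S h h' \<longleftrightarrow> base h = base h' \<and>
     (\<exists>(U, \<phi>)\<in>charts S. base h \<in> U \<and>
        (\<exists>r<0. inward_tangent \<phi> h' = r *\<^sub>R inward_tangent \<phi> h))"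

definition embedded_complex :: "'a punctured_surface \<Rightarrow> 'a track \<Rightarrow> bool" where
  "embedded_complex S \<tau> \<longleftrightarrow> finite \<tau> \<and>
     (\<forall>b\<in>\<tau>. (\<forall>k. regular_curve S k {0..1} b) \<and>
        (\<forall>s\<in>{0<..<1}. \<forall>t\<in>{0..1}. b s = b t \<longrightarrow> s = t)) \<and>
     (\<forall>b\<in>\<tau>. \<forall>b'\<in>\<tau>. b \<noteq> b' \<longrightarrow> (\<forall>s\<in>{0<..<1}. \<forall>t\<in>{0..1}. b s \<noteq> b' t))"

definition complementary_regions :: "'a punctured_surface \<Rightarrow> 'a set \<Rightarrow> 'a set set" where
  "complementary_regions S Y =
     connected_components_of (subtopology (surf S) (topspace (surf S) - Y))"

text \<open>The loop \<^term>\<open>c\<close>, defined on the unit circle, runs through the branches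
  \<open>\<beta> 0, \<dots>, \<beta> (m - 1)\<close> (a half-branch standing for the branch traversed from there); there is a
  cusp between two consecutive branches if they leave the common switch in the same direction.\<close>

definition boundary_with_cusps ::
    "'a punctured_surface \<Rightarrow> 'a track \<Rightarrow> (complex \<Rightarrow> 'a) \<Rightarrow> nat \<Rightarrow> bool" where
  "boundary_with_cusps S \<tau> c n \<longleftrightarrow>
     (\<exists>m>0. \<exists>\<beta> :: nat \<Rightarrow> 'a half_branch.
        (\<forall>j<m. \<beta> j \<in> half_branches \<tau> \<and>
           (\<forall>s\<in>{0..1}. c (cis (2 * pi * (real j + s) / real m)) = half_path (\<beta> j) s)) \<and>
        card {j. j < m \<and> same_class S (other_half (\<beta> j)) (\<beta> (Suc j mod m))} = n)"

text \<open>In the following, \<^term>\<open>\<phi>\<close> identifies an open disc or annulus with the region and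
  extends to the boundary; the extension need not be injective, as a branch may have the
  region on both of its sides.\<close>

definition disc_with_cusps :: "'a punctured_surface \<Rightarrow> 'a track \<Rightarrow> nat \<Rightarrow> 'a set \<Rightarrow> bool" where
  "disc_with_cusps S \<tau> n R \<longleftrightarrow>
     (\<exists>\<phi> :: complex \<Rightarrow> 'a.
        continuous_map (top_of_set (cball 0 1)) (surf S) \<phi> \<and>
        homeomorphic_map (top_of_set (ball 0 1)) (subtopology (surf S) R) \<phi> \<and>
        boundary_with_cusps S \<tau> \<phi> n)"

definition punctured_disc_with_cusps ::
    "'a punctured_surface \<Rightarrow> 'a track \<Rightarrow> nat \<Rightarrow> 'a set \<Rightarrow> bool" where
  "punctured_disc_with_cusps S \<tau> n R \<longleftrightarrow>
     (\<exists>\<phi> :: complex \<Rightarrow> 'a. \<phi> 0 \<in> punctures S \<and>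
        continuous_map (top_of_set (cball 0 1)) (closed_surf S) \<phi> \<and>
        homeomorphic_map (top_of_set (ball 0 1))
          (subtopology (closed_surf S) (insert (\<phi> 0) R)) \<phi> \<and>
        boundary_with_cusps S \<tau> \<phi> n)"

definition annulus_without_cusps :: "'a punctured_surface \<Rightarrow> 'a track \<Rightarrow> 'a set \<Rightarrow> bool" where
  "annulus_without_cusps S \<tau> R \<longleftrightarrow>
     (\<exists>\<phi> :: complex \<Rightarrow> 'a.
        continuous_map (top_of_set {z. 1 \<le> cmod z \<and> cmod z \<le> 2}) (surf S) \<phi> \<and>
        homeomorphic_map (top_of_set {z. 1 < cmod z \<and> cmod z < 2}) (subtopology (surf S) R) \<phi> \<and>
        boundary_with_cusps S \<tau> \<phi> 0 \<and> boundary_with_cusps S \<tau> (\<lambda>z. \<phi> (2 * z)) 0)"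

definition train_track :: "'a punctured_surface \<Rightarrow> 'a track \<Rightarrow> bool" where
  "train_track S \<tau> \<longleftrightarrow>
     embedded_complex S \<tau> \<and>
     (\<forall>h\<in>half_branches \<tau>. \<forall>h'\<in>half_branches \<tau>. base h = base h' \<longrightarrow>
        same_class S h h' \<or> opposite_class S h h') \<and>
     (\<forall>v\<in>switches \<tau>. \<exists>p. regular_curve S 1 {-1..1} p \<and> inj_on p {-1..1} \<and>
        p ` {-1..1} \<subseteq> support \<tau> \<and> p 0 = v) \<and>
     (\<forall>v\<in>switches \<tau>. card (halves_at \<tau> v) \<ge> 3 \<or>
        (\<exists>b\<in>\<tau>. halves_at \<tau> v = {(b, False), (b, True)})) \<and>
     (\<forall>R\<in>complementary_regions S (support \<tau>).
        (\<forall>n\<in>{0, 1, 2}. \<not> disc_with_cusps S \<tau> n R) \<and>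
        \<not> annulus_without_cusps S \<tau> R \<and> \<not> punctured_disc_with_cusps S \<tau> 0 R)"

definition generic :: "'a track \<Rightarrow> bool" where
  "generic \<tau> \<longleftrightarrow> (\<forall>v\<in>switches \<tau>. card (halves_at \<tau> v) \<le> 3)"

definition maximal :: "'a punctured_surface \<Rightarrow> 'a track \<Rightarrow> bool" where
  "maximal S \<tau> \<longleftrightarrow> (\<forall>R\<in>complementary_regions S (support \<tau>).
     disc_with_cusps S \<tau> 3 R \<or> punctured_disc_with_cusps S \<tau> 1 R)"

definition recurrent :: "'a punctured_surface \<Rightarrow> 'a track \<Rightarrow> bool" where
  "recurrent S \<tau> \<longleftrightarrow> (\<exists>\<mu> :: (real \<Rightarrow> 'a) \<Rightarrow> real. (\<forall>b\<in>\<tau>. \<mu> b > 0) \<and>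
     (\<forall>h\<in>half_branches \<tau>.
        (\<Sum>h' | h' \<in> half_branches \<tau> \<and> same_class S h h'. \<mu> (fst h')) =
        (\<Sum>h' | h' \<in> half_branches \<tau> \<and> opposite_class S h h'. \<mu> (fst h'))))"

text \<open>Embedded closed curves are parametrised over the real line with period 1.\<close>

definition simple_closed_curve :: "'a punctured_surface \<Rightarrow> (real \<Rightarrow> 'a) \<Rightarrow> bool" where
  "simple_closed_curve S c \<longleftrightarrow> (\<forall>k. regular_curve S k UNIV c) \<and>
     (\<forall>t. c (t + 1) = c t) \<and> inj_on c {0..<1}"

definition transverse_to :: "'a punctured_surface \<Rightarrow> 'a track \<Rightarrow> (real \<Rightarrow> 'a) \<Rightarrow> bool" where
  "transverse_to S \<tau> c \<longleftrightarrow>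
     range c \<inter> switches \<tau> = {} \<and>
     (\<forall>b\<in>\<tau>. \<forall>s\<in>{0<..<1}. \<forall>t. b s = c t \<longrightarrow>
        (\<forall>(U, \<phi>)\<in>charts S. c t \<in> U \<longrightarrow>
           cross (vector_derivative (\<phi> \<circ> b) (at s)) (vector_derivative (\<phi> \<circ> c) (at t)) \<noteq> 0))"

text \<open>A disc component of the complement of \<open>\<tau> \<union> c\<close> with exactly two corners. Corners on
  \<open>c\<close> come in pairs, and discs bounded by \<open>\<tau>\<close> alone with two cusps do not occur for a train
  track, so one side is a subarc of \<open>c\<close> and the other one a smooth path on \<open>\<tau>\<close>.\<close>

definition bigon :: "'a punctured_surface \<Rightarrow> 'a track \<Rightarrow> (real \<Rightarrow> 'a) \<Rightarrow> 'a set \<Rightarrow> bool" where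
  "bigon S \<tau> c R \<longleftrightarrow>
     R \<in> complementary_regions S (support \<tau> \<union> range c) \<and>
     (\<exists>\<phi> :: complex \<Rightarrow> 'a.
        continuous_map (top_of_set (cball 0 1)) (surf S) \<phi> \<and>
        homeomorphic_map (top_of_set (ball 0 1)) (subtopology (surf S) R) \<phi> \<and>
        regular_curve S 1 {0..1} (\<lambda>t. \<phi> (cis (pi * t))) \<and>
        (\<forall>t\<in>{0..1}. \<phi> (cis (pi * t)) \<in> range c) \<and>
        regular_curve S 1 {0..1} (\<lambda>t. \<phi> (cis (pi * (1 + t)))) \<and>
        (\<forall>t\<in>{0..1}. \<phi> (cis (pi * (1 + t))) \<in> support \<tau>))"

definition transversely_recurrent :: "'a punctured_surface \<Rightarrow> 'a track \<Rightarrow> bool" where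
  "transversely_recurrent S \<tau> \<longleftrightarrow>
     (\<forall>b\<in>\<tau>. \<exists>c. simple_closed_curve S c \<and> transverse_to S \<tau> c \<and>
        range c \<inter> b ` {0..1} \<noteq> {} \<and> (\<forall>R. \<not> bigon S \<tau> c R))"

definition complete_track :: "'a punctured_surface \<Rightarrow> 'a track \<Rightarrow> bool" where
  "complete_track S \<tau> \<longleftrightarrow> train_track S \<tau> \<and> generic \<tau> \<and> maximal S \<tau> \<and>
     recurrent S \<tau> \<and> transversely_recurrent S \<tau>"


section \<open>Isotopy of train tracks\<close>

definition maps_half :: "('a \<Rightarrow> 'a) \<Rightarrow> 'a half_branch \<Rightarrow> 'a half_branch \<Rightarrow> bool" where
  "maps_half f h h' \<longleftrightarrow> (\<exists>\<rho> :: real \<Rightarrow> real.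
     continuous_on {0..1} \<rho> \<and> strict_mono_on {0..1} \<rho> \<and> \<rho> 0 = 0 \<and> \<rho> 1 = 1 \<and>
     (\<forall>s\<in>{0..1}. f (half_path h s) = half_path h' (\<rho> s)))"

text \<open>The homeomorphism \<^term>\<open>f\<close> maps the 1-complex \<^term>\<open>\<tau>\<close> onto \<^term>\<open>\<tau>'\<close> and
  respects the two classes of half-branches at each switch. It is not required to be smooth:
  diffeomorphisms preserve the order of contact of branches at a switch, which can vary
  within an isotopy class of train tracks.\<close>

definition carries_onto ::
    "'a punctured_surface \<Rightarrow> ('a \<Rightarrow> 'a) \<Rightarrow> 'a track \<Rightarrow> 'a track \<Rightarrow> bool" where
  "carries_onto S f \<tau> \<tau>' \<longleftrightarrow>
     homeomorphic_map (surf S) (surf S) f \<and>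
     f ` support \<tau> = support \<tau>' \<and>
     (\<forall>h\<in>half_branches \<tau>. \<exists>h'\<in>half_branches \<tau>'. maps_half f h h') \<and>
     (\<forall>h\<^sub>1\<in>half_branches \<tau>. \<forall>h\<^sub>2\<in>half_branches \<tau>.
      \<forall>h\<^sub>1'\<in>half_branches \<tau>'. \<forall>h\<^sub>2'\<in>half_branches \<tau>'.
        maps_half f h\<^sub>1 h\<^sub>1' \<and> maps_half f h\<^sub>2 h\<^sub>2' \<longrightarrow>
          (same_class S h\<^sub>1 h\<^sub>2 \<longleftrightarrow> same_class S h\<^sub>1' h\<^sub>2'))"

definition isotopic_tracks :: "'a punctured_surface \<Rightarrow> 'a track \<Rightarrow> 'a track \<Rightarrow> bool" where
  "isotopic_tracks S \<tau> \<tau>' \<longleftrightarrow> (\<exists>f. isotopic_homeos S id f \<and> carries_onto S f \<tau> \<tau>')"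


section \<open>Splits\<close>

definition large_half :: "'a punctured_surface \<Rightarrow> 'a track \<Rightarrow> 'a half_branch \<Rightarrow> bool" where
  "large_half S \<tau> h \<longleftrightarrow> h \<in> half_branches \<tau> \<and> card (halves_at \<tau> (base h)) = 3 \<and>
     {h' \<in> half_branches \<tau>. same_class S h h'} = {h}"

definition large_branch :: "'a punctured_surface \<Rightarrow> 'a track \<Rightarrow> (real \<Rightarrow> 'a) \<Rightarrow> bool" where
  "large_branch S \<tau> e \<longleftrightarrow> large_half S \<tau> (e, False) \<and> large_half S \<tau> (e, True)"

definition smooth_embedding ::
    "'a punctured_surface \<Rightarrow> complex set \<Rightarrow> (complex \<Rightarrow> 'a) \<Rightarrow> bool" where
  "smooth_embedding S Q \<psi> \<longleftrightarrow>
     openin (surf S) (\<psi> ` Q) \<and>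
     homeomorphic_map (top_of_set Q) (subtopology (surf S) (\<psi> ` Q)) \<psi> \<and>
     (\<forall>(U, \<phi>)\<in>charts S. let W = {z \<in> Q. \<psi> z \<in> U} in
        smooth_on W (\<phi> \<circ> \<psi>) \<and> (\<forall>z\<in>W. jacobian (\<phi> \<circ> \<psi>) z \<noteq> 0))"

text \<open>The local picture of a split. Before: the large branch is the segment \<open>[-1, 1]\<close> and
  the four small half-branches are the arcs \<open>y = \<plusminus>(\<bar>x\<bar> - 1)\<^sup>2\<close>. After: the parallel strands
  \<open>y = \<plusminus>f x\<close>, which agree with these arcs for \<open>\<bar>x\<bar> \<ge> 2\<close>, and the diagonal \<open>y = d x\<close> between
  them over \<open>[-1, 1]\<close>. The precise shape of \<open>f\<close> and \<open>d\<close> does not matter.\<close>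

definition split_box :: "complex set" where
  "split_box = {z. \<bar>Re z\<bar> < 3 \<and> \<bar>Im z\<bar> < 5}"

definition before_split :: "complex set" where
  "before_split = {z \<in> split_box. \<bar>Im z\<bar> = (max 0 (\<bar>Re z\<bar> - 1))\<^sup>2}"

definition after_split :: "(real \<Rightarrow> real) \<Rightarrow> (real \<Rightarrow> real) \<Rightarrow> complex set" where
  "after_split f d = {z \<in> split_box. \<bar>Im z\<bar> = f (Re z)} \<union> {z. \<bar>Re z\<bar> \<le> 1 \<and> Im z = d (Re z)}"

definition split_functions :: "(real \<Rightarrow> real) \<Rightarrow> (real \<Rightarrow> real) \<Rightarrow> bool" where
  "split_functions f d \<longleftrightarrow>
     f differentiable_on {-3<..<3} \<and> d differentiable_on {-1..1} \<and>
     (\<forall>x\<in>{-3<..<3}. 0 < f x \<and> f x < 5) \<and>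
     (\<forall>x\<in>{-3<..<3}. \<bar>x\<bar> \<ge> 2 \<longrightarrow> f x = (\<bar>x\<bar> - 1)\<^sup>2) \<and>
     (\<forall>x\<in>{-1<..<1}. \<bar>d x\<bar> < f x) \<and>
     (d (-1) = - f (-1) \<and> d 1 = f 1 \<or> d (-1) = f (-1) \<and> d 1 = - f 1)"

text \<open>Applied to train tracks only, so that at its end points the diagonal is automatically
  tangent to the strands.\<close>

definition split_of :: "'a punctured_surface \<Rightarrow> 'a track \<Rightarrow> 'a track \<Rightarrow> bool" where
  "split_of S \<tau> \<tau>' \<longleftrightarrow>
     (\<exists>e\<in>\<tau>. \<exists>\<psi> f d. large_branch S \<tau> e \<and>
        smooth_embedding S split_box \<psi> \<and> split_functions f d \<and>
        e ` {0..1} = \<psi> ` {z. \<bar>Re z\<bar> \<le> 1 \<and> Im z = 0} \<and>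
        support \<tau> \<inter> \<psi> ` split_box = \<psi> ` before_split \<and>
        support \<tau>' \<inter> \<psi> ` split_box = \<psi> ` after_split f d \<and>
        support \<tau> - \<psi> ` split_box = support \<tau>' - \<psi> ` split_box)"


section \<open>Metric graphs with edges of length one\<close>

text \<open>\<^term>\<open>Inner u v t\<close> with \<open>0 < t < 1\<close> is the point at distance \<^term>\<open>t\<close> from
  \<^term>\<open>u\<close> on the edge from \<^term>\<open>u\<close> to \<^term>\<open>v\<close>.\<close>

datatype 'v graph_point = Vertex 'v | Inner 'v 'v real

definition graph_points :: "'v set \<Rightarrow> ('v \<times> 'v) set \<Rightarrow> 'v graph_point set" where
  "graph_points V E = Vertex ` V \<union> {Inner u v t |u v t. (u, v) \<in> E \<and> 0 < t \<and> t < 1}"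

text \<open>Path distances, infinite between different components.\<close>

definition vertex_dist :: "('v \<times> 'v) set \<Rightarrow> 'v \<Rightarrow> 'v \<Rightarrow> ennreal" where
  "vertex_dist E u v = (INF n\<in>{n. (u, v) \<in> (E \<union> E\<inverse>) ^^ n}. of_nat n)"

fun nearby_vertices :: "'v graph_point \<Rightarrow> ('v \<times> real) set" where
  "nearby_vertices (Vertex v) = {(v, 0)}"
| "nearby_vertices (Inner u v t) = {(u, t), (v, 1 - t)}"

fun along_edge_dist :: "'v graph_point \<Rightarrow> 'v graph_point \<Rightarrow> ennreal" where
  "along_edge_dist (Inner u v s) (Inner u' v' t) =
     (if u = u' \<and> v = v' then ennreal \<bar>s - t\<bar> else \<infinity>)"
| "along_edge_dist x y = \<infinity>"

definition graph_dist :: "('v \<times> 'v) set \<Rightarrow> 'v graph_point \<Rightarrow> 'v graph_point \<Rightarrow> ennreal" where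
  "graph_dist E x y = min (along_edge_dist x y)
     (INF (u, a)\<in>nearby_vertices x. INF (v, b)\<in>nearby_vertices y.
        ennreal a + vertex_dist E u v + ennreal b)"

definition graph_topology :: "'v set \<Rightarrow> ('v \<times> 'v) set \<Rightarrow> 'v graph_point topology" where
  "graph_topology V E = topology (\<lambda>U. U \<subseteq> graph_points V E \<and>
     (\<forall>x\<in>U. \<exists>r>0. \<forall>y\<in>graph_points V E. graph_dist E x y < r \<longrightarrow> y \<in> U))"

lemma openin_graph_topology:
  "openin (graph_topology V E) U \<longleftrightarrow> U \<subseteq> graph_points V E \<and>
     (\<forall>x\<in>U. \<exists>r>0. \<forall>y\<in>graph_points V E. graph_dist E x y < r \<longrightarrow> y \<in> U)"
proof -
  have "istopology (\<lambda>U. U \<subseteq> graph_points V E \<and>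
     (\<forall>x\<in>U. \<exists>r>0. \<forall>y\<in>graph_points V E. graph_dist E x y < r \<longrightarrow> y \<in> U))"
    unfolding istopology_def
  proof (intro conjI allI impI; (elim conjE)?)
    fix A B
    assume A: "\<forall>x\<in>A. \<exists>r>0. \<forall>y\<in>graph_points V E. graph_dist E x y < r \<longrightarrow> y \<in> A"
      and B: "\<forall>x\<in>B. \<exists>r>0. \<forall>y\<in>graph_points V E. graph_dist E x y < r \<longrightarrow> y \<in> B"
    show "\<forall>x\<in>A \<inter> B. \<exists>r>0. \<forall>y\<in>graph_points V E. graph_dist E x y < r \<longrightarrow> y \<in> A \<inter> B"
    proof
      fix x assume "x \<in> A \<inter> B"
      then obtain r s where "r > 0" "s > 0"
        and "\<forall>y\<in>graph_points V E. graph_dist E x y < r \<longrightarrow> y \<in> A"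
        and "\<forall>y\<in>graph_points V E. graph_dist E x y < s \<longrightarrow> y \<in> B"
        using A B by blast
      then show "\<exists>r>0. \<forall>y\<in>graph_points V E. graph_dist E x y < r \<longrightarrow> y \<in> A \<inter> B"
        by (intro exI[of _ "min r s"]) auto
    qed
  next
    fix \<K> :: "'a graph_point set set"
    assume "\<forall>K\<in>\<K>. K \<subseteq> graph_points V E \<and>
      (\<forall>x\<in>K. \<exists>r>0. \<forall>y\<in>graph_points V E. graph_dist E x y < r \<longrightarrow> y \<in> K)"
    then show "\<forall>x\<in>\<Union>\<K>. \<exists>r>0. \<forall>y\<in>graph_points V E. graph_dist E x y < r \<longrightarrow> y \<in> \<Union>\<K>"
      by (meson UnionE UnionI)
  qed blast+
  then show ?thesis
    unfolding graph_topology_def by (simp add: topology_inverse')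
qed


section \<open>The train track complex and the action of the mapping class group\<close>

definition TT_vertices :: "'a punctured_surface \<Rightarrow> 'a track set set" where
  "TT_vertices S = {\<tau>. complete_track S \<tau>} //
     {(\<tau>, \<tau>'). complete_track S \<tau> \<and> complete_track S \<tau>' \<and> isotopic_tracks S \<tau> \<tau>'}"

definition TT_edges :: "'a punctured_surface \<Rightarrow> ('a track set \<times> 'a track set) set" where
  "TT_edges S = {(T, T'). T \<in> TT_vertices S \<and> T' \<in> TT_vertices S \<and>
     (\<exists>\<tau>\<in>T. \<exists>\<tau>'\<in>T'. split_of S \<tau> \<tau>')}"

definition TT :: "'a punctured_surface \<Rightarrow> 'a track set graph_point topology" where
  "TT S = graph_topology (TT_vertices S) (TT_edges S)"

definition TT_vertex_action ::
    "'a punctured_surface \<Rightarrow> ('a \<Rightarrow> 'a) set \<Rightarrow> 'a track set \<Rightarrow> 'a track set" where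
  "TT_vertex_action S \<gamma> T = {\<tau>'. complete_track S \<tau>' \<and> (\<exists>f\<in>\<gamma>. \<exists>\<tau>\<in>T. carries_onto S f \<tau> \<tau>')}"

definition TT_action ::
    "'a punctured_surface \<Rightarrow> ('a \<Rightarrow> 'a) set \<Rightarrow> 'a track set graph_point \<Rightarrow> 'a track set graph_point"
  where "TT_action S \<gamma> = map_graph_point (TT_vertex_action S \<gamma>)"

definition proper_action :: "'g set \<Rightarrow> ('g \<Rightarrow> 'x \<Rightarrow> 'x) \<Rightarrow> 'x topology \<Rightarrow> bool" where
  "proper_action G act X \<longleftrightarrow>
     (\<forall>K. compactin X K \<longrightarrow> finite {\<gamma> \<in> G. act \<gamma> ` K \<inter> K \<noteq> {}})"

end

theory Submission
  imports Defs
begin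

text \<open>A compact set of points of a metric graph has only finitely many nearby vertices, so it suffices
  that only finitely many mapping classes map one given complete train track to another one. A
  homeomorphism between two train tracks is determined up to isotopy by finitely many data: the
  induced maps of the half-branches and of the complementary regions and, for each region, the
  permutation of the sides. Indeed, if these are trivial for a self-homeomorphism, then it lifts to
  the closed disc that parametrises the closure of a region and maps each side to itself; the lift is
  isotopic to the identity, linearly along the sides, by the Alexander trick, and these isotopies
  fit together on the surface.\<close>


section \<open>Gluing isotopies\<close>


text \<open>The map from the closed disc to the closure of a region is injective on the open cell
  only: a region may lie on both sides of a branch, and a switch may be met several times. Composing
  with an inverse therefore yields a lift on the open cell alone. It extends to the circle because
  its limit values at a boundary point form a connected set inside a finite fibre. For the same
  reason the permutation of the sides is a datum of its own: two sides of one disc may run along the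
  same branch, so the images of the branches do not determine it. Lifts are built for self-maps
  only, so all homeomorphisms between two tracks are first divided by a fixed one. The isotopies of
  neighbouring cells have to agree along a common branch. The linear interpolation depends on the
  motion of the branch alone and commutes with reversing it, so it does not matter which cell sees
  the branch, or in which direction. A puncture is the origin of its disc; the given homeomorphism
  is undefined there, but the lift extends by fixing the origin, and so do both stages of the
  isotopy of the disc. Finiteness of the set of regions comes from the two local sides of each
  branch at its midpoint.\<close>

lemma glue_continuous:
  fixes q :: "'i \<Rightarrow> 'b::t2_space \<Rightarrow> 'a" and F :: "'i \<Rightarrow> real \<Rightarrow> 'b \<Rightarrow> 'b"
  assumes M: "Hausdorff_space M" and Y: "Y \<subseteq> topspace M" and I: "finite I"
    and K: "\<And>i. i \<in> I \<Longrightarrow> compact (K i)"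
    and q: "\<And>i. i \<in> I \<Longrightarrow> continuous_map (top_of_set (K i)) M (q i)"
    and F: "\<And>i. i \<in> I \<Longrightarrow> continuous_on ({0..1} \<times> K i) (\<lambda>(t, x). F i t x)"
    and FK: "\<And>i t x. i \<in> I \<Longrightarrow> t \<in> {0..1} \<Longrightarrow> x \<in> K i \<Longrightarrow> F i t x \<in> K i"
    and cover: "Y \<subseteq> (\<Union>i\<in>I. q i ` K i)"
    and compat: "\<And>i j t x y. i \<in> I \<Longrightarrow> j \<in> I \<Longrightarrow> t \<in> {0..1} \<Longrightarrow> x \<in> K i \<Longrightarrow> y \<in> K j \<Longrightarrow>
       q i x = q j y \<Longrightarrow> q i (F i t x) = q j (F j t y)"
    and FY: "\<And>i t x. i \<in> I \<Longrightarrow> t \<in> {0..1} \<Longrightarrow> x \<in> K i \<Longrightarrow> q i (F i t x) \<in> Y \<longleftrightarrow> q i x \<in> Y"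
  obtains G where
    "continuous_map (prod_topology (top_of_set {0..1}) (subtopology M Y)) (subtopology M Y)
       (\<lambda>(t, y). G t y)"
    "\<And>i t x. i \<in> I \<Longrightarrow> t \<in> {0..1} \<Longrightarrow> x \<in> K i \<Longrightarrow> q i x \<in> Y \<Longrightarrow> G t (q i x) = q i (F i t x)"
proof -
  define G where "G = (\<lambda>t y. let p = (SOME p. fst p \<in> I \<and> snd p \<in> K (fst p) \<and> q (fst p) (snd p) = y)
     in q (fst p) (F (fst p) t (snd p)))"
  have G: "G t (q i x) = q i (F i t x)" if "i \<in> I" "t \<in> {0..1}" "x \<in> K i" for i t x
  proof -
    let ?P = "\<lambda>p. fst p \<in> I \<and> snd p \<in> K (fst p) \<and> q (fst p) (snd p) = q i x"
    define p where "p = (SOME p. ?P p)"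
    have "?P p"
      unfolding p_def by (rule someI[of ?P "(i, x)"]) (use that in simp)
    moreover have "G t (q i x) = q (fst p) (F (fst p) t (snd p))"
      unfolding G_def p_def Let_def ..
    ultimately show ?thesis
      using compat[of "fst p" i t "snd p" x] that by simp
  qed
  let ?T = "top_of_set {0..1::real}"
  have top: "topspace (subtopology M Y) = Y"
    using Y by auto
  have "continuous_map (prod_topology ?T (subtopology M Y)) (subtopology M Y) (\<lambda>(t, y). G t y)"
    unfolding continuous_map_closedin
  proof (intro conjI allI impI funcsetI)
    fix z assume "z \<in> topspace (prod_topology ?T (subtopology M Y))"
    then obtain t y where z: "z = (t, y)" "t \<in> {0..1}" "y \<in> Y"
      by auto
    with cover obtain i x where "i \<in> I" "x \<in> K i" "y = q i x"
      by blast
    with z G FY show "(\<lambda>(t, y). G t y) z \<in> topspace (subtopology M Y)"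
      unfolding top by simp
  next
    fix C assume "closedin (subtopology M Y) C"
    then obtain D where D: "closedin M D" "C = D \<inter> Y"
      by (auto simp: closedin_subtopology)
    \<comment> \<open>Continuity is tested on closed sets. On one piece the preimage of
      \<open>D\<close> is a closed subset \<open>?A i\<close> of a compact set, so its image
      \<open>?B i\<close> in the product of the unit interval with the Hausdorff space
      \<open>M\<close> is closed, and finitely many pieces give a closed union. The argument runs
      over \<open>M\<close> and is cut down to \<open>Y\<close> at the end, because a piece may
      contain points that \<open>q\<close> sends outside \<open>Y\<close>, such as
      punctures.\<close>
    let ?A = "\<lambda>i. {z \<in> {0..1} \<times> K i. (q i \<circ> (\<lambda>(t, x). F i t x)) z \<in> D}"
    let ?B = "\<lambda>i. (\<lambda>z. (fst z, q i (snd z))) ` ?A i"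
    have B: "closedin (prod_topology ?T M) (?B i)" if i: "i \<in> I" for i
    proof -
      have "continuous_map (top_of_set ({0..1} \<times> K i)) (top_of_set (K i)) (\<lambda>(t, x). F i t x)"
        using F[OF i] FK[OF i] by (auto simp: image_subset_iff)
      then have "continuous_map (top_of_set ({0..1} \<times> K i)) M (q i \<circ> (\<lambda>(t, x). F i t x))"
        using q[OF i] continuous_map_compose by blast
      then have "closedin (top_of_set ({0..1} \<times> K i)) (?A i)"
        using D(1) closedin_continuous_map_preimage by fastforce
      then have "compact (?A i)"
        using closedin_compact[OF compact_Times[OF compact_Icc K[OF i]]] by blast
      then have "compactin (top_of_set ({0..1} \<times> K i)) (?A i)"
        by (simp add: compactin_subtopology)
      moreover have "continuous_map (prod_topology ?T (top_of_set (K i))) (prod_topology ?T M)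
          (\<lambda>z. (fst z, q i (snd z)))"
        by (intro continuous_map_pairedI continuous_map_fst
            continuous_map_compose[OF continuous_map_snd q[OF i], unfolded o_def])
      then have "continuous_map (top_of_set ({0..1} \<times> K i)) (prod_topology ?T M)
          (\<lambda>z. (fst z, q i (snd z)))"
        by simp
      ultimately have "compactin (prod_topology ?T M) (?B i)"
        using image_compactin by blast
      moreover have "Hausdorff_space (prod_topology ?T M)"
        using M Hausdorff_space_prod_topology
        by (metis Hausdorff_space_euclidean Hausdorff_space_subtopology)
      ultimately show ?thesis
        using compactin_imp_closedin by blast
    qed
    have "closedin (prod_topology ?T M) (\<Union>i\<in>I. ?B i)"
      using I B by (intro closedin_Union) auto
    then have "closedin (subtopology (prod_topology ?T M) (topspace ?T \<times> Y))
        ((\<Union>i\<in>I. ?B i) \<inter> (topspace ?T \<times> Y))"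
      by (auto simp: closedin_subtopology)
    moreover have "subtopology (prod_topology ?T M) (topspace ?T \<times> Y) = prod_topology ?T (subtopology M Y)"
      by (metis prod_topology_subtopology(2) subtopology_topspace subtopology_Times)
    moreover have "{z \<in> topspace (prod_topology ?T (subtopology M Y)). (\<lambda>(t, y). G t y) z \<in> C}
        = (\<Union>i\<in>I. ?B i) \<inter> (topspace ?T \<times> Y)" (is "?L = ?R")
    proof (intro equalityI subsetI)
      fix z assume z: "z \<in> ?L"
      then obtain t y where ty: "z = (t, y)" "t \<in> {0..1}" "y \<in> Y" "G t y \<in> D"
        using D by auto
      with cover obtain i x where ix: "i \<in> I" "x \<in> K i" "y = q i x"
        by blast
      then have "(t, x) \<in> ?A i"
        using ty G by simp
      then have "z \<in> ?B i"
        by (rule rev_image_eqI) (use ty ix in simp)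
      then show "z \<in> ?R"
        using ix ty by auto
    next
      fix z assume "z \<in> ?R"
      then show "z \<in> ?L"
        unfolding mem_Collect_eq topspace_prod_topology top using D FY by (auto simp: G)
    qed
    ultimately show "closedin (prod_topology ?T (subtopology M Y))
        {z \<in> topspace (prod_topology ?T (subtopology M Y)). (\<lambda>(t, y). G t y) z \<in> C}"
      by simp
  qed
  then show thesis
    using that G by blast
qed

text \<open>The equivalence in \<open>compat\<close> says that exactly the original identifications
  persist at every time. Hence the inverses of the \<open>F i t\<close> respect them too, and they
  glue to an inverse of the glued map.\<close>

lemma glue_isotopy:
  fixes q :: "'i \<Rightarrow> 'b::t2_space \<Rightarrow> 'a" and F :: "'i \<Rightarrow> real \<Rightarrow> 'b \<Rightarrow> 'b"
  assumes M: "Hausdorff_space M" and Y: "Y \<subseteq> topspace M" and I: "finite I"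
    and K: "\<And>i. i \<in> I \<Longrightarrow> compact (K i)"
    and q: "\<And>i. i \<in> I \<Longrightarrow> continuous_map (top_of_set (K i)) M (q i)"
    and F: "\<And>i. i \<in> I \<Longrightarrow> continuous_on ({0..1} \<times> K i) (\<lambda>(t, x). F i t x)"
    and bij: "\<And>i t. i \<in> I \<Longrightarrow> t \<in> {0..1} \<Longrightarrow> bij_betw (F i t) (K i) (K i)"
    and cover: "Y \<subseteq> (\<Union>i\<in>I. q i ` K i)"
    and compat: "\<And>i j t x y. i \<in> I \<Longrightarrow> j \<in> I \<Longrightarrow> t \<in> {0..1} \<Longrightarrow> x \<in> K i \<Longrightarrow> y \<in> K j \<Longrightarrow>
       q i (F i t x) = q j (F j t y) \<longleftrightarrow> q i x = q j y"
    and FY: "\<And>i t x. i \<in> I \<Longrightarrow> t \<in> {0..1} \<Longrightarrow> x \<in> K i \<Longrightarrow> q i (F i t x) \<in> Y \<longleftrightarrow> q i x \<in> Y"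
  obtains G where
    "continuous_map (prod_topology (top_of_set {0..1}) (subtopology M Y)) (subtopology M Y)
       (\<lambda>(t, y). G t y)"
    "\<And>t. t \<in> {0..1} \<Longrightarrow> homeomorphic_map (subtopology M Y) (subtopology M Y) (G t)"
    "\<And>i t x. i \<in> I \<Longrightarrow> t \<in> {0..1} \<Longrightarrow> x \<in> K i \<Longrightarrow> q i x \<in> Y \<Longrightarrow> G t (q i x) = q i (F i t x)"
proof -
  have FK: "F i t x \<in> K i" if "i \<in> I" "t \<in> {0..1}" "x \<in> K i" for i t x
    using bij[OF that(1,2)] that(3) by (auto simp: bij_betw_def)
  obtain G where G: "continuous_map (prod_topology (top_of_set {0..1}) (subtopology M Y)) (subtopology M Y)
       (\<lambda>(t, y). G t y)"
    and Gq: "\<And>i t x. i \<in> I \<Longrightarrow> t \<in> {0..1} \<Longrightarrow> x \<in> K i \<Longrightarrow> q i x \<in> Y \<Longrightarrow> G t (q i x) = q i (F i t x)"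
  proof (rule glue_continuous[where M = M and Y = Y and I = I and K = K and q = q and F = F,
        OF M Y I K q F FK cover _ FY])
    show "q i (F i t x) = q j (F j t y)"
      if "i \<in> I" "j \<in> I" "t \<in> {0..1}" "x \<in> K i" "y \<in> K j" "q i x = q j y" for i j t x y
      using compat[OF that(1-5)] that(6) by blast
  next
    fix G :: "real \<Rightarrow> 'a \<Rightarrow> 'a"
    assume "continuous_map (prod_topology (top_of_set {0..1}) (subtopology M Y)) (subtopology M Y)
        (\<lambda>(t, y). G t y)"
      "\<And>i t x. i \<in> I \<Longrightarrow> t \<in> {0..1} \<Longrightarrow> x \<in> K i \<Longrightarrow> q i x \<in> Y \<Longrightarrow> G t (q i x) = q i (F i t x)"
    then show thesis
      by (rule that)
  qed assumption+
  have top: "topspace (subtopology M Y) = Y"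
    using Y by auto
  have slice: "continuous_map (subtopology M Y) (subtopology M Y) (H t)"
    if H: "continuous_map (prod_topology (top_of_set {0..1}) (subtopology M Y)) (subtopology M Y)
       (\<lambda>(t, y). H t y)" and t: "t \<in> {0..1}" for H :: "real \<Rightarrow> 'a \<Rightarrow> 'a" and t
  proof -
    have "continuous_map (subtopology M Y) (prod_topology (top_of_set {0..1}) (subtopology M Y)) (\<lambda>y. (t, y))"
      using t by (intro continuous_map_pairedI) auto
    from continuous_map_compose[OF this H] show ?thesis
      by (simp add: o_def)
  qed
  have "homeomorphic_map (subtopology M Y) (subtopology M Y) (G t)" if t: "t \<in> {0..1}" for t
  proof -
    \<comment> \<open>With \<open>t\<close> frozen, the inverses are viewed as a family constant in
      a dummy time \<open>s\<close>, so that \<open>glue_continuous\<close> applies; only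
      \<open>H 0\<close> is used afterwards.\<close>
    let ?F = "\<lambda>i (s::real). inv_into (K i) (F i t)"
    have inv: "?F i s x \<in> K i" "F i t (?F i s x) = x" if "i \<in> I" "x \<in> K i" for i x and s :: real
      using bij[OF that(1) t] that
      by (simp_all add: bij_betw_def inv_into_into f_inv_into_f)
    have inv': "?F i s (F i t x) = x" if "i \<in> I" "x \<in> K i" for i x and s :: real
      using bij[OF that(1) t] that by (simp add: bij_betw_def)
    have contF: "continuous_on (K i) (?F i s)" if i: "i \<in> I" for i and s :: real
    proof -
      have c: "continuous_on (K i) (F i t)"
      proof -
        have "continuous_on (K i) ((\<lambda>(t, x). F i t x) \<circ> (\<lambda>x. (t, x)))"
          using t by (intro continuous_on_compose continuous_intros continuous_on_subset[OF F[OF i]]) auto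
        then show ?thesis
          by (simp add: o_def)
      qed
      have "continuous_on (F i t ` K i) (?F i s)"
        by (rule continuous_on_inv[OF c K[OF i]]) (use inv' i in auto)
      then show ?thesis
        using bij[OF i t] by (simp add: bij_betw_def)
    qed
    obtain H where H: "continuous_map (prod_topology (top_of_set {0..1}) (subtopology M Y)) (subtopology M Y)
        (\<lambda>(t, y). H t y)"
      and Hq: "\<And>i t x. i \<in> I \<Longrightarrow> t \<in> {0..1} \<Longrightarrow> x \<in> K i \<Longrightarrow> q i x \<in> Y \<Longrightarrow> H t (q i x) = q i (?F i t x)"
    proof (rule glue_continuous[where M = M and Y = Y and I = I and K = K and q = q and F = ?F,
          OF M Y I K q _ _ cover])
      show "continuous_on ({0..1} \<times> K i) (\<lambda>(s, x). ?F i s x)" if i: "i \<in> I" for i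
      proof -
        have "continuous_on ({0..1} \<times> K i) (?F i 0 \<circ> snd)"
          by (intro continuous_on_compose continuous_intros continuous_on_subset[OF contF[OF i]]) auto
        then show ?thesis
          by (simp add: o_def case_prod_beta)
      qed
      show "q i (?F i s x) = q j (?F j s y)"
        if "i \<in> I" "j \<in> I" "x \<in> K i" "y \<in> K j" "q i x = q j y" for i j x y and s :: real
        using compat[OF that(1,2) t inv(1)[OF that(1,3)] inv(1)[OF that(2,4)]] that inv by simp
      show "q i (?F i s x) \<in> Y \<longleftrightarrow> q i x \<in> Y" if "i \<in> I" "x \<in> K i" for i x and s :: real
        using FY[OF that(1) t inv(1)[OF that]] inv(2)[OF that] by simp
    next
      fix H :: "real \<Rightarrow> 'a \<Rightarrow> 'a"
      assume "continuous_map (prod_topology (top_of_set {0..1}) (subtopology M Y)) (subtopology M Y)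
          (\<lambda>(t, y). H t y)"
        "\<And>i t x. i \<in> I \<Longrightarrow> t \<in> {0..1} \<Longrightarrow> x \<in> K i \<Longrightarrow> q i x \<in> Y \<Longrightarrow> H t (q i x) = q i (?F i t x)"
      then show thesis
        by (rule that)
    qed (use inv in auto)
    have "homeomorphic_maps (subtopology M Y) (subtopology M Y) (G t) (H 0)"
      unfolding homeomorphic_maps_def top
    proof (intro conjI ballI)
      show "continuous_map (subtopology M Y) (subtopology M Y) (G t)"
        "continuous_map (subtopology M Y) (subtopology M Y) (H 0)"
        using slice[OF G t] slice[OF H] by auto
      fix y assume "y \<in> Y"
      with cover obtain i x where ix: "i \<in> I" "x \<in> K i" "y = q i x"
        by blast
      have "q i (F i t x) \<in> Y" "q i (?F i 0 x) \<in> Y"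
        using FY[OF ix(1) t ix(2)] FY[OF ix(1) t inv(1)[OF ix(1,2)]] inv(2)[OF ix(1,2)] ix \<open>y \<in> Y\<close>
        by auto
      then show "H 0 (G t y) = y" "G t (H 0 y) = y"
        using ix \<open>y \<in> Y\<close> t FK inv inv' by (auto simp: Gq Hq)
    qed
    then show ?thesis
      by (rule homeomorphic_maps_imp_map)
  qed
  then show thesis
    using that G Gq by blast
qed


section \<open>Isotopies of the closed disc\<close>


text \<open>This is the condition on the reparametrisation in \<open>maps_half\<close>. It is stable
  under composition, inversion and linear interpolation to the identity; since 0 and 1 stay fixed
  throughout, switches do not move during such an interpolation.\<close>

definition reparam :: "(real \<Rightarrow> real) \<Rightarrow> bool" where
  "reparam \<rho> \<longleftrightarrow> continuous_on {0..1} \<rho> \<and> strict_mono_on {0..1} \<rho> \<and> \<rho> 0 = 0 \<and> \<rho> 1 = 1"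

lemma reparam_less: "reparam \<rho> \<Longrightarrow> 0 \<le> s \<Longrightarrow> s < s' \<Longrightarrow> s' \<le> 1 \<Longrightarrow> \<rho> s < \<rho> s'"
  unfolding reparam_def strict_mono_on_def by simp

lemma reparam_bounds:
  assumes "reparam \<rho>" "s \<in> {0..1}"
  shows "\<rho> s \<in> {0..1}" "\<rho> s = 0 \<longleftrightarrow> s = 0" "\<rho> s = 1 \<longleftrightarrow> s = 1" "\<rho> s \<in> {0<..<1} \<longleftrightarrow> s \<in> {0<..<1}"
proof -
  have 0: "\<rho> 0 = 0" "\<rho> 1 = 1"
    using assms by (auto simp: reparam_def)
  have "s = 0 \<or> 0 < s \<and> 0 < \<rho> s"
    using reparam_less[OF assms(1), of 0 s] assms(2) 0 by (cases "0 < s") auto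
  moreover have "s = 1 \<or> s < 1 \<and> \<rho> s < 1"
    using reparam_less[OF assms(1), of s 1] assms(2) 0 by (cases "s < 1") auto
  ultimately show "\<rho> s \<in> {0..1}" "\<rho> s = 0 \<longleftrightarrow> s = 0" "\<rho> s = 1 \<longleftrightarrow> s = 1" "\<rho> s \<in> {0<..<1} \<longleftrightarrow> s \<in> {0<..<1}"
    using 0 assms(2) by (auto simp: less_le)
qed

lemma reparam_eq_iff:
  assumes "reparam \<rho>" "s \<in> {0..1}" "s' \<in> {0..1}"
  shows "\<rho> s = \<rho> s' \<longleftrightarrow> s = s'"
  using assms by (metis strict_mono_on_eqD reparam_def)

lemma reparam_bij:
  assumes "reparam \<rho>"
  shows "bij_betw \<rho> {0..1} {0..1}"
proof -
  have "y \<in> \<rho> ` {0..1}" if "y \<in> {0..1}" for y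
    using IVT'[of \<rho> 0 y 1] assms that by (auto simp: reparam_def)
  then show ?thesis
    using reparam_bounds(1)[OF assms] reparam_eq_iff[OF assms]
    by (intro bij_betw_imageI inj_onI equalityI subsetI) auto
qed

lemma reparam_interpolate:
  assumes "reparam \<rho>" "t \<in> {0..1}"
  shows "reparam (\<lambda>s. (1 - t) * \<rho> s + t * s)"
  unfolding reparam_def
proof (intro conjI)
  show "strict_mono_on {0..1} (\<lambda>s. (1 - t) * \<rho> s + t * s)"
  proof (rule strict_mono_onI)
    fix r s :: real assume rs: "r \<in> {0..1}" "s \<in> {0..1}" "r < s"
    then have "\<rho> r < \<rho> s"
      using reparam_less[OF assms(1)] by simp
    show "(1 - t) * \<rho> r + t * r < (1 - t) * \<rho> s + t * s"
    proof (cases "t = 1")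
      case False
      then have "(1 - t) * \<rho> r < (1 - t) * \<rho> s"
        using \<open>\<rho> r < \<rho> s\<close> assms(2) by simp
      moreover have "t * r \<le> t * s"
        using rs assms(2) by (simp add: mult_left_mono)
      ultimately show ?thesis
        by linarith
    qed (use rs in simp)
  qed
qed (use assms in \<open>auto simp: reparam_def intro!: continuous_intros\<close>)

lemma reparam_compose:
  assumes "reparam \<rho>" "reparam \<rho>'"
  shows "reparam (\<rho>' \<circ> \<rho>)"
  unfolding reparam_def
proof (intro conjI)
  have "continuous_on (\<rho> ` {0..1}) \<rho>'"
    using assms(2) reparam_bij[OF assms(1)] by (auto simp: reparam_def bij_betw_def)
  then show "continuous_on {0..1} (\<rho>' \<circ> \<rho>)"
    using assms(1) by (intro continuous_on_compose) (auto simp: reparam_def)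
  show "strict_mono_on {0..1} (\<rho>' \<circ> \<rho>)"
  proof (rule strict_mono_onI)
    fix r s :: real assume rs: "r \<in> {0..1}" "s \<in> {0..1}" "r < s"
    then have "\<rho> r < \<rho> s" "0 \<le> \<rho> r" "\<rho> s \<le> 1"
      using reparam_less[OF assms(1)] reparam_bounds(1)[OF assms(1)] by auto
    then show "(\<rho>' \<circ> \<rho>) r < (\<rho>' \<circ> \<rho>) s"
      using reparam_less[OF assms(2)] by simp
  qed
qed (use assms in \<open>auto simp: reparam_def\<close>)

lemma reparam_inverse:
  assumes "reparam \<rho>"
  obtains \<rho>' where "reparam \<rho>'" "\<And>s. s \<in> {0..1} \<Longrightarrow> \<rho>' (\<rho> s) = s"
proof
  let ?r = "inv_into {0..1} \<rho>"
  have bij: "bij_betw \<rho> {0..1} {0..1}"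
    by (rule reparam_bij[OF assms])
  show inv: "?r (\<rho> s) = s" if "s \<in> {0..1}" for s
    using bij that by (simp add: bij_betw_def)
  show "reparam ?r"
    unfolding reparam_def
  proof (intro conjI)
    have "continuous_on (\<rho> ` {0..1}) ?r"
      by (rule continuous_on_inv) (use assms inv in \<open>auto simp: reparam_def\<close>)
    then show "continuous_on {0..1} ?r"
      using bij by (simp add: bij_betw_def)
    show "?r 0 = 0" "?r 1 = 1"
      using inv[of 0] inv[of 1] assms by (auto simp: reparam_def)
    show "strict_mono_on {0..1} ?r"
    proof (rule strict_mono_onI)
      fix a b :: real assume ab: "a \<in> {0..1}" "b \<in> {0..1}" "a < b"
      then obtain r s where rs: "r \<in> {0..1}" "s \<in> {0..1}" "a = \<rho> r" "b = \<rho> s"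
        using bij unfolding bij_betw_def by (metis imageE)
      then have "r < s"
        using reparam_less[OF assms, of s r] ab by (cases r s rule: linorder_cases) auto
      then show "?r a < ?r b"
        using rs inv by simp
    qed
  qed
qed

text \<open>The unit circle divided into \<open>m\<close> arcs as in \<^const>\<open>boundary_with_cusps\<close>.\<close>

definition circle_arc :: "nat \<Rightarrow> nat \<Rightarrow> real \<Rightarrow> complex" where
  "circle_arc m j s = cis (2 * pi * (real j + s) / real m)"

lemma norm_circle_arc [simp]: "norm (circle_arc m j s) = 1"
  by (simp add: circle_arc_def)

lemma continuous_on_circle_arc: "continuous_on A (circle_arc m j)"
  unfolding circle_arc_def by (cases "m = 0") (auto intro!: continuous_intros simp: cis_conv_exp)

lemma circle_arc_angle:
  assumes "j < m" "s \<in> {0..<1}"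
  shows "0 \<le> 2 * pi * (real j + s) / real m" "2 * pi * (real j + s) / real m < 2 * pi"
proof -
  have "real (Suc j) \<le> real m"
    using assms(1) by (simp only: of_nat_le_iff Suc_le_eq)
  then have "2 * pi * (real j + s) < 2 * pi * real m"
    using assms(2) by simp
  then show "2 * pi * (real j + s) / real m < 2 * pi"
    using assms(1) by (simp add: pos_divide_less_eq)
qed (use assms in auto)

lemma circle_arc_inj:
  assumes "j < m" "j' < m" "s \<in> {0..<1}" "s' \<in> {0..<1}" "circle_arc m j s = circle_arc m j' s'"
  shows "j = j'" "s = s'"
proof -
  have A: "Arg2pi (circle_arc m i r) = 2 * pi * (real i + r) / real m" if "i < m" "r \<in> {0..<1}" for i r
    by (rule Arg2pi_unique[where r = 1]) (use circle_arc_angle[OF that] in \<open>auto simp: circle_arc_def cis_conv_exp\<close>)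
  have eq: "real j + s = real j' + s'"
    using A[of j s] A[of j' s'] assms by simp
  have "\<lfloor>real j + s\<rfloor> = int j" "\<lfloor>real j' + s'\<rfloor> = int j'"
    using assms by (auto simp: floor_unique)
  then show "j = j'"
    using eq by simp
  then show "s = s'"
    using eq by simp
qed

lemma circle_arc_cover:
  assumes "m > 0" "norm z = 1"
  obtains j s where "j < m" "s \<in> {0..<1}" "z = circle_arc m j s"
proof -
  define x where "x = real m * Arg2pi z / (2 * pi)"
  have x: "0 \<le> x" "x < real m"
    using Arg2pi[of z] assms by (auto simp: x_def field_simps)
  have "real (nat \<lfloor>x\<rfloor>) + frac x = x"
    using x by (simp add: frac_def)
  then have "2 * pi * (real (nat \<lfloor>x\<rfloor>) + frac x) / real m = Arg2pi z"
    using assms by (simp add: x_def)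
  moreover have "cis (Arg2pi z) = z"
    using assms(2) by (simp add: cis_conv_exp complex_norm_eq_1_exp)
  ultimately have "z = circle_arc m (nat \<lfloor>x\<rfloor>) (frac x)"
    by (simp add: circle_arc_def)
  moreover have "nat \<lfloor>x\<rfloor> < m"
    using x by linarith
  ultimately show thesis
    using that[of "nat \<lfloor>x\<rfloor>" "frac x"] by (simp add: frac_lt_1)
qed

lemma circle_arc_end:
  assumes "j < m"
  shows "circle_arc m j 1 = circle_arc m (Suc j mod m) 0"
proof (cases "Suc j = m")
  case True
  then have "2 * pi * (real j + 1) / real m = 2 * pi"
    by (simp add: field_simps flip: True)
  then show ?thesis
    using True by (simp add: circle_arc_def)
next
  case False
  then show ?thesis
    using assms by (simp add: circle_arc_def add.commute)
qed

text \<open>A point with parameter 1 is renamed as the point with parameter 0 on the next arc,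
  cyclically, so that every point of the circle has one name. Reparametrisations fix 0 and 1 and
  therefore respect this renaming, which is how the criterion gets used.\<close>

lemma circle_arc_eq_iff:
  assumes "j < m" "j' < m" "s \<in> {0..1}" "s' \<in> {0..1}"
  shows "circle_arc m j s = circle_arc m j' s' \<longleftrightarrow>
    (if s = 1 then (Suc j mod m, 0) else (j, s)) = (if s' = 1 then (Suc j' mod m, 0) else (j', s'))"
proof -
  define c where "c = (\<lambda>j s. if s = 1 then (Suc j mod m, 0::real) else (j, s))"
  have c: "fst (c i r) < m" "snd (c i r) \<in> {0..<1}" "circle_arc m i r = circle_arc m (fst (c i r)) (snd (c i r))"
    if "i < m" "r \<in> {0..1}" for i r
    using that circle_arc_end[of i m] by (auto simp: c_def)
  have "circle_arc m j s = circle_arc m j' s' \<longleftrightarrow> c j s = c j' s'"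
    using circle_arc_inj[OF c(1)[OF assms(1,3)] c(1)[OF assms(2,4)] c(2)[OF assms(1,3)] c(2)[OF assms(2,4)]]
      c(3)[OF assms(1,3)] c(3)[OF assms(2,4)] by (metis prod.collapse)
  then show ?thesis
    by (simp add: c_def)
qed

text \<open>The disc is the cone over its boundary circle: letting every concentric circle move like
  the boundary extends the interpolated reparametrisations and preserves norms. Continuity at the
  origin and across the rays between sectors comes from \<open>glue_isotopy\<close>.\<close>

lemma cone_isotopy:
  assumes m: "m > 0" and \<rho>: "\<And>j. j < m \<Longrightarrow> reparam (\<rho> j)"
  obtains E :: "real \<Rightarrow> complex \<Rightarrow> complex" where
    "continuous_on ({0..1} \<times> cball 0 1) (\<lambda>(t, z). E t z)"
    "\<And>t. t \<in> {0..1} \<Longrightarrow> bij_betw (E t) (cball 0 1) (cball 0 1)"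
    "\<And>t z. t \<in> {0..1} \<Longrightarrow> z \<in> cball 0 1 \<Longrightarrow> norm (E t z) = norm z"
    "\<And>z. z \<in> cball 0 1 \<Longrightarrow> E 1 z = z"
    "\<And>t j s. t \<in> {0..1} \<Longrightarrow> j < m \<Longrightarrow> s \<in> {0..1} \<Longrightarrow> E t (circle_arc m j s) = circle_arc m j ((1 - t) * \<rho> j s + t * s)"
proof -
  let ?K = "{0..1::real} \<times> {0..1::real}"
  \<comment> \<open>Polar coordinates on sector \<open>j\<close>: the square records the radius and
    the position on the arc, and its edge of radius 0 collapses to the origin.\<close>
  define q where "q = (\<lambda>j (p::real \<times> real). fst p *\<^sub>R circle_arc m j (snd p))"
  define u where "u = (\<lambda>j t s. (1 - t) * \<rho> j s + t * s)"
  define F where "F = (\<lambda>j t (p::real \<times> real). (fst p, u j t (snd p)))"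
  have u: "reparam (u j t)" if "j < m" "t \<in> {0..1}" for j t
    unfolding u_def using reparam_interpolate[OF \<rho>[OF that(1)] that(2)] .
  have cover: "\<exists>j r s. j < m \<and> r \<in> {0..1} \<and> s \<in> {0..1} \<and> z = q j (r, s)" if z: "z \<in> cball 0 1" for z
  proof (cases "z = 0")
    case True
    then show ?thesis
      using m by (intro exI[of _ 0]) (auto simp: q_def)
  next
    case False
    then have "norm (sgn z) = 1"
      by (simp add: norm_sgn)
    then obtain j s where js: "j < m" "s \<in> {0..<1}" "sgn z = circle_arc m j s"
      using circle_arc_cover m by metis
    then have "z = q j (norm z, s)"
      using False by (simp add: q_def sgn_div_norm flip: js(3))
    then show ?thesis
      using js z by (intro exI[of _ j] exI[of _ "norm z"] exI[of _ s]) auto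
  qed
  have normq: "norm (q j p) = \<bar>fst p\<bar>" for j p
    by (simp add: q_def)
  obtain G where
    G: "continuous_map (prod_topology (top_of_set {0..1}) (subtopology euclidean (cball 0 1)))
       (subtopology euclidean (cball 0 1)) (\<lambda>(t, y). G t y)"
    and hom: "\<And>t. t \<in> {0..1} \<Longrightarrow>
       homeomorphic_map (subtopology euclidean (cball 0 1)) (subtopology euclidean (cball 0 1)) (G t)"
    and Gq: "\<And>i t x. i \<in> {..<m} \<Longrightarrow> t \<in> {0..1} \<Longrightarrow> x \<in> ?K \<Longrightarrow> q i x \<in> cball 0 1 \<Longrightarrow> G t (q i x) = q i (F i t x)"
  proof (rule glue_isotopy[where M = euclidean and Y = "cball (0::complex) 1" and I = "{..<m}"
        and K = "\<lambda>_. ?K" and q = q and F = F])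
    show "Hausdorff_space (euclidean :: complex topology)"
      by simp
    show "continuous_map (top_of_set ?K) euclidean (q i)" if "i \<in> {..<m}" for i
      unfolding q_def
      by (auto intro!: continuous_intros continuous_on_compose2[OF continuous_on_circle_arc[of UNIV]])
    show "continuous_on ({0..1} \<times> ?K) (\<lambda>(t, x). F i t x)" if "i \<in> {..<m}" for i
    proof -
      have "continuous_on {0..1} (\<rho> i)"
        using \<rho> that by (simp add: reparam_def)
      then have "continuous_on ({0..1} \<times> ?K) (\<lambda>z. \<rho> i (snd (snd z)))"
        by (rule continuous_on_compose2) (auto intro!: continuous_intros)
      then show ?thesis
        unfolding F_def u_def case_prod_beta by (intro continuous_intros)
    qed
    show "bij_betw (F i t) ?K ?K" if "i \<in> {..<m}" "t \<in> {0..1}" for i t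
    proof -
      have "bij_betw (map_prod id (u i t)) ?K ?K"
        using reparam_bij[OF u] that by (intro bij_betw_map_prod) auto
      moreover have "map_prod id (u i t) = F i t"
        by (auto simp: F_def map_prod_def)
      ultimately show ?thesis
        by simp
    qed
    show "cball 0 1 \<subseteq> (\<Union>i\<in>{..<m}. q i ` ?K)"
      using cover by fastforce
    show "q i (F i t x) = q j (F j t y) \<longleftrightarrow> q i x = q j y"
      if "i \<in> {..<m}" "j \<in> {..<m}" "t \<in> {0..1}" "x \<in> ?K" "y \<in> ?K" for i j t x y
    proof -
      obtain r s r' s' where xy: "x = (r, s)" "y = (r', s')"
        by (cases x, cases y)
      have b: "r \<in> {0..1}" "s \<in> {0..1}" "r' \<in> {0..1}" "s' \<in> {0..1}" "i < m" "j < m"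
        using that xy by auto
      have ub: "u i t s \<in> {0..1}" "u j t s' \<in> {0..1}" "u i t s = 1 \<longleftrightarrow> s = 1" "u j t s' = 1 \<longleftrightarrow> s' = 1"
         "u i t s = 0 \<longleftrightarrow> s = 0" "u j t s' = 0 \<longleftrightarrow> s' = 0"
        using reparam_bounds[OF u] b that(3) by auto
      have arcs: "circle_arc m i (u i t s) = circle_arc m j (u j t s') \<longleftrightarrow> circle_arc m i s = circle_arc m j s'"
        using reparam_eq_iff[OF u[OF b(5) that(3)] b(2,4)] ub
        unfolding circle_arc_eq_iff[OF b(5,6) ub(1,2)] circle_arc_eq_iff[OF b(5,6,2,4)] by auto
      have eqn: "q i p = q j p' \<longleftrightarrow> fst p = fst p' \<and> (fst p = 0 \<or> circle_arc m i (snd p) = circle_arc m j (snd p'))"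
        if "0 \<le> fst p" "0 \<le> fst p'" for p p'
      proof
        assume eq: "q i p = q j p'"
        then have "fst p = fst p'"
          using normq[of i p] normq[of j p'] that by simp
        with eq show "fst p = fst p' \<and> (fst p = 0 \<or> circle_arc m i (snd p) = circle_arc m j (snd p'))"
          by (auto simp: q_def)
      qed (auto simp: q_def)
      show ?thesis
        using b arcs by (subst (1 2) eqn) (auto simp: xy F_def)
    qed
    show "q i (F i t x) \<in> cball 0 1 \<longleftrightarrow> q i x \<in> cball 0 1" for i t x
      by (simp add: normq F_def)
  next
    fix G :: "real \<Rightarrow> complex \<Rightarrow> complex"
    assume "continuous_map (prod_topology (top_of_set {0..1}) (top_of_set (cball 0 1)))
       (top_of_set (cball 0 1)) (\<lambda>(t, y). G t y)"
    "\<And>t. t \<in> {0..1} \<Longrightarrow> homeomorphic_map (top_of_set (cball 0 1)) (top_of_set (cball 0 1)) (G t)"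
    "\<And>i t x. i \<in> {..<m} \<Longrightarrow> t \<in> {0..1} \<Longrightarrow> x \<in> ?K \<Longrightarrow> q i x \<in> cball 0 1 \<Longrightarrow> G t (q i x) = q i (F i t x)"
    then show thesis
      by (rule that)
  qed (auto intro: compact_Times)
  have Gq': "G t (q j (r, s)) = q j (r, u j t s)" if "j < m" "t \<in> {0..1}" "r \<in> {0..1}" "s \<in> {0..1}" for j t r s
    using Gq[of j t "(r, s)"] that by (simp add: F_def normq)
  show thesis
  proof (rule that)
    show "continuous_on ({0..1} \<times> cball 0 1) (\<lambda>(t, z). G t z)"
      using G by simp
    show "bij_betw (G t) (cball 0 1) (cball 0 1)" if "t \<in> {0..1}" for t
      using homeomorphic_imp_injective_map[OF hom[OF that]] homeomorphic_imp_surjective_map[OF hom[OF that]]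
      by (simp add: bij_betw_def)
    show "norm (G t z) = norm z" if t: "t \<in> {0..1}" and z: "z \<in> cball 0 1" for t z
      using cover[OF z] Gq' t by (auto simp: normq)
    show "G 1 z = z" if z: "z \<in> cball 0 1" for z
      using cover[OF z] Gq' by (auto simp: u_def)
    show "G t (circle_arc m j s) = circle_arc m j ((1 - t) * \<rho> j s + t * s)"
      if "t \<in> {0..1}" "j < m" "s \<in> {0..1}" for t j s
      using Gq'[OF that(2,1) _ that(3), of 1] by (simp add: q_def u_def)
  qed
qed

text \<open>At time \<open>t\<close> a copy of \<open>k\<close> shrunk by the factor
  \<open>1 - t\<close> acts on the disc of radius \<open>1 - t\<close>, and the identity acts
  outside. Shrinking is centred at the origin, so the origin stays fixed if \<open>k\<close> fixes
  it; this serves the punctured cells.\<close>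

lemma alexander_trick:
  fixes k :: "complex \<Rightarrow> complex"
  assumes cont: "continuous_on (cball 0 1) k" and bij: "bij_betw k (cball 0 1) (cball 0 1)"
    and fix1: "\<And>z. norm z = 1 \<Longrightarrow> k z = z"
  obtains A :: "real \<Rightarrow> complex \<Rightarrow> complex" where
    "continuous_on ({0..1} \<times> cball 0 1) (\<lambda>(t, z). A t z)"
    "\<And>t. t \<in> {0..1} \<Longrightarrow> bij_betw (A t) (cball 0 1) (cball 0 1)"
    "\<And>z. z \<in> cball 0 1 \<Longrightarrow> A 0 z = k z"
    "\<And>z. A 1 z = z"
    "\<And>t z. t \<in> {0..1} \<Longrightarrow> norm z = 1 \<Longrightarrow> A t z = z"
    "\<And>t. k 0 = 0 \<Longrightarrow> A t 0 = 0"
proof -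
  define K where "K = (\<lambda>z. if norm z \<le> 1 then k z else z)"
  define d where "d = (\<lambda>z. K z - z)"
  \<comment> \<open>Written through the displacement \<open>d\<close>, the shrunken copy also makes
    sense at \<open>t = 1\<close>: division by 0 yields 0 and the factor \<open>1 - t\<close>
    vanishes, so \<open>A 1\<close> is the identity.\<close>
  define A where "A = (\<lambda>t z. z + (1 - t) *\<^sub>R d (z /\<^sub>R (1 - t)))"
  have kball: "norm (k z) \<le> 1" if "norm z \<le> 1" for z
    using bij that by (auto simp: bij_betw_def image_subset_iff)
  have "continuous_on (cball 0 1 \<union> - ball 0 1) (\<lambda>z. if z \<in> cball 0 1 then k z else z)"
    by (rule continuous_on_cases) (use cont fix1 in \<open>auto intro: continuous_intros\<close>)
  moreover have "cball 0 1 \<union> - ball 0 1 = (UNIV :: complex set)"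
    by auto
  ultimately have "continuous_on UNIV K"
    by (simp add: K_def)
  then have contd: "continuous_on UNIV d"
    unfolding d_def by (intro continuous_intros)
  have bound: "norm (d z) \<le> 2" for z
    using norm_triangle_ineq4[of "k z" z] kball[of z] by (auto simp: d_def K_def)
  have contA: "continuous_on (UNIV \<times> UNIV) (\<lambda>p. A (fst p) (snd p))" 
    unfolding continuous_on_eq_continuous_within
  proof
    fix p :: "real \<times> complex"
    show "continuous (at p within UNIV \<times> UNIV) (\<lambda>p. A (fst p) (snd p))"
    proof (cases "fst p = 1")
      case False
      have "continuous_on ((- {1}) \<times> UNIV) (\<lambda>p. A (fst p) (snd p))"
        unfolding A_def
        by (intro continuous_intros continuous_on_compose2[OF contd]) auto
      moreover have "open ((- {1::real}) \<times> (UNIV :: complex set))"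
        by (intro open_Times) auto
      ultimately have "isCont (\<lambda>p. A (fst p) (snd p)) p"
        using False by (intro continuous_on_interior) (auto simp: interior_open mem_Times_iff)
      then show ?thesis
        by (rule continuous_at_imp_continuous_at_within)
    next
      \<comment> \<open>Inside the unit disc \<open>k z\<close> and \<open>z\<close> both have norm
        at most 1, so the displacement is bounded by 2 and the added term by
        \<open>2 * \<bar>1 - fst p\<bar>\<close>, uniformly in the point of the plane.\<close>
      case True
      have "((\<lambda>p. 2 * \<bar>1 - fst p\<bar>) \<longlongrightarrow> 2 * \<bar>1 - fst p\<bar>) (at p)"
        by (intro tendsto_intros)
      then have "((\<lambda>p. 2 * \<bar>1 - fst p\<bar>) \<longlongrightarrow> 0) (at p)"
        using True by simp
      then have "((\<lambda>p. (1 - fst p) *\<^sub>R d (snd p /\<^sub>R (1 - fst p))) \<longlongrightarrow> 0) (at p)"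
        by (rule Lim_null_comparison[rotated])
          (use bound in \<open>auto intro!: always_eventually simp: mult.commute[of 2] intro: mult_left_mono\<close>)
      then have "((\<lambda>p. snd p + (1 - fst p) *\<^sub>R d (snd p /\<^sub>R (1 - fst p))) \<longlongrightarrow> snd p + 0) (at p)"
        by (intro tendsto_intros)
      then have "((\<lambda>p. A (fst p) (snd p)) \<longlongrightarrow> A (fst p) (snd p)) (at p)"
        using True by (simp add: A_def)
      then show ?thesis
        by (simp add: continuous_within)
    qed
  qed
  have A_scale: "A t z = (1 - t) *\<^sub>R K (z /\<^sub>R (1 - t))" if "t < 1" for t z
    using that by (simp add: A_def d_def scaleR_diff_right)
  have A_out: "A t z = z" if "1 - t < norm z" "t \<in> {0..<1}" for t z
  proof -
    have "\<not> norm (z /\<^sub>R (1 - t)) \<le> 1"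
      using that by (simp add: field_simps)
    then show ?thesis
      using that by (auto simp: A_scale K_def)
  qed
  have A_in: "A t z = (1 - t) *\<^sub>R k (z /\<^sub>R (1 - t))" "norm (z /\<^sub>R (1 - t)) \<le> 1"
    if "norm z \<le> 1 - t" "t \<in> {0..<1}" for t z
  proof -
    show "norm (z /\<^sub>R (1 - t)) \<le> 1"
      using that by (simp add: field_simps)
    then show "A t z = (1 - t) *\<^sub>R k (z /\<^sub>R (1 - t))"
      using that unfolding A_scale[OF atLeastLessThan_iff[THEN iffD1, THEN conjunct2, OF that(2)]] K_def by simp
  qed
  \<comment> \<open>The disc of radius \<open>1 - t\<close> and its complement are both invariant,
    so bijectivity can be checked on each of them separately.\<close>
  have A_norm: "norm (A t z) \<le> 1 - t \<longleftrightarrow> norm z \<le> 1 - t" if "t \<in> {0..<1}" for t z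
  proof (cases "norm z \<le> 1 - t")
    case True
    then have "norm (A t z) \<le> (1 - t) * 1"
      unfolding A_in(1)[OF True that] norm_scaleR using kball[OF A_in(2)[OF True that]] that
      by (intro mult_mono) auto
    with True show ?thesis
      by simp
  next
    case False
    then show ?thesis
      using A_out[of t z] that by simp
  qed
  have bijA: "bij_betw (A t) (cball 0 1) (cball 0 1)" if t: "t \<in> {0..<1}" for t
  proof (intro bij_betw_imageI inj_onI equalityI subsetI)
    fix z w assume zw: "z \<in> cball 0 1" "w \<in> cball 0 1" "A t z = A t w"
    show "z = w"
    proof (cases "norm z \<le> 1 - t")
      case True
      then have w: "norm w \<le> 1 - t"
        using A_norm[OF t] zw(3) by metis
      have "k (z /\<^sub>R (1 - t)) = k (w /\<^sub>R (1 - t))"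
        using zw(3) t unfolding A_in(1)[OF True t] A_in(1)[OF w t] by simp
      then have "z /\<^sub>R (1 - t) = w /\<^sub>R (1 - t)"
        using bij A_in(2)[OF True t] A_in(2)[OF w t] unfolding bij_betw_def by (auto dest: inj_onD)
      then show ?thesis
        using t by simp
    next
      case False
      then have w: "\<not> norm w \<le> 1 - t"
        using A_norm[OF t] zw(3) by metis
      have "A t z = z"
        by (rule A_out[OF _ t]) (use False in simp)
      moreover have "A t w = w"
        by (rule A_out[OF _ t]) (use w in simp)
      ultimately show ?thesis
        using zw(3) by metis
    qed
  next
    fix y assume "y \<in> A t ` cball 0 1"
    then obtain z where z: "norm z \<le> 1" "y = A t z"
      by auto
    show "y \<in> cball 0 1"
    proof (cases "norm z \<le> 1 - t")
      case True
      then have "norm y \<le> 1 - t"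
        using A_norm[OF t] z by metis
      then show ?thesis
        using t by auto
    next
      case False
      then show ?thesis
        using z A_out[of t z] t by simp
    qed
  next
    fix y :: complex assume y: "y \<in> cball 0 1"
    show "y \<in> A t ` cball 0 1"
    proof (cases "norm y \<le> 1 - t")
      case True
      then obtain w where w: "norm w \<le> 1" "y /\<^sub>R (1 - t) = k w"
        using A_in(2)[OF True t] bij by (force simp: bij_betw_def set_eq_iff image_iff)
      have nz: "norm ((1 - t) *\<^sub>R w) \<le> 1 - t"
        using w t by (simp add: mult_left_le)
      have "A t ((1 - t) *\<^sub>R w) = (1 - t) *\<^sub>R k w"
        using A_in(1)[OF nz t] t by simp
      then have "A t ((1 - t) *\<^sub>R w) = y"
        using t by (simp flip: w(2))
      moreover have "(1 - t) *\<^sub>R w \<in> cball 0 1"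
        using nz t by (simp del: norm_scaleR)
      ultimately show ?thesis
        by blast
    next
      case False
      then show ?thesis
        using y A_out[of t y] t by (metis image_eqI linorder_not_le)
    qed
  qed
  show thesis
  proof (rule that)
    show "continuous_on ({0..1} \<times> cball 0 1) (\<lambda>(t, z). A t z)"
      unfolding case_prod_beta by (rule continuous_on_subset[OF contA]) auto
    show "bij_betw (A t) (cball 0 1) (cball 0 1)" if "t \<in> {0..1}" for t
    proof (cases "t = 1")
      case True
      then have "A t = id"
        by (auto simp: A_def)
      then show ?thesis
        by simp
    qed (use that bijA in auto)
    show "A 0 z = k z" if "z \<in> cball 0 1" for z
      using that by (simp add: A_def d_def K_def)
    show "A 1 z = z" for z
      by (simp add: A_def)
    show "A t z = z" if t: "t \<in> {0..1}" and z: "norm z = 1" for t z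
    proof (cases "t = 0 \<or> t = 1")
      case True
      then show ?thesis
        using fix1[OF z] z by (auto simp: A_def d_def K_def)
    next
      case False
      then show ?thesis
        using A_out t z by auto
    qed
    show "A t 0 = 0" if "k 0 = 0" for t
      using that by (simp add: A_def d_def K_def)
  qed
qed

text \<open>The cone isotopy \<open>E\<close> starts at a map with the boundary values of
  \<open>g\<close>. Hence \<open>k\<close>, which is \<open>g\<close> followed by the inverse of
  \<open>E 0\<close>, fixes the circle and is deformed to the identity by the Alexander isotopy
  \<open>A\<close>. Performing \<open>A t\<close> and then \<open>E t\<close> leads from
  \<open>g\<close> to the identity and moves the circle as \<open>E\<close> does.\<close>

lemma disc_isotopy:
  fixes g :: "complex \<Rightarrow> complex"
  assumes m: "m > 0" and \<rho>: "\<And>j. j < m \<Longrightarrow> reparam (\<rho> j)"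
    and cont: "continuous_on (cball 0 1) g" and bij: "bij_betw g (cball 0 1) (cball 0 1)"
    and arcs: "\<And>j s. j < m \<Longrightarrow> s \<in> {0..1} \<Longrightarrow> g (circle_arc m j s) = circle_arc m j (\<rho> j s)"
  obtains F :: "real \<Rightarrow> complex \<Rightarrow> complex" where
    "continuous_on ({0..1} \<times> cball 0 1) (\<lambda>(t, z). F t z)"
    "\<And>t. t \<in> {0..1} \<Longrightarrow> bij_betw (F t) (cball 0 1) (cball 0 1)"
    "\<And>z. z \<in> cball 0 1 \<Longrightarrow> F 0 z = g z"
    "\<And>z. z \<in> cball 0 1 \<Longrightarrow> F 1 z = z"
    "\<And>t j s. t \<in> {0..1} \<Longrightarrow> j < m \<Longrightarrow> s \<in> {0..1} \<Longrightarrow> F t (circle_arc m j s) = circle_arc m j ((1 - t) * \<rho> j s + t * s)"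
    "\<And>t z. t \<in> {0..1} \<Longrightarrow> z \<in> cball 0 1 \<Longrightarrow> norm (F t z) = 1 \<longleftrightarrow> norm z = 1"
    "\<And>t. t \<in> {0..1} \<Longrightarrow> g 0 = 0 \<Longrightarrow> F t 0 = 0"
proof -
  obtain E :: "real \<Rightarrow> complex \<Rightarrow> complex" where E: "continuous_on ({0..1} \<times> cball 0 1) (\<lambda>(t, z). E t z)"
    and Ebij: "\<And>t. t \<in> {0..1} \<Longrightarrow> bij_betw (E t) (cball 0 1) (cball 0 1)"
    and Enorm: "\<And>t z. t \<in> {0..1} \<Longrightarrow> z \<in> cball 0 1 \<Longrightarrow> norm (E t z) = norm z"
    and E1: "\<And>z. z \<in> cball 0 1 \<Longrightarrow> E 1 z = z"
    and Earc: "\<And>t j s. t \<in> {0..1} \<Longrightarrow> j < m \<Longrightarrow> s \<in> {0..1} \<Longrightarrow> E t (circle_arc m j s) = circle_arc m j ((1 - t) * \<rho> j s + t * s)"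
    using cone_isotopy[of m \<rho>] m \<rho> by blast
  let ?B = "cball (0::complex) 1"
  have Ecomp: "continuous_on S (\<lambda>x. E (a x) (b x))"
    if "continuous_on S a" "continuous_on S b" "\<And>x. x \<in> S \<Longrightarrow> a x \<in> {0..1} \<and> b x \<in> ?B"
    for S :: "'x::topological_space set" and a b
  proof -
    have "continuous_on S (\<lambda>x. (\<lambda>(t, z). E t z) (a x, b x))"
      by (rule continuous_on_compose2[OF E]) (use that in \<open>auto intro!: continuous_intros\<close>)
    then show ?thesis
      by simp
  qed
  define k where "k = inv_into ?B (E 0) \<circ> g"
  have E0: "bij_betw (E 0) ?B ?B"
    using Ebij by simp
  have Einv: "inv_into ?B (E 0) (E 0 z) = z" if "z \<in> ?B" for z
    using E0 that by (simp add: bij_betw_def)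
  have g_in: "g z \<in> ?B" if "z \<in> ?B" for z
    using bij that by (auto simp: bij_betw_def)
  have E_k: "E 0 (k z) = g z" if "z \<in> ?B" for z
    unfolding k_def o_def using bij_betw_inv_into_right[OF E0 g_in[OF that]] .
  have "continuous_on (E 0 ` ?B) (inv_into ?B (E 0))"
    by (rule continuous_on_inv) (use Einv in \<open>auto intro!: Ecomp continuous_intros\<close>)
  then have "continuous_on ?B (inv_into ?B (E 0))"
    using E0 by (simp add: bij_betw_def)
  then have contk: "continuous_on ?B k"
    unfolding k_def using cont bij by (intro continuous_on_compose) (auto simp: bij_betw_def)
  have bijk: "bij_betw k ?B ?B"
    unfolding k_def by (rule bij_betw_trans[OF bij bij_betw_inv_into[OF E0]])
  have k1: "k z = z" if "norm z = 1" for z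
  proof -
    obtain j s where js: "j < m" "s \<in> {0..<1}" "z = circle_arc m j s"
      using circle_arc_cover m \<open>norm z = 1\<close> by blast
    then have "g z = E 0 z"
      using arcs[of j s] Earc[of 0 j s] by simp
    then show ?thesis
      using Einv[of z] that by (simp add: k_def)
  qed
  have k0: "k 0 = 0" if "g 0 = 0"
    using E_k[of 0] Enorm[of 0 "k 0"] that bij_betwE[OF bijk, rule_format, of 0] by simp
  obtain A :: "real \<Rightarrow> complex \<Rightarrow> complex" where A: "continuous_on ({0..1} \<times> ?B) (\<lambda>(t, z). A t z)"
    and Abij: "\<And>t. t \<in> {0..1} \<Longrightarrow> bij_betw (A t) ?B ?B"
    and A0: "\<And>z. z \<in> ?B \<Longrightarrow> A 0 z = k z"
    and A1: "\<And>z. A 1 z = z"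
    and Asph: "\<And>t z. t \<in> {0..1} \<Longrightarrow> norm z = 1 \<Longrightarrow> A t z = z"
    and Az: "\<And>t. k 0 = 0 \<Longrightarrow> A t 0 = 0"
    using alexander_trick[OF contk bijk k1] by blast
  have Ain: "A t z \<in> ?B" if "t \<in> {0..1}" "z \<in> ?B" for t z
    using Abij[OF that(1)] that by (auto simp: bij_betw_def)
  show thesis
  proof (rule that)
    show "continuous_on ({0..1} \<times> ?B) (\<lambda>(t, z). E t (A t z))"
      unfolding case_prod_beta
      by (rule Ecomp) (use A Ain in \<open>auto intro!: continuous_intros simp: case_prod_beta\<close>)
    show "bij_betw (\<lambda>z. E t (A t z)) ?B ?B" if "t \<in> {0..1}" for t
      using bij_betw_trans[OF Abij[OF that] Ebij[OF that]] by (simp add: o_def)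
    show "E 0 (A 0 z) = g z" if "z \<in> ?B" for z
      using that A0 E_k by simp
    show "E 1 (A 1 z) = z" if "z \<in> ?B" for z
      using that E1 A1 by simp
    show "E t (A t (circle_arc m j s)) = circle_arc m j ((1 - t) * \<rho> j s + t * s)"
      if "t \<in> {0..1}" "j < m" "s \<in> {0..1}" for t j s
      using that Asph Earc by simp
    show "norm (E t (A t z)) = 1 \<longleftrightarrow> norm z = 1" if t: "t \<in> {0..1}" and z: "z \<in> ?B" for t z
    proof
      assume "norm (E t (A t z)) = 1"
      then have "norm (A t z) = 1"
        using Enorm[OF t Ain[OF t z]] by simp
      then have "A t (A t z) = A t z"
        using Asph[OF t] by simp
      then have "A t z = z"
        using Abij[OF t] z Ain[OF t z] by (auto simp: bij_betw_def dest: inj_onD)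
      with \<open>norm (A t z) = 1\<close> show "norm z = 1"
        by simp
    next
      assume "norm z = 1"
      then show "norm (E t (A t z)) = 1"
        using Asph[OF t] Enorm[OF t] z by simp
    qed
    show "E t (A t 0) = 0" if t: "t \<in> {0..1}" and "g 0 = 0" for t
      using Az[OF k0[OF that(2)]] Enorm[OF t, of 0] by simp
  qed
qed


section \<open>Extending homeomorphisms of cells to the boundary\<close>


text \<open>\<open>C\<close> is the cluster set of \<open>h\<close> at \<open>x\<close>. It is the
  intersection of the closures \<open>D n\<close> of the images of shrinking neighbourhoods, which
  are compact, connected and decreasing; so it is connected and nonempty. If it is a single point,
  compactness pushes some \<open>D n\<close> into any given ball about that point, which is
  convergence.\<close>

lemma cluster_set:
  fixes h :: "complex \<Rightarrow> complex"
  assumes hB: "h ` B \<subseteq> cball 0 1" and x: "x \<in> closure B" and cont: "continuous_on B h"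
    and e: "e > 0" and conn: "\<And>r. 0 < r \<Longrightarrow> r \<le> e \<Longrightarrow> connected (B \<inter> ball x r)"
  obtains C where "connected C" "C \<noteq> {}" "C \<subseteq> cball 0 1"
    "\<And>l. l \<in> C \<longleftrightarrow> (\<exists>z. (\<forall>n::nat. z n \<in> B) \<and> z \<longlonglongrightarrow> x \<and> (\<lambda>n. h (z n)) \<longlonglongrightarrow> l)"
    "\<And>l. C = {l} \<Longrightarrow> (h \<longlongrightarrow> l) (at x within B)"
proof -
  define D where "D = (\<lambda>n::nat. closure (h ` (B \<inter> ball x (e / Suc n))))"
  have sub: "D n \<subseteq> cball 0 1" for n
    unfolding D_def by (rule closure_minimal) (use hB in auto)
  have compact: "compact (D n)" for n
    using sub[of n] by (metis D_def bounded_cball bounded_subset closed_closure compact_eq_bounded_closed)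
  have small: "e / Suc n \<le> e" "0 < e / Suc n" for n
    using e by (auto simp: field_simps)
  have nonempty: "D n \<noteq> {}" for n
  proof -
    have "B \<inter> ball x (e / Suc n) \<noteq> {}"
      using x small(2)[of n] unfolding closure_approachable by (force simp: dist_commute)
    then show ?thesis
      by (simp add: D_def closure_eq_empty)
  qed
  have "connected (D n)" for n
    unfolding D_def using conn[OF small(2,1)]
    by (intro connected_imp_connected_closure connected_continuous_image continuous_on_subset[OF cont]) auto
  moreover have mono: "D n \<subseteq> D m" if "m \<le> n" for m n
  proof -
    have "e / Suc n \<le> e / Suc m"
      using that e by (simp add: frac_le)
    then show ?thesis
      unfolding D_def by (intro closure_mono image_mono) auto
  qed
  ultimately have conC: "connected (\<Inter>(range D))"
    using compact by (intro connected_nest) auto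
  show thesis
  proof (rule that[OF conC])
    show "\<Inter>(range D) \<noteq> {}"
      by (rule compact_nest[OF compact nonempty mono])
    show "\<Inter>(range D) \<subseteq> cball 0 1"
      using sub by blast
    show "l \<in> \<Inter>(range D) \<longleftrightarrow> (\<exists>z. (\<forall>n::nat. z n \<in> B) \<and> z \<longlonglongrightarrow> x \<and> (\<lambda>n. h (z n)) \<longlonglongrightarrow> l)" for l
    proof
      assume l: "l \<in> \<Inter>(range D)"
      have "\<exists>w. w \<in> B \<and> dist w x < e / Suc n \<and> dist (h w) l < 1 / Suc n" for n :: nat
      proof -
        have "l \<in> closure (h ` (B \<inter> ball x (e / Suc n)))"
          using l by (auto simp: D_def)
        then obtain y where "y \<in> h ` (B \<inter> ball x (e / Suc n))" "dist y l < 1 / Suc n"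
          unfolding closure_approachable by (metis of_nat_0_less_iff zero_less_Suc zero_less_divide_1_iff)
        then show ?thesis
          by (auto simp: dist_commute)
      qed
      then obtain z where z: "\<And>n. z n \<in> B" "\<And>n. dist (z n) x < e / Suc n" "\<And>n. dist (h (z n)) l < 1 / Suc n"
        by metis
      have lim: "(\<lambda>n. c / Suc n) \<longlonglongrightarrow> 0" for c :: real
        using LIMSEQ_Suc[OF lim_const_over_n[of c]] by simp
      have "z \<longlonglongrightarrow> x"
        unfolding tendsto_dist_iff[of z]
        by (rule tendsto_sandwich[OF _ _ tendsto_const lim[of e]]) (use z(2) in \<open>auto intro!: always_eventually less_imp_le\<close>)
      moreover have "(\<lambda>n. h (z n)) \<longlonglongrightarrow> l"
        unfolding tendsto_dist_iff[of "\<lambda>n. h (z n)"]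
        by (rule tendsto_sandwich[OF _ _ tendsto_const lim[of 1]]) (use z(3) in \<open>auto intro!: always_eventually less_imp_le\<close>)
      ultimately show "\<exists>z. (\<forall>n::nat. z n \<in> B) \<and> z \<longlonglongrightarrow> x \<and> (\<lambda>n. h (z n)) \<longlonglongrightarrow> l"
        using z(1) by blast
    next
      assume "\<exists>z. (\<forall>n::nat. z n \<in> B) \<and> z \<longlonglongrightarrow> x \<and> (\<lambda>n. h (z n)) \<longlonglongrightarrow> l"
      then obtain z where z: "\<And>n::nat. z n \<in> B" "z \<longlonglongrightarrow> x" "(\<lambda>n. h (z n)) \<longlonglongrightarrow> l"
        by blast
      have "l \<in> D n" for n
      proof -
        have "\<forall>\<^sub>F k in sequentially. h (z k) \<in> D n"
          using tendstoD[OF z(2) small(2)[of n]]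
        proof eventually_elim
          case (elim k)
          then have "z k \<in> B \<inter> ball x (e / Suc n)"
            using z(1) by (simp add: dist_commute)
          then show ?case
            unfolding D_def by (intro subsetD[OF closure_subset] imageI)
        qed
        then show ?thesis
          using z(3) by (intro Lim_in_closed_set[of "D n"]) (auto simp: D_def)
      qed
      then show "l \<in> \<Inter>(range D)"
        by blast
    qed
    show "(h \<longlongrightarrow> l) (at x within B)" if C: "\<Inter>(range D) = {l}" for l
      unfolding tendsto_iff
    proof (intro allI impI)
      fix d :: real assume "d > 0"
      have "\<exists>n. D n - ball l d = {}"
      proof (rule ccontr)
        assume "\<not> ?thesis"
        then have ne: "D n - ball l d \<noteq> {}" for n
          by blast
        have "\<Inter>(range (\<lambda>n. D n - ball l d)) \<noteq> {}"
          by (rule compact_nest[OF _ ne]) (use compact mono in \<open>auto intro: compact_diff\<close>)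
        then show False
          using C \<open>d > 0\<close> by auto
      qed
      then obtain n where n: "D n \<subseteq> ball l d"
        by blast
      have "\<forall>\<^sub>F z in at x within B. z \<in> B \<and> dist z x < e / Suc n"
        unfolding eventually_at using small(2)[of n] by blast
      then show "\<forall>\<^sub>F z in at x within B. dist (h z) l < d"
      proof eventually_elim
        case (elim z)
        then have "h z \<in> D n"
          unfolding D_def by (intro subsetD[OF closure_subset] imageI) (simp add: dist_commute)
        then show ?case
          using n by (auto simp: dist_commute)
      qed
    qed
  qed
qed

lemma closure_punctured_disc:
  assumes "Z \<subseteq> {0}"
  shows "closure (ball 0 1 - Z) = cball (0::complex) 1"
proof
  show "cball 0 1 \<subseteq> closure (ball 0 1 - Z)"
  proof
    fix z :: complex assume "z \<in> cball 0 1"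
    then have "z islimpt ball 0 1"
      using islimpt_ball[of z 0 1] by simp
    moreover have "ball 0 1 \<subseteq> insert 0 (ball 0 1 - Z)"
      using assms by blast
    ultimately have "z islimpt insert 0 (ball 0 1 - Z)"
      by (rule islimpt_subset)
    then show "z \<in> closure (ball 0 1 - Z)"
      by (simp add: islimpt_insert closure_def)
  qed
qed (auto intro: closure_minimal[THEN subsetD, rotated 2])

text \<open>On the open cell the lift is \<open>g\<close> conjugated by \<open>q\<close>. A limit
  value at a boundary point \<open>x\<close> is a preimage of \<open>g (q x)\<close>, so the
  connected cluster set at \<open>x\<close> lies in a finite fibre and is one point. At the puncture
  \<open>g\<close> is undefined, and invertibility of the lift on the open cell takes over.\<close>

lemma lift_extends:
  fixes q :: "complex \<Rightarrow> 'a"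
  assumes M: "Hausdorff_space M" and Z: "Z \<subseteq> {0}"
    and q: "continuous_map (top_of_set (cball 0 1)) M q"
    and qB: "homeomorphic_map (top_of_set (ball 0 1 - Z)) (subtopology M R) q"
    and RY: "R \<subseteq> Y" "C \<subseteq> Y" "Y \<subseteq> topspace M" "C \<inter> R = {}" and qZ: "q ` Z \<inter> Y = {}"
    and qS: "q ` sphere 0 1 \<subseteq> C"
    and fin: "\<And>x. finite {z \<in> sphere 0 1. q z = x}"
    and g: "homeomorphic_maps (subtopology M Y) (subtopology M Y) g g'"
    and inv: "g ` R \<subseteq> R" "g' ` R \<subseteq> R" "g ` C \<subseteq> C"
  obtains h where "continuous_on (cball 0 1) h" "h ` cball 0 1 \<subseteq> cball 0 1"
    "h ` (ball 0 1 - Z) \<subseteq> ball 0 1 - Z"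
    "\<And>z. z \<in> cball 0 1 - Z \<Longrightarrow> q (h z) = g (q z)" "\<And>z. z \<in> Z \<Longrightarrow> h z = z"
proof -
  define B where "B = ball (0::complex) 1 - Z"
  obtain p where qp: "homeomorphic_maps (top_of_set B) (subtopology M R) q p"
    using qB unfolding B_def homeomorphic_map_maps by blast
  have topR: "topspace (subtopology M R) = R" "topspace (subtopology M Y) = Y"
    using RY by auto
  have cp: "continuous_map (subtopology M R) (top_of_set B) p"
    and cq: "continuous_map (top_of_set B) (subtopology M R) q"
    and pq: "\<And>z. z \<in> B \<Longrightarrow> p (q z) = z" and qp': "\<And>y. y \<in> R \<Longrightarrow> q (p y) = y"
    using qp topR unfolding homeomorphic_maps_def by auto
  have pR: "p y \<in> B" if "y \<in> R" for y
    using continuous_map_image_subset_topspace[OF cp] that topR by auto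
  have qR: "q z \<in> R" if "z \<in> B" for z
    using continuous_map_image_subset_topspace[OF cq] that topR by auto
  have cg: "continuous_map (subtopology M Y) (subtopology M Y) g"
    "continuous_map (subtopology M Y) (subtopology M Y) g'"
    and gg': "\<And>y. y \<in> Y \<Longrightarrow> g' (g y) = y" "\<And>y. y \<in> Y \<Longrightarrow> g (g' y) = y"
    using g topR unfolding homeomorphic_maps_def by auto
  have B: "B \<subseteq> ball 0 1" "B \<inter> Z = {}" "closure B = cball 0 1"
    using closure_punctured_disc[OF Z] by (auto simp: B_def)
  have cases: "z \<in> B \<or> z \<in> Z \<or> z \<in> sphere 0 1" if "z \<in> cball 0 1" for z
    using that by (auto simp: B_def)
  define h0 where "h0 = p \<circ> g \<circ> q"
  have Bc: "z \<in> cball 0 1" if "z \<in> B" for z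
    using B(1) that by (auto intro: less_imp_le)
  define h0' where "h0' = p \<circ> g' \<circ> q"
  have cont0: "continuous_on B (p \<circ> f \<circ> q)"
    if f: "continuous_map (subtopology M Y) (subtopology M Y) f" "f ` R \<subseteq> R" for f
  proof -
    have "continuous_map (subtopology M R) (subtopology M R) f"
      using continuous_map_from_subtopology_mono[OF f(1)[unfolded continuous_map_in_subtopology, THEN conjunct1] RY(1)] f(2)
      by (auto simp: continuous_map_in_subtopology image_subset_iff)
    then have "continuous_map (top_of_set B) (top_of_set B) (p \<circ> f \<circ> q)"
      using cp cq by (metis continuous_map_compose comp_assoc)
    then show ?thesis
      by simp
  qed
  have h0_cont: "continuous_on B h0" and h0'_cont: "continuous_on B h0'"
    unfolding h0_def h0'_def using cont0 cg inv by auto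
  have h0B: "h0 z \<in> B" "h0' z \<in> B" if "z \<in> B" for z
    using qR[OF that] inv pR by (auto simp: h0_def h0'_def)
  have h0c: "h0 ` B \<subseteq> cball 0 1"
    using h0B(1) Bc by blast
  have q_h0: "q (h0 z) = g (q z)" if "z \<in> B" for z
    using qR[OF that] inv qp' by (auto simp: h0_def)
  have h0'h0: "h0' (h0 z) = z" if "z \<in> B" for z
  proof -
    have "g' (g (q z)) = q z"
      using gg'(1) qR[OF that] RY by blast
    then show ?thesis
      using pq[OF that] by (simp add: h0'_def q_h0[OF that])
  qed
  have h0h0': "h0 (h0' z) = z" if "z \<in> B" for z
  proof -
    have "g' (q z) \<in> R"
      using qR[OF that] inv by blast
    then show ?thesis
      using qR[OF that] gg'(2)[of "q z"] RY pq[OF that] by (auto simp: h0'_def h0_def qp')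
  qed

  \<comment> \<open>Limit values at boundary points\<close>
  have q_seq: "limitin M (\<lambda>n. q (z n)) (q x) sequentially"
    if "\<And>n::nat. z n \<in> cball 0 1" "z \<longlonglongrightarrow> x" "x \<in> cball 0 1" for z x
  proof -
    have "limitin (top_of_set (cball 0 1)) z x sequentially"
      unfolding limitin_subtopology using that by (simp add: always_eventually)
    from continuous_map_limit[OF q this] show ?thesis
      by (simp add: o_def)
  qed
  have boundary: "l \<in> sphere 0 1 \<and> q l = g (q x)"
    if x: "x \<in> sphere 0 1" and z: "\<And>n::nat. z n \<in> B" "z \<longlonglongrightarrow> x" and l: "(\<lambda>n. h0 (z n)) \<longlonglongrightarrow> l"
    for x z l
  proof -
    have zc: "z n \<in> cball 0 1" "h0 (z n) \<in> cball 0 1" for n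
      using z(1)[of n] h0B[OF z(1)[of n]] B by auto
    have lc: "l \<in> cball 0 1"
      by (rule Lim_in_closed_set[OF closed_cball _ _ l]) (use zc(2) in simp_all)
    have "limitin M (\<lambda>n. q (z n)) (q x) sequentially"
      by (rule q_seq) (use zc z x in auto)
    moreover have "q (z n) \<in> Y" for n
      using qR[OF z(1)] RY by blast
    moreover have "q x \<in> Y"
      using qS x RY(2) by blast
    ultimately have "limitin (subtopology M Y) (\<lambda>n. q (z n)) (q x) sequentially"
      unfolding limitin_subtopology by simp
    from continuous_map_limit[OF cg(1) this]
    have "limitin M (\<lambda>n. g (q (z n))) (g (q x)) sequentially"
      by (simp add: o_def limitin_subtopology)
    moreover have "limitin M (\<lambda>n. q (h0 (z n))) (q l) sequentially"
      by (rule q_seq[OF zc(2) l lc])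
    ultimately have eq: "q l = g (q x)"
      using limitin_Hausdorff_unique[OF _ _ _ M] q_h0[OF z(1)] by fastforce
    \<comment> \<open>The image point lies in \<open>C\<close>, hence neither in \<open>R\<close>
      nor outside \<open>Y\<close>; for \<open>l\<close> this leaves only the circle.\<close>
    have "g (q x) \<in> C"
      using qS x inv by blast
    then have "q l \<in> C"
      using eq by simp
    then have "l \<notin> B" "l \<notin> Z"
      using qR RY(2,4) qZ by blast+
    then show ?thesis
      using cases[OF lc] eq by blast
  qed
  have lim_sphere: "\<exists>l. (h0 \<longlongrightarrow> l) (at x within B)" if x: "x \<in> sphere 0 1" for x
  proof -
    have conn: "connected (B \<inter> ball x r)" if "0 < r" "r \<le> 1" for r
    proof -
      have "B \<inter> ball x r = ball 0 1 \<inter> ball x r"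
        using that x Z by (auto simp: B_def dist_norm)
      then show ?thesis
        by (simp add: convex_Int convex_connected)
    qed
    have xc: "x \<in> closure B"
      using B x by auto
    obtain K where K: "connected K" "K \<noteq> {}"
        "\<And>l. l \<in> K \<longleftrightarrow> (\<exists>z. (\<forall>n::nat. z n \<in> B) \<and> z \<longlonglongrightarrow> x \<and> (\<lambda>n. h0 (z n)) \<longlonglongrightarrow> l)"
        "\<And>l. K = {l} \<Longrightarrow> (h0 \<longlongrightarrow> l) (at x within B)"
      using cluster_set[OF h0c xc h0_cont zero_less_one conn] by metis
    have "K \<subseteq> {z \<in> sphere 0 1. q z = g (q x)}"
      using boundary[OF x] K(3) by blast
    then have "finite K"
      using fin finite_subset by blast
    then obtain l where "K = {l}"
      using K(1,2) connected_finite_iff_sing by blast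
    then show ?thesis
      using K(4) by blast
  qed

  \<comment> \<open>The limit at the puncture\<close>
  have lim_puncture: "(h0 \<longlongrightarrow> 0) (at 0 within B)" if 0: "0 \<in> Z"
  proof -
    have "connected (B \<inter> ball 0 r)" if "0 < r" "r \<le> 1" for r
    proof -
      have "B \<inter> ball 0 r = ball 0 r - {0}"
        using that Z 0 by (auto simp: B_def)
      then show ?thesis
        by (simp add: connected_punctured_ball)
    qed
    note conn = this
    have 0: "0 \<in> closure B"
      using B by auto
    obtain K where K: "connected K" "K \<noteq> {}" "K \<subseteq> cball 0 1"
        "\<And>l. l \<in> K \<longleftrightarrow> (\<exists>z. (\<forall>n::nat. z n \<in> B) \<and> z \<longlonglongrightarrow> 0 \<and> (\<lambda>n. h0 (z n)) \<longlonglongrightarrow> l)"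
        "\<And>l. K = {l} \<Longrightarrow> (h0 \<longlongrightarrow> l) (at 0 within B)"
    proof (rule cluster_set[OF h0c 0 h0_cont zero_less_one])
      show "connected (B \<inter> ball 0 r)" if "0 < r" "r \<le> 1" for r
        by (rule conn[OF that])
    next
      fix C
      assume "connected C" "C \<noteq> {}" "C \<subseteq> cball 0 1"
        "\<And>l. l \<in> C \<longleftrightarrow> (\<exists>z. (\<forall>n::nat. z n \<in> B) \<and> z \<longlonglongrightarrow> 0 \<and> (\<lambda>n. h0 (z n)) \<longlonglongrightarrow> l)"
        "\<And>l. C = {l} \<Longrightarrow> (h0 \<longlongrightarrow> l) (at 0 within B)"
      then show thesis
        by (rule that)
    qed
    have 0: "0 \<notin> B"
      using that by (auto simp: B_def)
    \<comment> \<open>If images of points tending to the puncture accumulated inside the open cell,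
      the continuous inverse \<open>h0'\<close> would send the accumulation point to 0, which is not
      in \<open>B\<close>.\<close>
    have KB: "l \<notin> B" if "l \<in> K" for l
    proof
      assume l: "l \<in> B"
      obtain z where z: "\<And>n. z n \<in> B" "z \<longlonglongrightarrow> 0" "(\<lambda>n. h0 (z n)) \<longlonglongrightarrow> l"
        using K(4) \<open>l \<in> K\<close> by blast
      have "(\<lambda>n. h0' (h0 (z n))) \<longlonglongrightarrow> h0' l"
        by (rule continuous_on_tendsto_compose[OF h0'_cont z(3) l]) (use h0B z in auto)
      then have "h0' l = 0"
        using h0'h0 z LIMSEQ_unique by fastforce
      then show False
        using h0B(2)[OF l] 0 by simp
    qed
    \<comment> \<open>The origin is a limit value: a sequence tending to 0 is pulled back by
      \<open>h0'\<close>, and a subsequence converges to some \<open>y\<close>. Continuity of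
      \<open>h0\<close> keeps \<open>y\<close> out of \<open>B\<close>, and \<open>boundary\<close>
      keeps it off the circle, so \<open>y = 0\<close>.\<close>
    obtain w :: "nat \<Rightarrow> complex" where w: "\<And>n. w n \<in> B" "w \<longlonglongrightarrow> 0"
      using \<open>0 \<in> closure B\<close> closure_sequential by metis
    have "\<And>n. h0' (w n) \<in> cball 0 1"
      using w h0B(2) Bc by blast
    then obtain y r where y: "y \<in> cball 0 1" "strict_mono r" "((\<lambda>n. h0' (w n)) \<circ> r) \<longlonglongrightarrow> y"
      using compact_cball[unfolded compact_def] by metis
    define v where "v = (\<lambda>n. h0' (w (r n)))"
    have v: "v n \<in> B" "h0 (v n) = w (r n)" for n
      using w h0B h0h0' by (auto simp: v_def)
    have vy: "v \<longlonglongrightarrow> y"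
      using y by (simp add: v_def o_def)
    have hv: "(\<lambda>n. h0 (v n)) \<longlonglongrightarrow> 0"
      using LIMSEQ_subseq_LIMSEQ[OF w(2) y(2)] v by (simp add: o_def)
    have "y \<notin> B"
    proof
      assume "y \<in> B"
      then have "(\<lambda>n. h0 (v n)) \<longlonglongrightarrow> h0 y"
        using continuous_on_tendsto_compose[OF h0_cont vy] v by auto
      then have "h0 y = 0"
        using hv LIMSEQ_unique by blast
      then show False
        using h0B(1)[OF \<open>y \<in> B\<close>] 0 by simp
    qed
    moreover have "y \<notin> sphere 0 1"
      using boundary[OF _ v(1) vy hv] by auto
    ultimately have "y = 0"
      using cases[OF y(1)] Z by blast
    then have "0 \<in> K"
      using K(4) v(1) vy hv by blast
    moreover have sub: "K \<subseteq> {0} \<union> sphere 0 1"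
      using K(3) KB cases Z by blast
    \<comment> \<open>The origin is separated from the circle by the radius 1/2, so the connected
      set \<open>K\<close>, which contains the origin, cannot also reach the circle.\<close>
    moreover have "K \<inter> sphere 0 1 = {}"
    proof (rule ccontr)
      assume "K \<inter> sphere 0 1 \<noteq> {}"
      then show False
        using connectedD[OF K(1), of "ball 0 (1/2)" "- cball 0 (1/2)"] sub \<open>0 \<in> K\<close> by force
    qed
    ultimately have "K = {0}"
      by blast
    then show ?thesis
      using K(5) by blast
  qed

  \<comment> \<open>Continuous extension to the closed disc\<close>
  have ext: "\<exists>f. continuous_map (subtopology euclidean (insert x B)) euclidean f \<and> (\<forall>z\<in>B. f z = h0 z)"
    if x: "x \<in> cball 0 1" for x
  proof (cases "x \<in> B")
    case True
    then show ?thesis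
      using h0_cont by (intro exI[of _ h0]) (simp add: insert_absorb)
  next
    case False
    then obtain l where l: "(h0 \<longlongrightarrow> l) (at x within B)"
      using cases[OF x] lim_sphere lim_puncture Z by blast
    let ?f = "\<lambda>z. if z = x then l else h0 z"
    have "continuous_on (insert x B) ?f"
      unfolding continuous_on_def
    proof
      fix z assume z: "z \<in> insert x B"
      show "(?f \<longlongrightarrow> ?f z) (at z within insert x B)"
      proof (cases "z = x")
        case True
        have "(?f \<longlongrightarrow> l) (at x within B)"
          using l by (rule Lim_transform_eventually) (use False in \<open>auto simp: eventually_at_filter\<close>)
        then show ?thesis
          using True by (simp add: at_within_def)
      next
        case zx: False
        then have "z \<in> B"
          using z by blast
        then have "(h0 \<longlongrightarrow> h0 z) (at z within B)"
          using h0_cont by (simp add: continuous_on_def)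
        moreover have "at z within insert x B = at z within B"
          by (rule at_within_nhd[of _ "- {x}"]) (use zx in auto)
        moreover have "\<forall>\<^sub>F w in at z within B. h0 w = ?f w"
          using False by (auto simp: eventually_at_filter)
        ultimately show ?thesis
          using zx by (auto intro: Lim_transform_eventually)
      qed
    qed
    then show ?thesis
      using False by (intro exI[of _ ?f]) auto
  qed
  \<comment> \<open>The target is a regular space, so extensions of \<open>h0\<close> to one
    additional point at a time suffice for a continuous extension to the whole closed disc.\<close>
  obtain h where h: "continuous_map (subtopology euclidean (cball 0 1)) euclidean h" "\<And>z. z \<in> B \<Longrightarrow> h z = h0 z"
    by (rule continuous_map_extension_pointwise[of euclidean B "cball 0 1" euclidean h0])
      (use B ext regular_space_euclidean in auto)
  have hc: "continuous_on (cball 0 1) h"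
    using h by simp
  have hseq: "(\<lambda>n. h0 (z n)) \<longlonglongrightarrow> h x" if "\<And>n::nat. z n \<in> B" "z \<longlonglongrightarrow> x" "x \<in> cball 0 1" for z x
  proof -
    have "(\<lambda>n. h (z n)) \<longlonglongrightarrow> h x"
      by (rule continuous_on_tendsto_compose[OF hc that(2,3)]) (use that(1) Bc in simp)
    then show ?thesis
      using h(2) that(1) by simp
  qed
  have seq: "\<exists>z. (\<forall>n::nat. z n \<in> B) \<and> z \<longlonglongrightarrow> x" if "x \<in> cball 0 1" for x
    using that B(3) closure_sequential by metis
  have sph: "h x \<in> sphere 0 1 \<and> q (h x) = g (q x)" if x: "x \<in> sphere 0 1" for x
  proof -
    obtain z where z: "\<And>n::nat. z n \<in> B" "z \<longlonglongrightarrow> x"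
      using seq[of x] x by auto
    then show ?thesis
      using boundary[OF x z hseq[OF z]] x by auto
  qed
  have zer: "h z = z" if "z \<in> Z" for z
  proof -
    have z0: "z = 0" "0 \<in> Z"
      using that Z by auto
    obtain w where w: "\<And>n::nat. w n \<in> B" "w \<longlonglongrightarrow> 0"
      using seq[of 0] by auto
    have "w n \<noteq> 0" for n
      using w(1)[of n] z0 by (auto simp: B_def)
    then have "filterlim w (at 0 within B) sequentially"
      using w by (simp add: filterlim_at)
    then have "(\<lambda>n. h0 (w n)) \<longlonglongrightarrow> 0"
      using lim_puncture[OF z0(2)] filterlim_compose by blast
    then show ?thesis
      using hseq[OF w] z0 LIMSEQ_unique by auto
  qed
  show thesis
  proof (rule that[OF hc])
    show "h ` (ball 0 1 - Z) \<subseteq> ball 0 1 - Z"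
      using h(2) h0B by (auto simp flip: B_def)
    show "q (h z) = g (q z)" if "z \<in> cball 0 1 - Z" for z
      using that cases sph h(2) q_h0 by (metis Diff_iff)
    show "h ` cball 0 1 \<subseteq> cball 0 1"
    proof
      fix y assume "y \<in> h ` cball 0 1"
      then obtain z where "z \<in> cball 0 1" "y = h z"
        by blast
      then show "y \<in> cball 0 1"
        using cases[of z] sph[of z] zer[of z] h(2)[of z] h0B(1)[of z] B(1) by auto
    qed
  qed (use zer in auto)
qed

text \<open>The lifts of \<open>g\<close> and \<open>g'\<close> are inverse to each other on the
  open cell, where \<open>q\<close> is injective, and by density on the closed disc.\<close>

lemma lift_homeo:
  fixes q :: "complex \<Rightarrow> 'a"
  assumes M: "Hausdorff_space M" and Z: "Z \<subseteq> {0}"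
    and q: "continuous_map (top_of_set (cball 0 1)) M q"
    and qB: "homeomorphic_map (top_of_set (ball 0 1 - Z)) (subtopology M R) q"
    and RY: "R \<subseteq> Y" "C \<subseteq> Y" "Y \<subseteq> topspace M" "C \<inter> R = {}" and qZ: "q ` Z \<inter> Y = {}"
    and qS: "q ` sphere 0 1 \<subseteq> C"
    and fin: "\<And>x. finite {z \<in> sphere 0 1. q z = x}"
    and g: "homeomorphic_maps (subtopology M Y) (subtopology M Y) g g'"
    and inv: "g ` R \<subseteq> R" "g' ` R \<subseteq> R" "g ` C \<subseteq> C" "g' ` C \<subseteq> C"
  obtains h where "continuous_on (cball 0 1) h" "bij_betw h (cball 0 1) (cball 0 1)"
    "\<And>z. z \<in> cball 0 1 - Z \<Longrightarrow> q (h z) = g (q z)" "\<And>z. z \<in> Z \<Longrightarrow> h z = z"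
    "h ` (ball 0 1 - Z) \<subseteq> ball 0 1 - Z"
proof -
  let ?B = "ball 0 1 - Z"
  obtain h where h: "continuous_on (cball 0 1) h" "h ` cball 0 1 \<subseteq> cball 0 1" "h ` ?B \<subseteq> ?B"
    "\<And>z. z \<in> cball 0 1 - Z \<Longrightarrow> q (h z) = g (q z)" "\<And>z. z \<in> Z \<Longrightarrow> h z = z"
    using lift_extends[OF M Z q qB RY qZ qS fin g inv(1,2,3)] by metis
  have g': "homeomorphic_maps (subtopology M Y) (subtopology M Y) g' g"
    using g homeomorphic_maps_sym by blast
  obtain h' where h': "continuous_on (cball 0 1) h'" "h' ` cball 0 1 \<subseteq> cball 0 1" "h' ` ?B \<subseteq> ?B"
    "\<And>z. z \<in> cball 0 1 - Z \<Longrightarrow> q (h' z) = g' (q z)" "\<And>z. z \<in> Z \<Longrightarrow> h' z = z"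
    using lift_extends[OF M Z q qB RY qZ qS fin g' inv(2,1,4)] by metis
  have qinj: "inj_on q ?B"
    using homeomorphic_imp_injective_map[OF qB] by simp
  have qY: "q z \<in> Y" if "z \<in> ?B" for z
    using homeomorphic_imp_surjective_map[OF qB] RY that by auto
  have gg': "g' (g y) = y" "g (g' y) = y" if "y \<in> Y" for y
    using g RY that unfolding homeomorphic_maps_def by auto
  have id: "k (l z) = z"
    if kl: "continuous_on (cball 0 1) k" "continuous_on (cball 0 1) l" "l ` cball 0 1 \<subseteq> cball 0 1"
      "k ` ?B \<subseteq> ?B" "l ` ?B \<subseteq> ?B" "\<And>z. z \<in> ?B \<Longrightarrow> q (k (l z)) = q z" and z: "z \<in> cball 0 1" for k l z
  proof -
    have eq: "(k \<circ> l) z = id z" if "z \<in> ?B" for z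
      using inj_onD[OF qinj, of "k (l z)" z] kl(4,5,6) that by (auto simp: image_subset_iff)
    have "continuous_on (cball 0 1) (k \<circ> l)"
      using kl by (intro continuous_on_compose continuous_on_subset[OF kl(1)])
    moreover have "z \<in> (top_of_set (cball 0 1)) closure_of ?B"
      using z closure_punctured_disc[OF Z] by (subst closure_of_subtopology) (auto simp: Int_absorb1 Int_absorb2 ball_subset_cball Diff_subset[THEN subset_trans])
    ultimately have "(k \<circ> l) z = id z"
      by (intro forall_in_closure_of_eq[where X = "top_of_set (cball 0 1)" and Y = euclidean and S = ?B, OF _ _ _ _ eq]) 
        (auto simp: continuous_on_id)
    then show ?thesis
      by simp
  qed
  have step: "q (k (l z)) = q z"
    if "\<And>z. z \<in> cball 0 1 - Z \<Longrightarrow> q (k z) = f (q z)" "\<And>z. z \<in> cball 0 1 - Z \<Longrightarrow> q (l z) = f' (q z)"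
      "l ` ?B \<subseteq> ?B" "\<And>y. y \<in> Y \<Longrightarrow> f (f' y) = y" and z: "z \<in> ?B" for k l f f' z
  proof -
    have "l z \<in> ?B"
      using that(3) z by blast
    then have "q (k (l z)) = f (q (l z))" "q (l z) = f' (q z)"
      using that(1)[of "l z"] that(2)[of z] z by auto
    then show ?thesis
      using that(4)[OF qY[OF z]] by simp
  qed
  have "h' (h z) = z" "h (h' z) = z" if "z \<in> cball 0 1" for z
    using id[OF h'(1) h(1,2) h'(3) h(3) step[OF h'(4) h(4,3) gg'(1)] that]
      id[OF h(1) h'(1,2) h(3) h'(3) step[OF h(4) h'(4,3) gg'(2)] that] by simp_all
  then have "bij_betw h (cball 0 1) (cball 0 1)"
    using h(2) h'(2) by (intro bij_betw_byWitness[where f' = h']) auto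
  then show thesis
    using that h by blast
qed


section \<open>Compact sets in metric graphs\<close>


lemma vertex_dist_less_1:
  assumes "vertex_dist E u v < 1"
  shows "u = v"
proof -
  obtain n where n: "(u, v) \<in> (E \<union> E\<inverse>) ^^ n" "(of_nat n :: ennreal) < 1"
    using assms unfolding vertex_dist_def Inf_less_iff by auto
  have "n = 0"
  proof (cases n)
    case (Suc k)
    have "(1::ennreal) \<le> 1 + of_nat k"
      by simp
    then show ?thesis
      using n(2) Suc by (metis leD of_nat_Suc)
  qed
  then show ?thesis
    using n by simp
qed

text \<open>Distinct vertices have distance at least 1, so a distance below 1 is realised along one
  edge or through a single vertex.\<close>

lemma graph_dist_less:
  assumes "graph_dist E x y < ennreal r" and r: "0 < r" "r \<le> 1"
    and pos: "\<And>u a. (u, a) \<in> nearby_vertices x \<Longrightarrow> 0 \<le> a"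
    and pos': "\<And>u a. (u, a) \<in> nearby_vertices y \<Longrightarrow> 0 \<le> a"
  obtains u v s t where "x = Inner u v s" "y = Inner u v t" "\<bar>s - t\<bar> < r"
  | u a b where "(u, a) \<in> nearby_vertices x" "(u, b) \<in> nearby_vertices y" "a < r" "b < r"
proof -
  consider "along_edge_dist x y < ennreal r"
    | u a v b where "(u, a) \<in> nearby_vertices x" "(v, b) \<in> nearby_vertices y"
      "ennreal a + vertex_dist E u v + ennreal b < ennreal r"
    using assms(1) unfolding graph_dist_def min_less_iff_disj by (auto simp: Inf_less_iff)
  then show thesis
  proof cases
    case 1
    then show ?thesis
    proof (cases "(x, y)" rule: along_edge_dist.cases)
      case (1 u v s u' v' t)
      then show ?thesis
        using \<open>along_edge_dist x y < ennreal r\<close> that(1)[of u v s t] r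
        by (auto split: if_splits simp: ennreal_less_iff)
    qed auto
  next
    case (2 u a v b)
    have "ennreal a \<le> ennreal a + vertex_dist E u v + ennreal b"
      "ennreal b \<le> ennreal a + vertex_dist E u v + ennreal b"
      "vertex_dist E u v \<le> ennreal a + vertex_dist E u v + ennreal b"
      by (simp_all add: add.assoc add.left_commute add_increasing2 add_increasing)
    then have "ennreal a < ennreal r" "ennreal b < ennreal r" "vertex_dist E u v < ennreal r"
      using 2(3) by (meson order.strict_trans1)+
    moreover have "ennreal r \<le> 1"
      using r by (simp add: ennreal_le_1)
    ultimately have "u = v" "a < r" "b < r"
      using vertex_dist_less_1 r pos[OF 2(1)] pos'[OF 2(2)]
      by (metis order.strict_trans2, simp_all add: ennreal_less_iff)
    then show ?thesis
      using that(2) 2 by blast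
  qed
qed

lemma nearby_nonneg: "x \<in> graph_points V E \<Longrightarrow> (u, a) \<in> nearby_vertices x \<Longrightarrow> 0 \<le> a"
  by (auto simp: graph_points_def)

lemma openin_star:
  assumes c: "0 < c" "c \<le> 1"
  shows "openin (graph_topology V E) {x \<in> graph_points V E. \<exists>a<c. (v, a) \<in> nearby_vertices x}"
    (is "openin _ ?O")
  unfolding openin_graph_topology
proof (intro conjI ballI)
  fix x assume "x \<in> ?O"
  then obtain a where x: "x \<in> graph_points V E" and a: "a < c" "(v, a) \<in> nearby_vertices x"
    by blast
  \<comment> \<open>The bound \<open>c - a\<close> keeps points of the same edge inside the star.
    For an inner point \<open>r\<close> also does not exceed the distance to either end, so a path
    through a vertex occurs only if \<open>x\<close> is the centre itself.\<close>
  obtain r where r: "0 < r" "r \<le> 1" "r \<le> c - a"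
    and small: "\<And>u b. (u, b) \<in> nearby_vertices x \<Longrightarrow> b < r \<Longrightarrow> u = v \<and> b = 0"
  proof (cases x)
    case (Vertex w)
    then show ?thesis
      using a c that[of c] by auto
  next
    case (Inner u w s)
    then have "0 < s" "s < 1"
      using x by (auto simp: graph_points_def)
    then show ?thesis
      using Inner a c that[of "min (c - a) (min s (1 - s))"] by auto
  qed
  have "y \<in> ?O" if y: "y \<in> graph_points V E" and d: "graph_dist E x y < ennreal r" for y
  proof (rule graph_dist_less[OF d r(1,2) nearby_nonneg[OF x] nearby_nonneg[OF y]])
    fix u w s t assume st: "x = Inner u w s" "y = Inner u w t" "\<bar>s - t\<bar> < r"
    from a(2) st(1) consider "v = u" "a = s" | "v = w" "a = 1 - s"
      by auto
    then show "y \<in> ?O"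
    proof cases
      case 1
      then have "t < c" "(v, t) \<in> nearby_vertices y"
        using st r by auto
      then show ?thesis
        using y by blast
    next
      case 2
      then have "1 - t < c" "(v, 1 - t) \<in> nearby_vertices y"
        using st r by auto
      then show ?thesis
        using y by blast
    qed
  next
    fix u b b' assume b: "(u, b) \<in> nearby_vertices x" "(u, b') \<in> nearby_vertices y" "b < r" "b' < r"
    then have "u = v" "b = 0"
      using small by auto
    then have "b' < c"
      using b(4) r a nearby_nonneg[OF x a(2)] by simp
    then show "y \<in> ?O"
      using y b(2) \<open>u = v\<close> by blast
  qed
  then show "\<exists>r>0. \<forall>y\<in>graph_points V E. graph_dist E x y < r \<longrightarrow> y \<in> ?O"
    using r(1) by (intro exI[of _ "ennreal r"]) auto
qed blast

lemma openin_edge: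
  "openin (graph_topology V E) {x \<in> graph_points V E. \<exists>t. x = Inner u v t}"
    (is "openin _ ?O")
  unfolding openin_graph_topology
proof (intro conjI ballI)
  fix x assume "x \<in> ?O"
  then obtain s where x: "x \<in> graph_points V E" "x = Inner u v s"
    by blast
  then have s: "0 < s" "s < 1"
    by (auto simp: graph_points_def)
  \<comment> \<open>No path shorter than this reaches an end of the edge.\<close>
  define r where "r = min s (1 - s)"
  have r: "0 < r" "r \<le> 1"
    using s by (auto simp: r_def)
  have "y \<in> ?O" if y: "y \<in> graph_points V E" and d: "graph_dist E x y < ennreal r" for y
    by (rule graph_dist_less[OF d r nearby_nonneg[OF x(1)] nearby_nonneg[OF y]])
      (use x y in \<open>auto simp: r_def\<close>)
  then show "\<exists>r>0. \<forall>y\<in>graph_points V E. graph_dist E x y < r \<longrightarrow> y \<in> ?O"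
    using r(1) by (intro exI[of _ "ennreal r"]) auto
qed blast

lemma topspace_graph_topology: "topspace (graph_topology V E) = graph_points V E"
proof
  show "topspace (graph_topology V E) \<subseteq> graph_points V E"
    using openin_topspace[of "graph_topology V E"] unfolding openin_graph_topology by blast
  have "openin (graph_topology V E) (graph_points V E)"
    unfolding openin_graph_topology by (auto intro: exI[of _ 1])
  then show "graph_points V E \<subseteq> topspace (graph_topology V E)"
    by (rule openin_subset)
qed

text \<open>The bound 2/3 is less than the distance of the points of a star of radius 1/3 to the other
  end of their edge. Hence no local finiteness of the graph is needed.\<close>

lemma compact_finite_nearby_vertices:
  assumes "compactin (graph_topology V E) K"
  shows "finite {v. \<exists>x\<in>K. \<exists>a<2/3. (v, a) \<in> nearby_vertices x}"
proof -
  define star where "star = (\<lambda>v. {x \<in> graph_points V E. \<exists>a<1/3. (v, a) \<in> nearby_vertices x})"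
  define edge where "edge = (\<lambda>u v. {x \<in> graph_points V E. \<exists>t. x = Inner u v t})"
  let ?N = "\<lambda>A. {v. \<exists>x\<in>A. \<exists>a<2/3. (v, a) \<in> nearby_vertices x}"
  \<comment> \<open>Stars catch the vertices and open edges the inner points. Each member of this
    cover has at most two vertices within 2/3 of its points, so a finite subcover bounds their
    number.\<close>
  define \<U> where "\<U> = range star \<union> (\<Union>u. range (edge u))"
  have sub: "K \<subseteq> graph_points V E"
    using compactin_subset_topspace[OF assms] by (simp add: topspace_graph_topology)
  have "\<forall>U\<in>\<U>. openin (graph_topology V E) U"
    using openin_star[of "1/3"] openin_edge by (auto simp: \<U>_def star_def edge_def)
  moreover have "K \<subseteq> \<Union>\<U>"
  proof
    fix x assume "x \<in> K"
    then have "x \<in> graph_points V E"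
      using sub by blast
    then show "x \<in> \<Union>\<U>"
      by (cases x) (auto simp: \<U>_def star_def edge_def)
  qed
  ultimately obtain \<F> where \<F>: "finite \<F>" "\<F> \<subseteq> \<U>" "K \<subseteq> \<Union>\<F>"
    using assms unfolding compactin_def by meson
  have "finite (?N U)" if U: "U \<in> \<U>" for U
  proof -
    consider v where "U = star v" | u v where "U = edge u v"
      using U unfolding \<U>_def by blast
    then show ?thesis
    proof cases
      case 1
      have "w = v" if "x \<in> star v" "a < 2/3" "(w, a) \<in> nearby_vertices x" for x w a
        using that by (cases x) (auto simp: star_def)
      then have "?N U \<subseteq> {v}"
        using 1 by blast
      then show ?thesis
        using finite_subset by blast
    next
      case 2
      then have "?N U \<subseteq> {u, v}"
        by (auto simp: edge_def)
      then show ?thesis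
        using finite_subset by blast
    qed
  qed
  then have "finite (\<Union>U\<in>\<F>. ?N U)"
    using \<F> by (intro finite_UN_I) auto
  moreover have "?N K \<subseteq> (\<Union>U\<in>\<F>. ?N U)"
    using \<F>(3) by blast
  ultimately show ?thesis
    by (rule rev_finite_subset)
qed

lemma nearby_vertices_map: "(v, a) \<in> nearby_vertices x \<Longrightarrow> (f v, a) \<in> nearby_vertices (map_graph_point f x)"
  by (cases x) auto

text \<open>Every point of an edge is within 1/2 of one of its ends, and 1/2 is less than
  2/3.\<close>

lemma nearest_vertex:
  assumes "x \<in> graph_points V E" "E \<subseteq> V \<times> V"
  obtains v a where "v \<in> V" "a < 2/3" "(v, a) \<in> nearby_vertices x"
proof (cases x)
  case (Vertex v)
  then show thesis
    using assms that[of v 0] by (auto simp: graph_points_def)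
next
  case (Inner u v t)
  then show thesis
    using assms that[of u t] that[of v "1 - t"] by (cases "t < 2/3") (auto simp: graph_points_def)
qed

text \<open>The induced map of graph points keeps the position on an edge, so a vertex near
  \<open>x\<close> goes to a vertex equally near to the image of \<open>x\<close>. If both points
  lie in \<open>K\<close>, both vertices lie in one finite set, and only finitely many group
  elements take one to the other.\<close>

lemma proper_action_graph:
  assumes E: "E \<subseteq> V \<times> V"
    and fin: "\<And>v w. v \<in> V \<Longrightarrow> w \<in> V \<Longrightarrow> finite {\<gamma> \<in> G. act \<gamma> v = w}"
  shows "proper_action G (\<lambda>\<gamma>. map_graph_point (act \<gamma>)) (graph_topology V E)"
  unfolding proper_action_def
proof (intro allI impI)
  fix K assume K: "compactin (graph_topology V E) K"
  let ?N = "{v. \<exists>x\<in>K. \<exists>a<2/3. (v, a) \<in> nearby_vertices x}"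
  have sub: "K \<subseteq> graph_points V E"
    using compactin_subset_topspace[OF K] by (simp add: topspace_graph_topology)
  have "finite ?N"
    by (rule compact_finite_nearby_vertices[OF K])
  moreover have "?N \<subseteq> V"
  proof
    fix v assume "v \<in> ?N"
    then obtain x a where "x \<in> graph_points V E" "(v, a) \<in> nearby_vertices x"
      using sub by blast
    then show "v \<in> V"
      using E by (cases x) (auto simp: graph_points_def)
  qed
  ultimately have "finite (\<Union>v\<in>?N. \<Union>w\<in>?N. {\<gamma> \<in> G. act \<gamma> v = w})"
    using fin by (intro finite_UN_I) (auto simp: subset_iff)
  moreover have "{\<gamma> \<in> G. map_graph_point (act \<gamma>) ` K \<inter> K \<noteq> {}}
      \<subseteq> (\<Union>v\<in>?N. \<Union>w\<in>?N. {\<gamma> \<in> G. act \<gamma> v = w})"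
  proof
    fix \<gamma> assume "\<gamma> \<in> {\<gamma> \<in> G. map_graph_point (act \<gamma>) ` K \<inter> K \<noteq> {}}"
    then obtain x where x: "\<gamma> \<in> G" "x \<in> K" "map_graph_point (act \<gamma>) x \<in> K"
      by blast
    obtain v a where v: "v \<in> V" "a < 2/3" "(v, a) \<in> nearby_vertices x"
      using nearest_vertex[OF _ E] x(2) sub by blast
    have "v \<in> ?N"
      using x(2) v by blast
    moreover have "act \<gamma> v \<in> ?N"
      using x(3) v(2) nearby_vertices_map[OF v(3)] by blast
    ultimately show "\<gamma> \<in> (\<Union>v\<in>?N. \<Union>w\<in>?N. {\<gamma> \<in> G. act \<gamma> v = w})"
      using x(1) by blast
  qed
  ultimately show "finite {\<gamma> \<in> G. map_graph_point (act \<gamma>) ` K \<inter> K \<noteq> {}}"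
    by (rule rev_finite_subset)
qed


section \<open>Complementary regions as cells\<close>


text \<open>A curve with increasing real part is the graph of a function \<open>u\<close> over an
  interval, and a vertical shear straightens it. Removing the axis from a small box leaves an upper
  and a lower half, both connected.\<close>

lemma graph_two_sides:
  fixes c :: "real \<Rightarrow> complex"
  assumes ab: "\<alpha> < x" "x < \<beta>" and cont: "continuous_on {\<alpha>..\<beta>} c"
    and mono: "strict_mono_on {\<alpha>..\<beta>} (\<lambda>t. Re (c t))" and W: "open W" "c x \<in> W"
  obtains V C1 C2 where "open V" "c x \<in> V" "V \<subseteq> W" "connected C1" "connected C2"
    "C1 \<union> C2 = V - c ` {\<alpha>..\<beta>}"
proof -
  define p where "p = (\<lambda>t. Re (c t))"
  define r where "r = inv_into {\<alpha>..\<beta>} p"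
  define u where "u = (\<lambda>X. Im (c (r X)))"
  have p_less: "p s < p t" if "\<alpha> \<le> s" "s < t" "t \<le> \<beta>" for s t
    using mono that unfolding strict_mono_on_def p_def by simp
  have inj: "inj_on p {\<alpha>..\<beta>}"
    using strict_mono_on_imp_inj_on[OF mono] by (simp add: p_def)
  have contp: "continuous_on {\<alpha>..\<beta>} p"
    unfolding p_def by (intro continuous_intros cont)
  have rp: "r (p t) = t" if "t \<in> {\<alpha>..\<beta>}" for t
    using inj that by (simp add: r_def)
  have img: "X \<in> p ` {\<alpha>..\<beta>}" if "X \<in> {p \<alpha><..<p \<beta>}" for X
    using IVT'[of p \<alpha> X \<beta>] that contp ab by auto
  have pr: "p (r X) = X" "r X \<in> {\<alpha>..\<beta>}" if "X \<in> {p \<alpha><..<p \<beta>}" for X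
    unfolding r_def by (rule f_inv_into_f[OF img[OF that]], rule inv_into_into[OF img[OF that]])
  let ?D = "{p \<alpha><..<p \<beta>}"
  have "continuous_on (p ` {\<alpha>..\<beta>}) r"
    by (rule continuous_on_inv[OF contp]) (use rp in auto)
  then have contr: "continuous_on ?D r"
    by (rule continuous_on_subset) (use img in blast)
  have "continuous_on ?D (\<lambda>X. c (r X))"
    by (rule continuous_on_compose2[OF cont contr]) (use pr in blast)
  then have contu: "continuous_on ?D u"
    unfolding u_def by (intro continuous_intros)
  \<comment> \<open>The shear that takes the real axis to the curve; its second argument is the
    height above the curve.\<close>
  define \<psi> where "\<psi> = (\<lambda>z. Complex (fst z) (u (fst z) + snd z))"
  have cont\<psi>: "continuous_on (?D \<times> UNIV) \<psi>"
    unfolding \<psi>_def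
    by (intro continuous_intros continuous_on_compose2[OF contu]) auto
  have x: "x \<in> {\<alpha>..\<beta>}" "p x \<in> ?D"
    using ab p_less by auto
  have cx: "c x = \<psi> (p x, 0)"
    using rp[OF x(1)] by (simp add: \<psi>_def u_def p_def)
  have "open ((?D \<times> UNIV) \<inter> \<psi> -` W)"
    by (intro continuous_open_preimage cont\<psi> W open_Times) auto
  moreover have "(p x, 0) \<in> (?D \<times> UNIV) \<inter> \<psi> -` W"
    using x cx W by simp
  ultimately obtain A B where AB: "open A" "open B" "(p x, 0) \<in> A \<times> B"
      "A \<times> B \<subseteq> (?D \<times> UNIV) \<inter> \<psi> -` W"
    unfolding open_prod_def by metis
  obtain e1 e2 where e: "e1 > 0" "ball (p x) e1 \<subseteq> A" "e2 > 0" "ball 0 e2 \<subseteq> B"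
    using AB by (metis mem_Sigma_iff open_contains_ball)
  let ?I = "ball (p x) e1" and ?J = "{0<..<e2}" and ?J' = "{-e2<..<0}"
  have ID: "?I \<subseteq> ?D"
    using AB(4) e AB(3) by blast
  have JB: "?J \<subseteq> ball 0 e2" "?J' \<subseteq> ball 0 e2"
    by auto
  define V where "V = \<psi> ` (?I \<times> ball 0 e2)"
  have V: "V = {z. Re z \<in> ?I} \<inter> (\<lambda>z. Im z - u (Re z)) -` ball 0 e2"
  proof (intro equalityI subsetI)
    fix z assume "z \<in> {z. Re z \<in> ?I} \<inter> (\<lambda>z. Im z - u (Re z)) -` ball 0 e2"
    moreover have "z = \<psi> (Re z, Im z - u (Re z))"
      by (simp add: \<psi>_def)
    ultimately show "z \<in> V"
      unfolding V_def by blast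
  qed (auto simp: V_def \<psi>_def)
  have openI: "open {z. Re z \<in> ?I}"
    using open_vimage[OF open_ball, of Re "p x" e1] continuous_on_Re[OF continuous_on_id]
    by (simp add: vimage_def)
  have "open V"
    unfolding V using ID
    by (intro continuous_open_preimage openI open_ball continuous_intros
        continuous_on_compose2[OF contu]) auto
  moreover have "c x \<in> V"
    unfolding V_def cx using e by (intro imageI) auto
  moreover have "V \<subseteq> W"
  proof -
    have "?I \<times> ball 0 e2 \<subseteq> \<psi> -` W"
      using AB(4) Sigma_mono[OF e(2) e(4)] by blast
    then show ?thesis
      unfolding V_def by blast
  qed
  moreover have "connected (\<psi> ` (?I \<times> ?J))" "connected (\<psi> ` (?I \<times> ?J'))"
    by (intro connected_continuous_image continuous_on_subset[OF cont\<psi>] connected_Times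
        convex_connected; use ID in auto)+
  moreover have "\<psi> ` (?I \<times> ?J) \<union> \<psi> ` (?I \<times> ?J') = V - c ` {\<alpha>..\<beta>}"
  proof -
    have on: "Im z = u (Re z)" if "z \<in> c ` {\<alpha>..\<beta>}" for z
      using that rp by (auto simp: u_def p_def)
    have off: "z \<in> c ` {\<alpha>..\<beta>}" if z: "Re z \<in> ?I" "Im z = u (Re z)" for z
    proof
      have "Re z \<in> ?D"
        using z ID by blast
      then show "r (Re z) \<in> {\<alpha>..\<beta>}" "z = c (r (Re z))"
        using pr[of "Re z"] z by (auto simp: complex_eq_iff u_def p_def)
    qed
    have "V - c ` {\<alpha>..\<beta>} = \<psi> ` (?I \<times> (ball 0 e2 - {0}))"
    proof (intro equalityI subsetI)
      fix z assume "z \<in> V - c ` {\<alpha>..\<beta>}"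
      then obtain X Y where "z = \<psi> (X, Y)" "X \<in> ?I" "Y \<in> ball 0 e2" "Y \<noteq> 0"
        using off unfolding V_def by (fastforce simp: \<psi>_def)
      then show "z \<in> \<psi> ` (?I \<times> (ball 0 e2 - {0}))"
        by blast
    next
      fix z assume "z \<in> \<psi> ` (?I \<times> (ball 0 e2 - {0}))"
      then obtain X Y where XY: "z = \<psi> (X, Y)" "X \<in> ?I" "Y \<in> ball 0 e2" "Y \<noteq> 0"
        by blast
      then have "Im z \<noteq> u (Re z)"
        by (simp add: \<psi>_def)
      then show "z \<in> V - c ` {\<alpha>..\<beta>}"
        using on XY unfolding V_def by blast
    qed
    moreover have "ball (0::real) e2 - {0} = ?J \<union> ?J'"
      by auto
    ultimately show ?thesis
      by (simp only: Sigma_Un_distrib2 image_Un)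
  qed
  ultimately show thesis
    using that by blast
qed

text \<open>Multiplication by \<open>d\<close> rotates and scales the plane so that the arc advances
  to the right, which makes it a graph.\<close>

lemma arc_two_sides:
  fixes c :: "real \<Rightarrow> complex"
  assumes ab: "\<alpha> < x" "x < \<beta>" and cont: "continuous_on {\<alpha>..\<beta>} c" and d: "d \<noteq> 0"
    and mono: "strict_mono_on {\<alpha>..\<beta>} (\<lambda>t. Re (c t * d))" and W: "open W" "c x \<in> W"
  obtains V C1 C2 where "open V" "c x \<in> V" "V \<subseteq> W" "connected C1" "connected C2"
    "C1 \<union> C2 = V - c ` {\<alpha>..\<beta>}"
proof -
  let ?L = "\<lambda>z. z * d" and ?M = "\<lambda>z. z / d"
  have opens: "open (?M -` A)" "open (?L -` A)" if "open A" for A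
    using d that by (intro open_vimage continuous_intros; simp)+
  have LM: "?L ` A = ?M -` A" "?M ` A = ?L -` A" for A
  proof -
    have "z \<in> ?L ` A" if "z / d \<in> A" for z
      using that d by (intro image_eqI[of _ _ "z / d"]) auto
    then show "?L ` A = ?M -` A"
      using d by auto
    have "z \<in> ?M ` A" if "z * d \<in> A" for z
      using that d by (intro image_eqI[of _ _ "z * d"]) auto
    then show "?M ` A = ?L -` A"
      using d by auto
  qed
  have W': "open (?L ` W)" "c x * d \<in> ?L ` W"
    using opens(1)[OF W(1)] W(2) by (simp only: LM(1), blast)
  have cont': "continuous_on {\<alpha>..\<beta>} (\<lambda>t. c t * d)"
    by (intro continuous_intros cont)
  obtain V C1 C2 where V: "open V" "c x * d \<in> V" "V \<subseteq> ?L ` W" "connected C1" "connected C2"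
      "C1 \<union> C2 = V - (\<lambda>t. c t * d) ` {\<alpha>..\<beta>}"
    using graph_two_sides[OF ab cont' mono W'] by blast
  show thesis
  proof
    show "open (?M ` V)"
      using opens(2)[OF V(1)] by (simp only: LM(2))
    show "c x \<in> ?M ` V"
      using V(2) d by (intro image_eqI[of _ _ "c x * d"]) auto
    show "?M ` V \<subseteq> W"
      using V(3) d by (auto simp: subset_iff image_iff)
    show "connected (?M ` C1)" "connected (?M ` C2)"
      using V(4,5) d by (auto intro!: connected_continuous_image continuous_intros)
    have "c ` {\<alpha>..\<beta>} = ?M ` (\<lambda>t. c t * d) ` {\<alpha>..\<beta>}"
      using d by (simp add: image_image)
    moreover have "inj ?M"
      using d by (simp add: inj_on_def)
    ultimately show "?M ` C1 \<union> ?M ` C2 = ?M ` V - c ` {\<alpha>..\<beta>}"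
      by (metis V(6) image_Un image_set_diff)
  qed
qed

lemma topspace_surf: "topspace (surf S) = topspace (closed_surf S) - punctures S"
  by (auto simp: surf_def)

lemma surf_eq_subtopology: "surf S = subtopology (closed_surf S) (topspace (surf S))"
  by (metis surf_def topspace_surf)

lemma embedded_complexD:
  assumes "embedded_complex S \<tau>"
  shows "finite \<tau>" "\<And>b. b \<in> \<tau> \<Longrightarrow> continuous_map (top_of_set {0..1}) (surf S) b"
    "\<And>b b' s t. b \<in> \<tau> \<Longrightarrow> b' \<in> \<tau> \<Longrightarrow> s \<in> {0<..<1} \<Longrightarrow> t \<in> {0..1} \<Longrightarrow> b s = b' t \<Longrightarrow> b = b' \<and> s = t"
proof -
  show "finite \<tau>"
    using assms by (simp add: embedded_complex_def)
  show "continuous_map (top_of_set {0..1}) (surf S) b" if "b \<in> \<tau>" for b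
    using assms that by (simp add: embedded_complex_def regular_curve_def)
  show "b = b' \<and> s = t"
    if "b \<in> \<tau>" "b' \<in> \<tau>" "s \<in> {0<..<1}" "t \<in> {0..1}" "b s = b' t" for b b' s t
  proof -
    have "\<forall>b\<in>\<tau>. \<forall>b'\<in>\<tau>. b \<noteq> b' \<longrightarrow> (\<forall>s\<in>{0<..<1}. \<forall>t\<in>{0..1}. b s \<noteq> b' t)"
      using assms unfolding embedded_complex_def by (elim conjE)
    then have "b = b'"
      using that by blast
    moreover have "\<forall>s\<in>{0<..<1}. \<forall>t\<in>{0..1}. b s = b t \<longrightarrow> s = t"
      using assms that(1) unfolding embedded_complex_def by (elim conjE) (drule (1) bspec, elim conjE)
    ultimately show ?thesis
      using that by blast
  qed
qed

lemma support_subset: "embedded_complex S \<tau> \<Longrightarrow> support \<tau> \<subseteq> topspace (surf S)"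
  using embedded_complexD(2) continuous_map_image_subset_topspace unfolding support_def by fastforce

lemma regular_curve_strict_mono:
  assumes c: "regular_curve S 1 {0..1} b" and U: "(U, \<phi>) \<in> charts S" "openin (closed_surf S) U" "b (1/2) \<in> U"
  obtains \<alpha> \<beta> d where "0 < \<alpha>" "\<alpha> < 1/2" "1/2 < \<beta>" "\<beta> < 1" "d \<noteq> 0" "b ` {\<alpha>..\<beta>} \<subseteq> U"
    "continuous_on {\<alpha>..\<beta>} (\<phi> \<circ> b)" "strict_mono_on {\<alpha>..\<beta>} (\<lambda>t. Re ((\<phi> \<circ> b) t * d))"
proof -
  define J where "J = {t \<in> {0..1}. b t \<in> U}"
  define f where "f = \<phi> \<circ> b"
  \<comment> \<open>\<open>C_k_on\<close> speaks of Frechet derivatives in basis directions. On the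
    real line the only one is 1, so the velocity in this form is what is known to be
    continuous.\<close>
  define v where "v = (\<lambda>t. frechet_derivative f (at t within J) 1)"
  have cb: "continuous_map (top_of_set {0..1}) (surf S) b"
    using c by (simp add: regular_curve_def)
  have "C_k_on 1 J f \<and> (\<forall>t\<in>J. f differentiable (at t within J) \<and> vector_derivative f (at t within J) \<noteq> 0)"
    using c U(1) unfolding regular_curve_def Let_def J_def f_def by blast
  then have f: "continuous_on J v"
    "\<And>t. t \<in> J \<Longrightarrow> f differentiable (at t within J)" "\<And>t. t \<in> J \<Longrightarrow> vector_derivative f (at t within J) \<noteq> 0"
    by (auto simp: v_def)
  have "continuous_map (top_of_set {0..1}) (closed_surf S) b"
    using cb by (simp add: surf_def continuous_map_in_subtopology)
  from openin_continuous_map_preimage[OF this U(2)]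
  have "openin (top_of_set {0..1}) J"
    by (simp add: J_def)
  then obtain T where T: "open T" "J = {0..1} \<inter> T"
    by (auto simp: openin_open)
  have "1/2 \<in> J"
    using U(3) by (simp add: J_def)
  then have "1/2 \<in> T \<inter> {0<..<1}"
    unfolding T(2) by simp
  moreover have "open (T \<inter> {0<..<1})"
    using T(1) by (intro open_Int) auto
  ultimately obtain e where e: "e > 0" "ball (1/2) e \<subseteq> T \<inter> {0<..<1}"
    by (meson open_contains_ball)
  have ballJ: "ball (1/2) e \<subseteq> J"
    using e T(2) by auto
  have deriv: "(f has_vector_derivative v t) (at t)" if t: "t \<in> ball (1/2) e" for t
  proof -
    have tJ: "t \<in> J" "t \<in> interior J"
      using t ballJ by (auto intro: interiorI[of "ball (1/2) e"])
    have D: "(f has_derivative frechet_derivative f (at t within J)) (at t within J)"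
      using f(2)[OF tJ(1)] by (simp add: frechet_derivative_works)
    have "frechet_derivative f (at t within J) h = h *\<^sub>R v t" for h
      using linear_cmul[OF has_derivative_linear[OF D], of h 1] by (simp add: v_def)
    then have "frechet_derivative f (at t within J) = (\<lambda>h. h *\<^sub>R v t)"
      by blast
    with D have "(f has_vector_derivative v t) (at t within J)"
      by (simp add: has_vector_derivative_def)
    then show ?thesis
      using at_within_interior[OF tJ(2)] by simp
  qed
  \<comment> \<open>Multiplied by its own conjugate, the velocity at the midpoint becomes a positive
    real number. By continuity the real part of \<open>v t * d\<close> stays positive nearby, so the
    rotated curve advances to the right.\<close>
  define d where "d = cnj (v (1/2))"
  have half: "1/2 \<in> ball (1/2) e" "1/2 \<in> J"
    using e ballJ by auto
  have "vector_derivative f (at (1/2) within J) = v (1/2)"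
  proof -
    have "1/2 \<in> interior J"
      using half ballJ by (auto intro: interiorI[of "ball (1/2) e"])
    then show ?thesis
      using vector_derivative_at[OF deriv[OF half(1)]] by (simp only: at_within_interior)
  qed
  then have d: "d \<noteq> 0"
    using f(3)[OF half(2)] by (simp add: d_def)
  have "continuous_on (ball (1/2) e) (\<lambda>t. Re (v t * d))"
    by (intro continuous_intros continuous_on_subset[OF f(1) ballJ])
  then have "open (ball (1/2) e \<inter> (\<lambda>t. Re (v t * d)) -` {0<..})"
    by (intro continuous_open_preimage) auto
  moreover have "Re (v (1/2) * d) > 0"
  proof -
    have "v (1/2) * d = of_real ((cmod d)\<^sup>2)"
      unfolding d_def complex_norm_square by simp
    then show ?thesis
      using d by simp
  qed
  ultimately obtain e' where e': "e' > 0" "cball (1/2) e' \<subseteq> ball (1/2) e \<inter> (\<lambda>t. Re (v t * d)) -` {0<..}"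
    using half(1) by (metis (no_types, lifting) IntI greaterThan_iff open_contains_cball vimageI)
  have I: "{1/2 - e'..1/2 + e'} = cball (1/2) e'"
    by (simp add: cball_eq_atLeastAtMost)
  have sub: "{1/2 - e'..1/2 + e'} \<subseteq> {0<..<1}" "b ` {1/2 - e'..1/2 + e'} \<subseteq> U"
    using e'(2) e(2) ballJ unfolding I by (blast, auto simp: J_def)
  have "strict_mono_on {1/2 - e'..1/2 + e'} (\<lambda>t. Re (f t * d))"
  proof (rule strict_mono_onI)
    fix r s :: real assume rs: "r \<in> {1/2 - e'..1/2 + e'}" "s \<in> {1/2 - e'..1/2 + e'}" "r < s"
    show "Re (f r * d) < Re (f s * d)"
    proof (rule DERIV_pos_imp_increasing[OF rs(3)])
      fix t assume "r \<le> t" "t \<le> s"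
      then have "t \<in> {1/2 - e'..1/2 + e'}"
        using rs by auto
      then have t: "t \<in> ball (1/2) e" "Re (v t * d) > 0"
        using e'(2) unfolding I by auto
      have "((\<lambda>t. f t * d) has_vector_derivative v t * d) (at t)"
        by (rule has_vector_derivative_mult_left[OF deriv[OF t(1)]])
      then have "((\<lambda>t. Re (f t * d)) has_vector_derivative Re (v t * d)) (at t)"
        by (rule bounded_linear.has_vector_derivative[OF bounded_linear_Re])
      then show "\<exists>y. DERIV (\<lambda>t. Re (f t * d)) t :> y \<and> y > 0"
        using t(2) has_real_derivative_iff_has_vector_derivative by blast
    qed
  qed
  moreover have "continuous_on {1/2 - e'..1/2 + e'} f"
  proof (rule continuous_on_vector_derivative[where f' = v])
    fix t assume "t \<in> {1/2 - e'..1/2 + e'}"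
    then have "t \<in> ball (1/2) e"
      using e'(2) unfolding I by blast
    then show "(f has_vector_derivative v t) (at t within {1/2 - e'..1/2 + e'})"
      by (rule has_vector_derivative_at_within[OF deriv])
  qed
  moreover have "0 < 1/2 - e'" "1/2 + e' < 1"
    using sub(1) e'(1) by (auto simp: subset_iff)
  ultimately show thesis
    using that[of "1/2 - e'" "1/2 + e'" d] d e'(1) sub(2) by (simp add: f_def)
qed

text \<open>Near the midpoint of a branch, unlike at a switch, the track is a single short arc: the
  remaining part \<open>Z\<close> of the track is compact and misses the midpoint, so it can be
  removed from a chart domain together with the punctures.\<close>

lemma branch_two_sides:
  assumes S: "oriented_surface S g k" and \<tau>: "embedded_complex S \<tau>" and b: "b \<in> \<tau>"
  obtains N C1 C2 where "openin (closed_surf S) N" "b (1/2) \<in> N" "connectedin (closed_surf S) C1"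
    "connectedin (closed_surf S) C2" "C1 \<union> C2 = N - support \<tau>" "N \<subseteq> topspace (surf S)"
proof -
  let ?M = "closed_surf S"
  have M: "Hausdorff_space ?M" and at: "oriented_smooth_atlas ?M (charts S)"
    and pu: "punctures S \<subseteq> topspace ?M" "finite (punctures S)"
    using S by (auto simp: oriented_surface_def)
  have cb: "continuous_map (top_of_set {0..1}) ?M b'" if "b' \<in> \<tau>" for b'
    using embedded_complexD(2)[OF \<tau> that] by (simp add: surf_def continuous_map_in_subtopology)
  have comp: "closedin ?M (b' ` A)" if "b' \<in> \<tau>" "compact A" "A \<subseteq> {0..1}" for b' A
  proof -
    have "compactin (top_of_set {0..1}) A"
      using that(2,3) by (simp add: compactin_subtopology)
    then show ?thesis
      using image_compactin[OF _ cb[OF that(1)]] compactin_imp_closedin[OF M] by blast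
  qed
  have x: "b (1/2) \<in> topspace (surf S)"
    using continuous_map_image_subset_topspace[OF embedded_complexD(2)[OF \<tau> b]] by auto
  then have "b (1/2) \<in> (\<Union>(U, \<phi>)\<in>charts S. U)"
    using at unfolding oriented_smooth_atlas_def by (simp add: topspace_surf)
  then obtain U \<phi> where U: "(U, \<phi>) \<in> charts S" "b (1/2) \<in> U"
    by blast
  have chart: "openin ?M U" "open (\<phi> ` U)" "homeomorphic_map (subtopology ?M U) (top_of_set (\<phi> ` U)) \<phi>"
    using at U(1) unfolding oriented_smooth_atlas_def by blast+
  have reg: "regular_curve S 1 {0..1} b"
    using \<tau> b by (simp add: embedded_complex_def)
  obtain \<alpha> \<beta> d where ab: "0 < \<alpha>" "\<alpha> < 1/2" "1/2 < \<beta>" "\<beta> < 1" and d: "d \<noteq> 0" and bU: "b ` {\<alpha>..\<beta>} \<subseteq> U"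
    and mono: "continuous_on {\<alpha>..\<beta>} (\<phi> \<circ> b)" "strict_mono_on {\<alpha>..\<beta>} (\<lambda>t. Re ((\<phi> \<circ> b) t * d))"
    using regular_curve_strict_mono[OF reg U(1) chart(1) U(2)] by metis
  define Z where "Z = (\<Union>b'\<in>\<tau> - {b}. b' ` {0..1}) \<union> b ` ({0..\<alpha>} \<union> {\<beta>..1})"
  have "closedin ?M (\<Union>b'\<in>\<tau> - {b}. b' ` {0..1})"
    using embedded_complexD(1)[OF \<tau>] comp by (intro closedin_Union) auto
  moreover have "closedin ?M (b ` ({0..\<alpha>} \<union> {\<beta>..1}))"
    using ab by (intro comp[OF b]) auto
  ultimately have "closedin ?M (Z \<union> punctures S)"
    unfolding Z_def using closedin_Hausdorff_finite[OF M pu] by (intro closedin_Un)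
  then have N0: "openin ?M (U - (Z \<union> punctures S))"
    using chart(1) by (rule openin_diff[rotated])
  define N0 where "N0 = U - (Z \<union> punctures S)"
  have Utop: "U \<subseteq> topspace ?M"
    using openin_subset[OF chart(1)] .
  have not_Z: "b t \<notin> Z" if t: "\<alpha> < t" "t < \<beta>" for t
  proof
    assume "b t \<in> Z"
    then consider b' s where "b' \<in> \<tau>" "b' \<noteq> b" "s \<in> {0..1}" "b t = b' s"
      | s where "s \<in> {0..\<alpha>} \<union> {\<beta>..1}" "b t = b s"
      unfolding Z_def by blast
    then show False
    proof cases
      case (1 b' s)
      then show False
        using embedded_complexD(3)[OF \<tau> b, of b' t s] t ab by auto
    next
      case (2 s)
      then show False
        using embedded_complexD(3)[OF \<tau> b b, of t s] t ab by auto
    qed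
  qed
  have supp: "y \<in> b ` {\<alpha>..\<beta>}" if y: "y \<in> support \<tau>" "y \<in> N0" for y
  proof -
    obtain b' t where bt: "b' \<in> \<tau>" "t \<in> {0..1}" "y = b' t"
      using y(1) unfolding support_def by blast
    have y: "y \<notin> Z"
      using y(2) by (simp add: N0_def)
    then have b': "b' = b"
      using bt unfolding Z_def by blast
    then have "t \<notin> {0..\<alpha>} \<union> {\<beta>..1}"
      using bt y unfolding Z_def by blast
    then show ?thesis
      using bt b' by auto
  qed
  have opn: "open_map (subtopology ?M U) (top_of_set (\<phi> ` U)) \<phi>"
    using chart(3) by (rule homeomorphic_imp_open_map)
  have openW: "open (\<phi> ` N0)"
  proof -
    have "openin (subtopology ?M U) N0"
      using N0 chart(1) unfolding N0_def by (subst openin_open_subtopology) auto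
    then have "openin (top_of_set (\<phi> ` U)) (\<phi> ` N0)"
      using opn by (simp add: open_map_def)
    then show ?thesis
      using chart(2) by (simp add: openin_open_eq)
  qed
  obtain \<psi> where hom: "homeomorphic_maps (subtopology ?M U) (top_of_set (\<phi> ` U)) \<phi> \<psi>"
    using chart(3) homeomorphic_map_maps by blast
  have \<psi>: "continuous_map (top_of_set (\<phi> ` U)) ?M \<psi>" "\<And>y. y \<in> U \<Longrightarrow> \<psi> (\<phi> y) = y"
    and c\<phi>: "continuous_map (subtopology ?M U) (top_of_set (\<phi> ` U)) \<phi>"
    using hom Utop unfolding homeomorphic_maps_def by (auto simp: continuous_map_in_subtopology)
  have "b (1/2) \<in> N0"
    using not_Z[of "1/2"] ab U(2) x by (auto simp: N0_def topspace_surf)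
  then have "(\<phi> \<circ> b) (1/2) \<in> \<phi> ` N0"
    by simp
  then obtain V C1 C2 where V: "open V" "(\<phi> \<circ> b) (1/2) \<in> V" "V \<subseteq> \<phi> ` N0" "connected C1" "connected C2"
    "C1 \<union> C2 = V - (\<phi> \<circ> b) ` {\<alpha>..\<beta>}"
    using arc_two_sides[OF ab(2,3) mono(1) d mono(2) openW] by metis
  define N where "N = {y \<in> U. \<phi> y \<in> V}"
  have N_eq: "\<psi> ` A = {y \<in> U. \<phi> y \<in> A}" if "A \<subseteq> \<phi> ` U" for A
    using that \<psi>(2) by (auto simp: image_iff) (metis imageE subsetD)
  have N0U: "N0 \<subseteq> U"
    by (auto simp: N0_def)
  have VU: "V \<subseteq> \<phi> ` U"
    using V(3) N0U by blast
  have \<phi>inj: "inj_on \<phi> U"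
    using \<psi>(2) by (rule inj_on_inverseI)
  have NN0: "N \<subseteq> N0"
  proof
    fix y assume y: "y \<in> N"
    then obtain y' where "y' \<in> N0" "\<phi> y = \<phi> y'"
      using V(3) by (auto simp: N_def)
    then show "y \<in> N0"
      using inj_onD[OF \<phi>inj, of y y'] N0U y by (auto simp: N_def)
  qed
  show thesis
  proof
    have "openin (subtopology ?M U) {y \<in> topspace (subtopology ?M U). \<phi> y \<in> V}"
      by (rule openin_continuous_map_preimage[OF c\<phi>]) (use V(1) VU in \<open>simp add: openin_open_eq chart(2)\<close>)
    moreover have "{y \<in> topspace (subtopology ?M U). \<phi> y \<in> V} = N"
      using Utop by (auto simp: N_def)
    ultimately show "openin ?M N"
      using chart(1) by (simp add: openin_open_subtopology)
    show "b (1/2) \<in> N"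
      using U(2) V(2) by (simp add: N_def)
    have "C1 \<subseteq> \<phi> ` U" "C2 \<subseteq> \<phi> ` U"
      using V(6) VU by blast+
    then show "connectedin ?M (\<psi> ` C1)" "connectedin ?M (\<psi> ` C2)"
      using connectedin_continuous_map_image[OF \<psi>(1)] V(4,5) by (auto simp: connectedin_subtopology)
    have "\<psi> ` C1 \<union> \<psi> ` C2 = {y \<in> U. \<phi> y \<in> V - (\<phi> \<circ> b) ` {\<alpha>..\<beta>}}"
      unfolding image_Un[symmetric] V(6) by (rule N_eq) (use VU in blast)
    also have "\<dots> = N - support \<tau>"
    proof (intro equalityI subsetI)
      fix y assume y: "y \<in> {y \<in> U. \<phi> y \<in> V - (\<phi> \<circ> b) ` {\<alpha>..\<beta>}}"
      then have "y \<in> N"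
        by (simp add: N_def)
      moreover have "y \<notin> support \<tau>"
        using supp[of y] y NN0 \<open>y \<in> N\<close> by auto
      ultimately show "y \<in> N - support \<tau>"
        by blast
    next
      fix y assume y: "y \<in> N - support \<tau>"
      have "\<phi> y \<notin> (\<phi> \<circ> b) ` {\<alpha>..\<beta>}"
      proof
        assume "\<phi> y \<in> (\<phi> \<circ> b) ` {\<alpha>..\<beta>}"
        then obtain t where t: "t \<in> {\<alpha>..\<beta>}" "\<phi> y = \<phi> (b t)"
          by auto
        moreover have "b t \<in> U" "y \<in> U"
          using bU t(1) y by (blast, simp add: N_def)
        ultimately have "y = b t"
          using inj_onD[OF \<phi>inj t(2)] by blast
        then show False
          using y t(1) b ab by (auto simp: support_def)
      qed
      then show "y \<in> {y \<in> U. \<phi> y \<in> V - (\<phi> \<circ> b) ` {\<alpha>..\<beta>}}"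
        using y by (simp add: N_def)
    qed
    finally show "\<psi> ` C1 \<union> \<psi> ` C2 = N - support \<tau>" .
    show "N \<subseteq> topspace (surf S)"
      using NN0 Utop by (auto simp: N0_def topspace_surf)
  qed
qed

lemma regions_subset:
  assumes "R \<in> complementary_regions S Y"
  shows "R \<subseteq> topspace (surf S)" "R \<inter> Y = {}"
  using connected_components_of_subset[OF assms[unfolded complementary_regions_def]] by auto

text \<open>A connected set off the track lies in one region, so at most two regions accumulate at
  the midpoint of a given branch. By \<open>adj\<close> every region accumulates at one of these
  finitely many midpoints.\<close>

lemma finite_regions:
  assumes S: "oriented_surface S g k" and \<tau>: "embedded_complex S \<tau>"
    and adj: "\<And>R. R \<in> complementary_regions S (support \<tau>) \<Longrightarrow>
      \<exists>b\<in>\<tau>. b (1/2) \<in> closed_surf S closure_of R"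
  shows "finite (complementary_regions S (support \<tau>))"
proof -
  let ?\<R> = "complementary_regions S (support \<tau>)" and ?M = "closed_surf S"
  let ?X = "subtopology (surf S) (topspace (surf S) - support \<tau>)"
  have "finite {R \<in> ?\<R>. b (1/2) \<in> ?M closure_of R}" if b: "b \<in> \<tau>" for b
  proof -
    obtain N C1 C2 where N: "openin ?M N" "b (1/2) \<in> N" "connectedin ?M C1"
      "connectedin ?M C2" "C1 \<union> C2 = N - support \<tau>" "N \<subseteq> topspace (surf S)"
      by (rule branch_two_sides[OF S \<tau> b])
    have X: "?X = subtopology ?M (topspace (surf S) - support \<tau>)"
      by (simp add: surf_def subtopology_subtopology topspace_surf Int_absorb1 Diff_subset)
    have "C1 \<subseteq> topspace (surf S) - support \<tau>" "C2 \<subseteq> topspace (surf S) - support \<tau>"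
      using N(5,6) by blast+
    then have conn: "connectedin ?X C1" "connectedin ?X C2"
      unfolding X using N by (auto simp: connectedin_subtopology)
    have fin: "finite {R \<in> ?\<R>. R \<inter> C \<noteq> {}}" if "connectedin ?X C" for C
    proof -
      have "R = R'" if "R \<in> ?\<R>" "R' \<in> ?\<R>" "R \<inter> C \<noteq> {}" "R' \<inter> C \<noteq> {}" for R R'
      proof -
        have "C \<subseteq> R" "C \<subseteq> R'"
          using that \<open>connectedin ?X C\<close> connected_components_of_maximal
          unfolding complementary_regions_def disjnt_def by blast+
        then have "R \<inter> R' \<noteq> {}"
          using that by blast
        then show ?thesis
          using that connected_components_of_overlap unfolding complementary_regions_def by blast
      qed
      then show ?thesis
        by (metis (mono_tags, lifting) finite.emptyI finite.insertI finite_subset mem_Collect_eq singletonI subsetI)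
    qed
    have "{R \<in> ?\<R>. b (1/2) \<in> ?M closure_of R} \<subseteq> {R \<in> ?\<R>. R \<inter> C1 \<noteq> {}} \<union> {R \<in> ?\<R>. R \<inter> C2 \<noteq> {}}"
    proof
      fix R assume R: "R \<in> {R \<in> ?\<R>. b (1/2) \<in> ?M closure_of R}"
      then obtain y where "y \<in> R" "y \<in> N"
        using N(1,2) unfolding in_closure_of by blast
      then have "y \<in> C1 \<union> C2"
        using regions_subset(2)[of R S "support \<tau>"] R N(5) by blast
      then show "R \<in> {R \<in> ?\<R>. R \<inter> C1 \<noteq> {}} \<union> {R \<in> ?\<R>. R \<inter> C2 \<noteq> {}}"
        using R \<open>y \<in> R\<close> by blast
    qed
    then show ?thesis
      using fin conn by (meson finite_Un finite_subset)
  qed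
  then have "finite (\<Union>b\<in>\<tau>. {R \<in> ?\<R>. b (1/2) \<in> ?M closure_of R})"
    using embedded_complexD(1)[OF \<tau>] by blast
  moreover have "?\<R> \<subseteq> (\<Union>b\<in>\<tau>. {R \<in> ?\<R>. b (1/2) \<in> ?M closure_of R})"
    using adj by blast
  ultimately show ?thesis
    by (rule rev_finite_subset)
qed

text \<open>The set \<open>Z\<close> is empty for a disc and consists of the origin for a once punctured disc.\<close>

definition cell ::
    "'a punctured_surface \<Rightarrow> 'a track \<Rightarrow> 'a set \<Rightarrow> complex set \<Rightarrow> (complex \<Rightarrow> 'a) \<Rightarrow> nat \<Rightarrow>
     (nat \<Rightarrow> 'a half_branch) \<Rightarrow> bool" where
  "cell S \<tau> R Z q m \<beta> \<longleftrightarrow>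
     Z \<subseteq> {0} \<and> q ` Z \<subseteq> punctures S \<and> continuous_map (top_of_set (cball 0 1)) (closed_surf S) q \<and>
     homeomorphic_map (top_of_set (ball 0 1 - Z)) (subtopology (closed_surf S) R) q \<and>
     m > 0 \<and> (\<forall>j<m. \<beta> j \<in> half_branches \<tau> \<and>
       (\<forall>s\<in>{0..1}. q (circle_arc m j s) = half_path (\<beta> j) s))"

text \<open>Maximality leaves two kinds of regions. For the punctured kind the given homeomorphism
  covers the region with its puncture filled in; deleting the origin and its image restores the
  region.\<close>

lemma cell_exists:
  assumes max: "maximal S \<tau>" and R: "R \<in> complementary_regions S (support \<tau>)"
  shows "\<exists>Z q m \<beta>. cell S \<tau> R Z q m \<beta>"
proof -
  have Rs: "R \<subseteq> topspace (surf S)"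
    using regions_subset[OF R] by blast
  then have sub: "subtopology (surf S) R = subtopology (closed_surf S) R"
    by (simp add: surf_def subtopology_subtopology topspace_surf Int_absorb1)
  consider q where "continuous_map (top_of_set (cball 0 1)) (surf S) q"
      "homeomorphic_map (top_of_set (ball 0 1)) (subtopology (surf S) R) q"
      "boundary_with_cusps S \<tau> q 3"
    | q where "q 0 \<in> punctures S" "continuous_map (top_of_set (cball 0 1)) (closed_surf S) q"
      "homeomorphic_map (top_of_set (ball 0 1)) (subtopology (closed_surf S) (insert (q 0) R)) q"
      "boundary_with_cusps S \<tau> q 1"
    using max R unfolding maximal_def disc_with_cusps_def punctured_disc_with_cusps_def by metis
  then show ?thesis
  proof cases
    case (1 q)
    then obtain m \<beta> where "m > 0" "\<forall>j<m. \<beta> j \<in> half_branches \<tau> \<and>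
           (\<forall>s\<in>{0..1}. q (cis (2 * pi * (real j + s) / real m)) = half_path (\<beta> j) s)"
      unfolding boundary_with_cusps_def by blast
    then have "cell S \<tau> R {} q m \<beta>"
      unfolding cell_def circle_arc_def using 1(1,2) unfolding sub
      by (simp add: surf_def continuous_map_in_subtopology)
    then show ?thesis
      by blast
  next
    case (2 q)
    then obtain m \<beta> where m: "m > 0" "\<forall>j<m. \<beta> j \<in> half_branches \<tau> \<and>
           (\<forall>s\<in>{0..1}. q (cis (2 * pi * (real j + s) / real m)) = half_path (\<beta> j) s)"
      unfolding boundary_with_cusps_def by blast
    have q0: "q 0 \<notin> R"
      using 2(1) Rs by (auto simp: topspace_surf)
    have "q 0 \<in> topspace (closed_surf S)"
      using continuous_map_image_subset_topspace[OF 2(2)] by auto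
    then have ins: "topspace (subtopology (closed_surf S) (insert (q 0) R)) = insert (q 0) R"
      using Rs by (auto simp: topspace_surf)
    have img: "q ` ball 0 1 = insert (q 0) R" and inj: "inj_on q (ball 0 1)"
      using homeomorphic_imp_surjective_map[OF 2(3)] homeomorphic_imp_injective_map[OF 2(3)] ins by auto
    have "q ` (ball 0 1 - {0}) = insert (q 0) R - {q 0}"
      using inj_on_image_set_diff[OF inj, of "ball 0 1" "{0}"] img by simp
    then have "q ` (topspace (top_of_set (ball 0 1)) \<inter> (- {0})) =
        topspace (subtopology (closed_surf S) (insert (q 0) R)) \<inter> R"
      using q0 ins by (auto simp: Diff_eq)
    from homeomorphic_map_subtopologies[OF 2(3) this]
    have "homeomorphic_map (top_of_set (ball 0 1 - {0})) (subtopology (closed_surf S) R) q"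
      by (simp add: subtopology_subtopology Diff_eq Int_absorb1 subset_insertI)
    then have "cell S \<tau> R {0} q m \<beta>"
      unfolding cell_def circle_arc_def using 2(1,2) m by auto
    then show ?thesis
      by blast
  qed
qed

text \<open>This supplies \<open>adj\<close> in \<open>finite_regions\<close>: the midpoint of a
  side is a limit of points of the open cell, and at parameter 1/2 a half-branch does not depend on
  its direction.\<close>

lemma cell_closure:
  assumes "cell S \<tau> R Z q m \<beta>"
  shows "\<exists>b\<in>\<tau>. b (1/2) \<in> closed_surf S closure_of R"
proof -
  have Z: "Z \<subseteq> {0}" and q: "continuous_map (top_of_set (cball 0 1)) (closed_surf S) q"
    and hom: "homeomorphic_map (top_of_set (ball 0 1 - Z)) (subtopology (closed_surf S) R) q"
    and m: "0 < m" "\<beta> 0 \<in> half_branches \<tau>" "q (circle_arc m 0 (1/2)) = half_path (\<beta> 0) (1/2)"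
    using assms by (auto simp: cell_def)
  have "ball 0 1 - Z \<subseteq> cball (0::complex) 1"
    by auto
  then have "circle_arc m 0 (1/2) \<in> (top_of_set (cball 0 1)) closure_of (ball 0 1 - Z)"
    using closure_punctured_disc[OF Z] by (simp add: closure_of_subtopology Int_absorb1 Int_absorb2)
  then have "q (circle_arc m 0 (1/2)) \<in> closed_surf S closure_of q ` (ball 0 1 - Z)"
    using continuous_map_image_closure_subset[OF q] by blast
  moreover have "q ` (ball 0 1 - Z) \<subseteq> R"
    using homeomorphic_imp_surjective_map[OF hom] by auto
  ultimately have "half_path (\<beta> 0) (1/2) \<in> closed_surf S closure_of R"
    using closure_of_mono m(3) by (metis subsetD)
  moreover have "half_path (\<beta> 0) (1/2) = fst (\<beta> 0) (1/2)"
    by (simp add: half_path_def)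
  ultimately show ?thesis
    using m(2) by (auto simp: half_branches_def)
qed


section \<open>Homeomorphisms preserving the branches and the regions\<close>


lemma agree_on_closure:
  fixes f g :: "'a::topological_space \<Rightarrow> 'b::metric_space"
  assumes "continuous_on T f" "continuous_on T g" "S \<subseteq> T" "T \<subseteq> closure S"
    and eq: "\<And>x. x \<in> S \<Longrightarrow> f x = g x" and "x \<in> T"
  shows "f x = g x"
proof (rule forall_in_closure_of_eq[where X = "top_of_set T" and Y = euclidean and S = S])
  show "x \<in> top_of_set T closure_of S"
    using assms by (auto simp: closure_of_subtopology Int_absorb1)
qed (use assms in \<open>auto simp: Hausdorff_space_euclidean\<close>)

text \<open>Conjugation with the reversal of the unit interval: the motion of a branch expressed in
  the parameter of its half-branch with end \<open>e\<close>.\<close>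

definition half_reparam :: "(real \<Rightarrow> real) \<Rightarrow> bool \<Rightarrow> real \<Rightarrow> real" where
  "half_reparam \<rho> e s = (if e then 1 - \<rho> (1 - s) else \<rho> s)"

lemma reparam_half:
  assumes "reparam \<rho>"
  shows "reparam (half_reparam \<rho> e)"
proof (cases e)
  case True
  have "continuous_on {0..1} (\<lambda>s. 1 - \<rho> (1 - s))"
    by (rule continuous_on_diff[OF continuous_on_const continuous_on_compose2[of "{0..1}" \<rho>]])
      (use assms in \<open>auto simp: reparam_def intro!: continuous_intros\<close>)
  moreover have "strict_mono_on {0..1} (\<lambda>s. 1 - \<rho> (1 - s))"
  proof (rule strict_mono_onI)
    fix r s :: real assume "r \<in> {0..1}" "s \<in> {0..1}" "r < s"
    then show "1 - \<rho> (1 - r) < 1 - \<rho> (1 - s)"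
      using reparam_less[OF assms, of "1 - s" "1 - r"] by simp
  qed
  moreover have "half_reparam \<rho> e = (\<lambda>s. 1 - \<rho> (1 - s))"
    using True by (simp add: half_reparam_def fun_eq_iff)
  ultimately show ?thesis
    using assms by (simp add: reparam_def)
next
  case False
  then have "half_reparam \<rho> e = \<rho>"
    by (simp add: half_reparam_def fun_eq_iff)
  then show ?thesis
    using assms by simp
qed

text \<open>A point inside a branch lies on no other branch and is not a switch. It still belongs to
  both half-branches of its branch, which is why the parameters agree only under
  \<open>h = h'\<close>.\<close>

lemma embedded_half_path:
  assumes \<tau>: "embedded_complex S \<tau>" and h: "h \<in> half_branches \<tau>" "h' \<in> half_branches \<tau>"
    and s: "s \<in> {0<..<1}" "t \<in> {0..1}" and eq: "half_path h s = half_path h' t"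
  shows "fst h = fst h'" "t \<in> {0<..<1}" "h = h' \<Longrightarrow> s = t"
proof -
  have "fst h = fst h' \<and> (if snd h then 1 - s else s) = (if snd h' then 1 - t else t)"
    using s h eq by (intro embedded_complexD(3)[OF \<tau>]) (auto simp: half_path_def half_branches_def)
  then show "fst h = fst h'" "t \<in> {0<..<1}" "h = h' \<Longrightarrow> s = t"
    using s by (auto split: if_splits)
qed

text \<open>Since \<open>reparam\<close> fixes 0 and 1, this includes keeping the direction of every
  branch and fixing every switch.\<close>

definition preserves_branches :: "'a track \<Rightarrow> ('a \<Rightarrow> 'a) \<Rightarrow> bool" where
  "preserves_branches \<tau> g \<longleftrightarrow> (\<forall>b\<in>\<tau>. \<exists>\<rho>. reparam \<rho> \<and> (\<forall>s\<in>{0..1}. g (b s) = b (\<rho> s)))"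

lemma preserves_branches_support:
  assumes "preserves_branches \<tau> g"
  shows "g ` support \<tau> = support \<tau>"
proof -
  have "g ` b ` {0..1} = b ` {0..1}" if b: "b \<in> \<tau>" for b
  proof -
    obtain \<rho> where \<rho>: "reparam \<rho>" "\<And>s. s \<in> {0..1} \<Longrightarrow> g (b s) = b (\<rho> s)"
      using assms b unfolding preserves_branches_def by blast
    have "g ` b ` {0..1} = b ` \<rho> ` {0..1}"
      using \<rho>(2) unfolding image_image by (intro image_cong) auto
    then show ?thesis
      using reparam_bij[OF \<rho>(1)] by (simp add: bij_betw_def)
  qed
  then show ?thesis
    unfolding support_def by (auto simp: image_UN)
qed

lemma preserves_branches_half:
  assumes "preserves_branches \<tau> g" "h \<in> half_branches \<tau>"
  obtains \<rho> where "reparam \<rho>" "\<And>s. s \<in> {0..1} \<Longrightarrow> g (half_path h s) = half_path h (\<rho> s)"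
proof -
  obtain \<rho> where \<rho>: "reparam \<rho>" "\<And>s. s \<in> {0..1} \<Longrightarrow> g (fst h s) = fst h (\<rho> s)"
    using assms unfolding preserves_branches_def half_branches_def by fastforce
  have "g (half_path h s) = half_path h (half_reparam \<rho> (snd h) s)" if "s \<in> {0..1}" for s
    using \<rho>(2)[of "1 - s"] \<rho>(2)[of s] that by (auto simp: half_path_def half_reparam_def)
  then show thesis
    using that reparam_half[OF \<rho>(1)] by blast
qed

locale celled_surface =
  fixes S :: "'a punctured_surface" and \<tau> :: "'a track" and Z :: "'a set \<Rightarrow> complex set"
    and q :: "'a set \<Rightarrow> complex \<Rightarrow> 'a" and m :: "'a set \<Rightarrow> nat" and \<beta> :: "'a set \<Rightarrow> nat \<Rightarrow> 'a half_branch"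
  assumes Hausdorff: "Hausdorff_space (closed_surf S)"
    and embedded: "embedded_complex S \<tau>"
    and finite_cells: "finite (complementary_regions S (support \<tau>))"
    and cells: "R \<in> complementary_regions S (support \<tau>) \<Longrightarrow> cell S \<tau> R (Z R) (q R) (m R) (\<beta> R)"
begin

abbreviation "\<R> \<equiv> complementary_regions S (support \<tau>)"
abbreviation "Y \<equiv> topspace (surf S)"
abbreviation "side R \<equiv> circle_arc (m R)"

definition open_arc :: "'a set \<Rightarrow> nat \<Rightarrow> complex set" where
  "open_arc R j = side R j ` {0<..<1}"

text \<open>The action on branches and regions is trivial here; how the sides of a region are
  permuted becomes visible only on a \<open>lift\<close>.\<close>

definition automorphism :: "('a \<Rightarrow> 'a) \<Rightarrow> bool" where
  "automorphism g \<longleftrightarrow> homeomorphic_map (surf S) (surf S) g \<and> preserves_branches \<tau> g \<and> (\<forall>R\<in>\<R>. g ` R = R)"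

lemma automorphismD:
  assumes "automorphism g"
  shows "homeomorphic_map (surf S) (surf S) g" "preserves_branches \<tau> g" "R \<in> \<R> \<Longrightarrow> g ` R = R"
  using assms by (auto simp: automorphism_def)

text \<open>On \<open>Z R\<close> the equation would involve \<open>g\<close> at a puncture, outside
  its domain, so there the value of \<open>h\<close> is prescribed instead.\<close>

definition lift :: "'a set \<Rightarrow> ('a \<Rightarrow> 'a) \<Rightarrow> (complex \<Rightarrow> complex) \<Rightarrow> bool" where
  "lift R g h \<longleftrightarrow> continuous_on (cball 0 1) h \<and> bij_betw h (cball 0 1) (cball 0 1) \<and>
     (\<forall>z\<in>cball 0 1 - Z R. q R (h z) = g (q R z)) \<and> (\<forall>z\<in>Z R. h z = z) \<and>
     h ` (ball 0 1 - Z R) \<subseteq> ball 0 1 - Z R"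

lemma cellD:
  assumes R: "R \<in> \<R>"
  shows "Z R \<subseteq> {0}" "q R ` Z R \<inter> Y = {}" "continuous_map (top_of_set (cball 0 1)) (closed_surf S) (q R)"
    "homeomorphic_map (top_of_set (ball 0 1 - Z R)) (subtopology (closed_surf S) R) (q R)"
    "m R > 0" "\<And>j. j < m R \<Longrightarrow> \<beta> R j \<in> half_branches \<tau>"
    "\<And>j s. j < m R \<Longrightarrow> s \<in> {0..1} \<Longrightarrow> q R (side R j s) = half_path (\<beta> R j) s"
    "inj_on (q R) (ball 0 1 - Z R)" "q R ` (ball 0 1 - Z R) = R"
proof -
  show h: "homeomorphic_map (top_of_set (ball 0 1 - Z R)) (subtopology (closed_surf S) R) (q R)"
    using cells[OF R] by (simp add: cell_def)
  have "R \<subseteq> topspace (closed_surf S)"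
    using regions_subset(1)[OF R] by (auto simp: topspace_surf)
  then show "inj_on (q R) (ball 0 1 - Z R)" "q R ` (ball 0 1 - Z R) = R"
    using homeomorphic_imp_injective_map[OF h] homeomorphic_imp_surjective_map[OF h] by (auto simp: Int_absorb1)
qed (use cells[OF R] in \<open>auto simp: cell_def topspace_surf\<close>)

lemma half_path_in_support:
  assumes "h \<in> half_branches \<tau>" "s \<in> {0..1}"
  shows "half_path h s \<in> support \<tau>"
proof -
  have "fst h \<in> \<tau>" "half_path h s \<in> fst h ` {0..1}"
    using assms by (auto simp: half_path_def half_branches_def intro!: imageI)
  then show ?thesis
    unfolding support_def by blast
qed

lemma boundary_point:
  assumes R: "R \<in> \<R>" and z: "norm z = 1"
  obtains j s where "j < m R" "s \<in> {0..<1}" "z = side R j s" "q R z = half_path (\<beta> R j) s"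
    "q R z \<in> support \<tau>"
proof -
  obtain j s where js: "j < m R" "s \<in> {0..<1}" "z = side R j s"
    using circle_arc_cover[OF cellD(5)[OF R] z] by blast
  then have "q R z = half_path (\<beta> R j) s"
    using cellD(7)[OF R] by simp
  moreover from this have "q R z \<in> support \<tau>"
    using half_path_in_support[OF cellD(6)[OF R js(1)], of s] js by simp
  ultimately show thesis
    using that js by blast
qed

text \<open>A side passes a point inside a branch at most once and can meet a switch only at its two
  ends. This finiteness is what \<open>lift_homeo\<close> requires.\<close>

lemma finite_fibre:
  assumes R: "R \<in> \<R>"
  shows "finite {z \<in> sphere 0 1. q R z = x}"
proof -
  let ?A = "\<lambda>j. {s \<in> {0..1}. half_path (\<beta> R j) s = x}"
  have "finite (?A j)" if j: "j < m R" for j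
  proof (cases "\<exists>s\<in>{0<..<1}. half_path (\<beta> R j) s = x")
    case True
    then obtain s where s: "s \<in> {0<..<1}" "half_path (\<beta> R j) s = x"
      by blast
    have "?A j \<subseteq> {s}"
      using embedded_half_path(3)[OF embedded cellD(6)[OF R j] cellD(6)[OF R j] s(1)] s(2) by blast
    then show ?thesis
      by (rule finite_subset) simp
  next
    case False
    have "s = 0 \<or> s = 1 \<or> s \<in> {0<..<1}" if "s \<in> {0..1}" for s :: real
      using that by auto
    with False have "?A j \<subseteq> {0, 1}"
      by blast
    then show ?thesis
      by (rule finite_subset) simp
  qed
  then have "finite (\<Union>j\<in>{..<m R}. side R j ` ?A j)"
    by blast
  moreover have "{z \<in> sphere 0 1. q R z = x} \<subseteq> (\<Union>j\<in>{..<m R}. side R j ` ?A j)"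
  proof
    fix z assume z: "z \<in> {z \<in> sphere 0 1. q R z = x}"
    then have "norm z = 1"
      by simp
    then obtain j s where js: "j < m R" "s \<in> {0..<1}" "z = side R j s" "q R z = half_path (\<beta> R j) s"
      using boundary_point[OF R] by blast
    then have "s \<in> ?A j"
      using z by simp
    then show "z \<in> (\<Union>j\<in>{..<m R}. side R j ` ?A j)"
      using js by blast
  qed
  ultimately show ?thesis
    by (rule rev_finite_subset)
qed

lemma cball_cases:
  assumes "z \<in> cball 0 1"
  obtains "z \<in> ball 0 1 - Z R" | "z \<in> Z R" | "norm z = 1"
  using assms by fastforce

lemma automorphism_inverse:
  assumes g: "automorphism g"
  obtains g' where "homeomorphic_maps (surf S) (surf S) g g'" "\<And>R. R \<in> \<R> \<Longrightarrow> g' ` R \<subseteq> R"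
    "g' ` support \<tau> \<subseteq> support \<tau>"
proof -
  obtain g' where g': "homeomorphic_maps (surf S) (surf S) g g'"
    using g unfolding automorphism_def homeomorphic_map_maps by blast
  then have g'g: "g' (g y) = y" if "y \<in> Y" for y
    using that by (simp add: homeomorphic_maps_def)
  have inv: "g' ` A \<subseteq> A" if A: "g ` A = A" "A \<subseteq> Y" for A
  proof
    fix y assume "y \<in> g' ` A"
    then obtain a' where a': "a' \<in> A" "y = g' a'"
      by blast
    then have "a' \<in> g ` A"
      using A(1) by simp
    then obtain a where "a \<in> A" "a' = g a"
      by blast
    then show "y \<in> A"
      using A(2) g'g a' by auto
  qed
  show thesis
  proof (rule that[OF g'])
    show "g' ` R \<subseteq> R" if "R \<in> \<R>" for R
      using inv[OF _ regions_subset(1)[OF that]] g that by (simp add: automorphism_def)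
    show "g' ` support \<tau> \<subseteq> support \<tau>"
      using inv[OF preserves_branches_support support_subset[OF embedded]] g by (simp add: automorphism_def)
  qed
qed

lemma lift_exists:
  assumes g: "automorphism g" and R: "R \<in> \<R>"
  shows "\<exists>h. lift R g h"
proof -
  obtain g' where g': "homeomorphic_maps (surf S) (surf S) g g'" "\<And>R. R \<in> \<R> \<Longrightarrow> g' ` R \<subseteq> R"
    "g' ` support \<tau> \<subseteq> support \<tau>"
    using automorphism_inverse[OF g] by blast
  have gR: "g ` R \<subseteq> R" "g ` support \<tau> \<subseteq> support \<tau>"
    using g R preserves_branches_support unfolding automorphism_def by blast+
  have RY: "R \<subseteq> Y" "support \<tau> \<subseteq> Y" "Y \<subseteq> topspace (closed_surf S)" "support \<tau> \<inter> R = {}"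
    using regions_subset[OF R] support_subset[OF embedded] by (auto simp: topspace_surf)
  have sph: "q R ` sphere 0 1 \<subseteq> support \<tau>"
    using boundary_point[OF R] by fastforce
  have gM: "homeomorphic_maps (subtopology (closed_surf S) Y) (subtopology (closed_surf S) Y) g g'"
    using g'(1) by (simp only: surf_eq_subtopology[of S, symmetric])
  obtain h where "continuous_on (cball 0 1) h" "bij_betw h (cball 0 1) (cball 0 1)"
    "\<And>z. z \<in> cball 0 1 - Z R \<Longrightarrow> q R (h z) = g (q R z)" "\<And>z. z \<in> Z R \<Longrightarrow> h z = z"
    "h ` (ball 0 1 - Z R) \<subseteq> ball 0 1 - Z R"
    using lift_homeo[OF Hausdorff cellD(1)[OF R] cellD(3)[OF R] cellD(4)[OF R] RY cellD(2)[OF R] sph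
        finite_fibre[OF R] gM gR(1) g'(2)[OF R] gR(2) g'(3)]
    by blast
  then show ?thesis
    unfolding lift_def by blast
qed

text \<open>Only the circle is mapped to the track by \<open>q\<close>: the open cell goes to
  \<open>R\<close>, and a point of \<open>Z R\<close> goes to a puncture.\<close>

lemma lift_sphere:
  assumes R: "R \<in> \<R>" and g: "automorphism g" and h: "lift R g h" and z: "norm z = 1"
  shows "norm (h z) = 1" "q R (h z) = g (q R z)"
proof -
  have zZ: "z \<notin> Z R"
    using cellD(1)[OF R] z by auto
  then show eq: "q R (h z) = g (q R z)"
    using h z by (simp add: lift_def)
  have "q R z \<in> support \<tau>"
    using boundary_point[OF R z] by blast
  then have supp: "q R (h z) \<in> support \<tau>"
    using eq g preserves_branches_support unfolding automorphism_def by blast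
  have "h z \<in> cball 0 1"
    using h z by (auto simp: lift_def bij_betw_def)
  then show "norm (h z) = 1"
  proof (cases rule: cball_cases[of _ R])
    case 1
    then have "q R (h z) \<in> R"
      using cellD(9)[OF R] by blast
    then show ?thesis
      using supp regions_subset(2)[OF R] by blast
  next
    case 2
    then show ?thesis
      using supp cellD(2)[OF R] support_subset[OF embedded] by blast
  qed
qed

lemma open_arc_interior:
  assumes R: "R \<in> \<R>" and z: "norm z = 1" and h: "h \<in> half_branches \<tau>" "s \<in> {0<..<1}" "q R z = half_path h s"
  obtains i where "i < m R" "z \<in> open_arc R i"
proof -
  obtain i t where it: "i < m R" "t \<in> {0..<1}" "z = side R i t" "q R z = half_path (\<beta> R i) t"
    using boundary_point[OF R z] by blast
  then have "t \<in> {0<..<1}"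
    using embedded_half_path(2)[OF embedded h(1) cellD(6)[OF R it(1)] h(2)] h(3) by auto
  then show thesis
    using that it by (auto simp: open_arc_def)
qed

lemma open_arc_disjoint:
  assumes "i < m R" "j < m R" "side R i s \<in> open_arc R j" "s \<in> {0..1}"
  shows "i = j" "s \<in> {0<..<1}"
proof -
  obtain t where t: "t \<in> {0<..<1}" "side R i s = side R j t"
    using assms(3) by (auto simp: open_arc_def)
  show "i = j" "s \<in> {0<..<1}"
    using t circle_arc_eq_iff[OF assms(1,2,4), of t] by (auto split: if_splits)
qed

text \<open>Since \<open>g\<close> keeps the inside of each branch, its lift sends an open side into
  the union of the open sides; the image is connected, so it stays in one of them.\<close>

lemma lift_open_arc:
  assumes R: "R \<in> \<R>" and g: "automorphism g" and h: "lift R g h" and j: "j < m R"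
  shows "\<exists>i<m R. h ` open_arc R j \<subseteq> open_arc R i"
proof -
  let ?Q = "h ` open_arc R j"
  define A where "A = (\<lambda>i. side R i ` {0..1})"
  obtain \<rho> where \<rho>: "reparam \<rho>" "\<And>s. s \<in> {0..1} \<Longrightarrow> g (half_path (\<beta> R j) s) = half_path (\<beta> R j) (\<rho> s)"
    using preserves_branches_half[OF automorphismD(2)[OF g] cellD(6)[OF R j]] by blast
  have Q: "\<exists>i<m R. w \<in> open_arc R i" if w: "w \<in> ?Q" for w
  proof -
    obtain s where s: "s \<in> {0<..<1}" "w = h (side R j s)"
      using w unfolding open_arc_def by blast
    have "q R w = half_path (\<beta> R j) (\<rho> s)"
      using lift_sphere(2)[OF R g h norm_circle_arc] cellD(7)[OF R j, of s] \<rho>(2)[of s] s by simp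
    moreover have "\<rho> s \<in> {0<..<1}"
      using reparam_bounds(4)[OF \<rho>(1), of s] s by simp
    moreover have "norm w = 1"
      using lift_sphere(1)[OF R g h norm_circle_arc] s by simp
    ultimately show ?thesis
      using open_arc_interior[OF R _ cellD(6)[OF R j]] by metis
  qed
  have "open_arc R j \<subseteq> cball 0 1"
    by (auto simp: open_arc_def)
  then have "continuous_on (open_arc R j) h"
    using h continuous_on_subset unfolding lift_def by blast
  moreover have "connected (open_arc R j)"
    unfolding open_arc_def by (intro connected_continuous_image continuous_on_circle_arc) simp
  ultimately have "connected ?Q"
    by (rule connected_continuous_image)
  have "h (side R j (1/2)) \<in> ?Q"
    unfolding open_arc_def by auto
  then obtain i where i: "i < m R" "h (side R j (1/2)) \<in> open_arc R i"
    using Q by blast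
  have compA: "compact (A i)" for i
    unfolding A_def by (intro compact_continuous_image continuous_on_circle_arc) auto
  let ?B = "\<Union>k\<in>{..<m R} - {i}. A k"
  have sub: "open_arc R k \<subseteq> A k" for k
    by (auto simp: open_arc_def A_def)
  have disj: "open_arc R k \<inter> A k' = {}" if "k < m R" "k' < m R" "k \<noteq> k'" for k k'
    using open_arc_disjoint(1)[OF that(2,1)] that(3) unfolding A_def by blast
  \<comment> \<open>Two different closed sides share at most end points, and \<open>?Q\<close>
    contains none of these. So the closed sets \<open>A i\<close> and \<open>?B\<close> cover
    \<open>?Q\<close> without meeting inside it, and one of them misses it.\<close>
  have "A i \<inter> ?B \<inter> ?Q = {}"
  proof (rule ccontr)
    assume "A i \<inter> ?B \<inter> ?Q \<noteq> {}"
    then obtain w k where w: "w \<in> A i" "k < m R" "k \<noteq> i" "w \<in> A k" "w \<in> ?Q"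
      by blast
    then obtain l where "l < m R" "w \<in> open_arc R l"
      using Q by blast
    then show False
      using disj w i(1) by blast
  qed
  moreover have "?Q \<subseteq> A i \<union> ?B"
    using Q sub by blast
  moreover have "closed (A i)" "closed ?B"
    using compA by (auto intro!: closed_UN compact_imp_closed)
  ultimately have "A i \<inter> ?Q = {} \<or> ?B \<inter> ?Q = {}"
    using connected_closedD[OF \<open>connected ?Q\<close>] by blast
  moreover have "h (side R j (1/2)) \<in> A i \<inter> ?Q"
    using i(2) sub \<open>h (side R j (1/2)) \<in> ?Q\<close> by blast
  ultimately have "?B \<inter> ?Q = {}"
    by blast
  then have "?Q \<subseteq> open_arc R i"
    using Q sub by blast
  then show ?thesis
    using i(1) by blast
qed

lemma mid_arc: "side R j (1/2) \<in> open_arc R j"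
  unfolding open_arc_def by auto

text \<open>By \<open>same\<close>, the lifts of \<open>g1\<close> and \<open>g2\<close> permute the sides in the same way.\<close>

lemma lift_fixes_arcs:
  assumes R: "R \<in> \<R>" and g1: "automorphism g1" and g2: "automorphism g2" and g: "automorphism g"
    and comp: "\<And>y. y \<in> Y \<Longrightarrow> g2 (g y) = g1 y"
    and h1: "lift R g1 h1" and h2: "lift R g2 h2" and h: "lift R g h"
    and same: "\<And>i j. i < m R \<Longrightarrow> j < m R \<Longrightarrow>
      h1 (side R j (1/2)) \<in> open_arc R i \<longleftrightarrow> h2 (side R j (1/2)) \<in> open_arc R i"
    and j: "j < m R"
  shows "h ` open_arc R j \<subseteq> open_arc R j"
proof -
  let ?B = "ball 0 1 - Z R"
  \<comment> \<open>On the open cell both sides lie over the same point of \<open>R\<close> and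
    \<open>q\<close> is injective; density does the rest.\<close>
  have h2h: "h2 (h z) = h1 z" if z: "z \<in> cball 0 1" for z
  proof (rule agree_on_closure[where T = "cball 0 1" and S = ?B and f = "\<lambda>z. h2 (h z)" and g = h1 and x = z])
    show "continuous_on (cball 0 1) (\<lambda>z. h2 (h z))"
      by (rule continuous_on_compose2[of "cball 0 1" h2]) (use h h2 in \<open>auto simp: lift_def bij_betw_def\<close>)
    show "h2 (h w) = h1 w" if w: "w \<in> ?B" for w
    proof -
      have hw: "h w \<in> ?B" "h1 w \<in> ?B"
        using h h1 w unfolding lift_def by blast+
      then have h2w: "h2 (h w) \<in> ?B"
        using h2 unfolding lift_def by blast
      have "q R w \<in> Y"
        using w cellD(9)[OF R] regions_subset(1)[OF R] by blast
      moreover have "q R (h2 (h w)) = g2 (q R (h w))" "q R (h w) = g (q R w)" "q R (h1 w) = g1 (q R w)"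
        using h2 h h1 hw w by (auto simp: lift_def)
      ultimately have "q R (h2 (h w)) = q R (h1 w)"
        using comp by simp
      then show ?thesis
        using inj_onD[OF cellD(8)[OF R]] h2w hw by blast
    qed
  qed (use h1 z closure_punctured_disc[OF cellD(1)[OF R]] in \<open>auto simp: lift_def\<close>)
  obtain \<sigma> where \<sigma>: "\<And>j. j < m R \<Longrightarrow> \<sigma> j < m R \<and> h2 ` open_arc R j \<subseteq> open_arc R (\<sigma> j)"
    using lift_open_arc[OF R g2 h2] by metis
  have disj: "i = k" if ik: "i < m R" "k < m R" "w \<in> open_arc R i" "w \<in> open_arc R k" for i k w
  proof -
    obtain s where "w = side R i s" "s \<in> {0..1}"
      using ik(3) by (auto simp: open_arc_def)
    then show ?thesis
      using open_arc_disjoint(1)[OF ik(1,2)] ik(4) by blast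
  qed
  \<comment> \<open>Surjectivity of \<open>\<sigma>\<close>: the midpoint of side \<open>k\<close>
    has a preimage under \<open>h2\<close>. It lies on the circle, and inside a side, because
    \<open>g2\<close> moves its image under \<open>q\<close> to the inside of a branch.\<close>
  have "{..<m R} \<subseteq> \<sigma> ` {..<m R}"
  proof
    fix k assume k: "k \<in> {..<m R}"
    have "side R k (1/2) \<in> cball 0 1"
      by simp
    then obtain z where z: "z \<in> cball 0 1" "h2 z = side R k (1/2)"
      using h2 unfolding lift_def bij_betw_def by (metis imageE)
    have nz: "norm (h2 z) = 1"
      using z(2) by simp
    have "norm z = 1"
      using z(1)
    proof (cases rule: cball_cases[of _ R])
      case 1
      then have "h2 z \<in> ball 0 1"
        using h2 unfolding lift_def by blast
      then show ?thesis
        using nz by simp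
    next
      case 2
      then have "h2 z = z"
        using h2 by (simp add: lift_def)
      then show ?thesis
        using nz by simp
    qed
    then obtain i s where js: "i < m R" "s \<in> {0..<1}" "z = side R i s" "q R z = half_path (\<beta> R i) s"
      using boundary_point[OF R] by blast
    obtain \<rho> where \<rho>: "reparam \<rho>" "\<And>s. s \<in> {0..1} \<Longrightarrow> g2 (half_path (\<beta> R i) s) = half_path (\<beta> R i) (\<rho> s)"
      using preserves_branches_half[OF automorphismD(2)[OF g2] cellD(6)[OF R js(1)]] by blast
    have "half_path (\<beta> R k) (1/2) = half_path (\<beta> R i) (\<rho> s)"
      using lift_sphere(2)[OF R g2 h2 \<open>norm z = 1\<close>] z(2) js \<rho>(2)[of s] cellD(7)[OF R, of k "1/2"] k by simp
    then have "\<rho> s \<in> {0<..<1}"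
      using embedded_half_path(2)[OF embedded cellD(6)[OF R, of k] cellD(6)[OF R js(1)], of "1/2" "\<rho> s"]
        k reparam_bounds(1)[OF \<rho>(1), of s] js(2) by auto
    then have "s \<in> {0<..<1}"
      using reparam_bounds(4)[OF \<rho>(1), of s] js(2) by auto
    then have "z \<in> open_arc R i"
      using js(3) by (simp add: open_arc_def)
    then have "h2 z \<in> open_arc R (\<sigma> i)"
      using \<sigma>[OF js(1)] by blast
    then have "\<sigma> i = k"
      using disj \<sigma>[OF js(1)] k mid_arc[of R k] z(2) by (metis lessThan_iff)
    then show "k \<in> \<sigma> ` {..<m R}"
      using js(1) by blast
  qed
  moreover have "\<sigma> ` {..<m R} \<subseteq> {..<m R}"
    using \<sigma> by blast
  ultimately have "\<sigma> ` {..<m R} = {..<m R}"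
    by blast
  then have inj: "inj_on \<sigma> {..<m R}"
    by (intro eq_card_imp_inj_on) simp_all
  \<comment> \<open>If \<open>h\<close> moves side \<open>j\<close> to side \<open>i\<close>, then
    \<open>h1\<close> sends the midpoint into side \<open>\<sigma> i\<close>. By \<open>same\<close>
    so does \<open>h2\<close>, which sends it into side \<open>\<sigma> j\<close>; as
    \<open>\<sigma>\<close> is injective, \<open>i = j\<close>.\<close>
  let ?c = "side R j (1/2)"
  obtain i where i: "i < m R" "h ` open_arc R j \<subseteq> open_arc R i"
    using lift_open_arc[OF R g h j] by blast
  have "h ?c \<in> open_arc R i"
    using i(2) mid_arc by blast
  then have "h2 (h ?c) \<in> open_arc R (\<sigma> i)"
    using \<sigma>[OF i(1)] by blast
  then have "h1 ?c \<in> open_arc R (\<sigma> i)"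
    using h2h[of ?c] by simp
  then have "h2 ?c \<in> open_arc R (\<sigma> i)"
    using same \<sigma>[OF i(1)] j by blast
  moreover have "h2 ?c \<in> open_arc R (\<sigma> j)"
    using \<sigma>[OF j] mid_arc by blast
  ultimately have "\<sigma> i = \<sigma> j"
    using disj \<sigma>[OF i(1)] \<sigma>[OF j] by blast
  then show ?thesis
    using inj_onD[OF inj] i j by auto
qed

lemma isotopic_id:
  assumes g: "automorphism g" and h: "\<And>R. R \<in> \<R> \<Longrightarrow> lift R g (h R)"
    and arcs: "\<And>R j. R \<in> \<R> \<Longrightarrow> j < m R \<Longrightarrow> h R ` open_arc R j \<subseteq> open_arc R j"
  shows "isotopic_homeos S g id"
proof -

  \<comment> \<open>The lifts along the sides\<close>
  obtain r where r: "\<And>b. b \<in> \<tau> \<Longrightarrow> reparam (r b)"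
      "\<And>b s. b \<in> \<tau> \<Longrightarrow> s \<in> {0..1} \<Longrightarrow> g (b s) = b (r b s)"
    using g unfolding automorphism_def preserves_branches_def by metis
  define rh where "rh = (\<lambda>k. half_reparam (r (fst k)) (snd k))"
  have rh: "reparam (rh k)" if "k \<in> half_branches \<tau>" for k
    using that reparam_half[OF r(1)] by (auto simp: rh_def half_branches_def)
  have g_half: "g (half_path k s) = half_path k (rh k s)" if "k \<in> half_branches \<tau>" "s \<in> {0..1}" for k s
    using r(2)[of "fst k" s] r(2)[of "fst k" "1 - s"] that
    by (auto simp: rh_def half_path_def half_reparam_def half_branches_def)
  \<comment> \<open>Equality after applying \<open>q\<close> determines the parameter only inside a
    side, where \<open>arcs\<close> already tells which side it is. At the end points
    \<open>q\<close> may identify several points, so these are reached by continuity.\<close>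
  have boundary: "h R (side R j s) = side R j (rh (\<beta> R j) s)"
    if R: "R \<in> \<R>" and j: "j < m R" and s: "s \<in> {0..1}" for R j s
  proof (rule agree_on_closure[where T = "{0..1}" and S = "{0<..<1}" and x = s
        and f = "\<lambda>s. h R (side R j s)" and g = "\<lambda>s. side R j (rh (\<beta> R j) s)"])
    note \<beta> = cellD(6)[OF R j]
    show "continuous_on {0..1} (\<lambda>s. h R (side R j s))"
      by (rule continuous_on_compose2[of "cball 0 1" "h R", OF _ continuous_on_circle_arc])
        (use h[OF R] in \<open>auto simp: lift_def\<close>)
    show "continuous_on {0..1} (\<lambda>s. side R j (rh (\<beta> R j) s))"
      by (rule continuous_on_compose2[OF continuous_on_circle_arc[of UNIV]])
        (use rh[OF \<beta>] in \<open>auto simp: reparam_def\<close>)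
    show "h R (side R j s) = side R j (rh (\<beta> R j) s)" if s: "s \<in> {0<..<1}" for s
    proof -
      have "side R j s \<in> open_arc R j"
        using s by (simp add: open_arc_def)
      then have "h R (side R j s) \<in> open_arc R j"
        using arcs[OF R j] by blast
      then obtain s' where s': "s' \<in> {0<..<1}" "h R (side R j s) = side R j s'"
        by (auto simp: open_arc_def)
      have "half_path (\<beta> R j) s' = half_path (\<beta> R j) (rh (\<beta> R j) s)"
        using lift_sphere(2)[OF R g h[OF R] norm_circle_arc, of "m R" j s] s' s
          cellD(7)[OF R j, of s'] cellD(7)[OF R j, of s] g_half[OF \<beta>, of s] by simp
      then have "s' = rh (\<beta> R j) s"
        using embedded_half_path(3)[OF embedded \<beta> \<beta> s'(1)] reparam_bounds(1)[OF rh[OF \<beta>], of s] s by auto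
      then show ?thesis
        using s'(2) by simp
    qed
  qed (use s in auto)

  \<comment> \<open>Isotopies of the single cells\<close>
  define isotopy where "isotopy = (\<lambda>R F. continuous_on ({0..1} \<times> cball 0 1) (\<lambda>(t, z). F t z) \<and>
      (\<forall>t\<in>{0..1}. bij_betw (F t) (cball 0 1) (cball 0 1)) \<and>
      (\<forall>z\<in>cball 0 1. F 0 z = h R z \<and> F 1 z = z) \<and>
      (\<forall>t\<in>{0..1}. \<forall>j<m R. \<forall>s\<in>{0..1}. F t (side R j s) =
        side R j ((1 - t) * rh (\<beta> R j) s + t * s)) \<and>
      (\<forall>t\<in>{0..1}. \<forall>z\<in>cball 0 1. norm (F t z) = 1 \<longleftrightarrow> norm z = 1) \<and>
      (\<forall>t\<in>{0..1}. \<forall>z\<in>Z R. F t z = z))"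
  have ex: "\<exists>F. isotopy R F" if R: "R \<in> \<R>" for R
  proof -
    have hc: "continuous_on (cball 0 1) (h R)" and hb: "bij_betw (h R) (cball 0 1) (cball 0 1)"
      using h[OF R] by (auto simp: lift_def)
    obtain F :: "real \<Rightarrow> complex \<Rightarrow> complex" where
      F: "continuous_on ({0..1} \<times> cball 0 1) (\<lambda>(t, z). F t z)"
       "\<And>t. t \<in> {0..1} \<Longrightarrow> bij_betw (F t) (cball 0 1) (cball 0 1)"
       "\<And>z. z \<in> cball 0 1 \<Longrightarrow> F 0 z = h R z" "\<And>z. z \<in> cball 0 1 \<Longrightarrow> F 1 z = z"
       "\<And>t j s. t \<in> {0..1} \<Longrightarrow> j < m R \<Longrightarrow> s \<in> {0..1} \<Longrightarrow> F t (side R j s) =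
          side R j ((1 - t) * rh (\<beta> R j) s + t * s)"
       "\<And>t z. t \<in> {0..1} \<Longrightarrow> z \<in> cball 0 1 \<Longrightarrow> norm (F t z) = 1 \<longleftrightarrow> norm z = 1"
       "\<And>t. t \<in> {0..1} \<Longrightarrow> h R 0 = 0 \<Longrightarrow> F t 0 = 0"
      using disc_isotopy[where \<rho> = "\<lambda>j. rh (\<beta> R j)", OF cellD(5)[OF R] rh[OF cellD(6)[OF R]] hc hb boundary[OF R]]
      by blast
    have "F t z = z" if "t \<in> {0..1}" "z \<in> Z R" for t z
    proof -
      have "z = 0"
        using that(2) cellD(1)[OF R] by blast
      then show ?thesis
        using F(7)[OF that(1)] h[OF R] that(2) by (auto simp: lift_def)
    qed
    then have "isotopy R F"
      unfolding isotopy_def using F(1-6) by blast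
    then show ?thesis
      by blast
  qed
  obtain F where F0: "\<And>R. R \<in> \<R> \<Longrightarrow> isotopy R (F R)"
    using ex by metis
  have F: "\<And>R. R \<in> \<R> \<Longrightarrow> continuous_on ({0..1} \<times> cball 0 1) (\<lambda>(t, z). F R t z)"
     "\<And>R t. R \<in> \<R> \<Longrightarrow> t \<in> {0..1} \<Longrightarrow> bij_betw (F R t) (cball 0 1) (cball 0 1)"
     "\<And>R z. R \<in> \<R> \<Longrightarrow> z \<in> cball 0 1 \<Longrightarrow> F R 0 z = h R z \<and> F R 1 z = z"
     "\<And>R t j s. R \<in> \<R> \<Longrightarrow> t \<in> {0..1} \<Longrightarrow> j < m R \<Longrightarrow> s \<in> {0..1} \<Longrightarrow> F R t (side R j s) =
        side R j ((1 - t) * rh (\<beta> R j) s + t * s)"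
     "\<And>R t z. R \<in> \<R> \<Longrightarrow> t \<in> {0..1} \<Longrightarrow> z \<in> cball 0 1 \<Longrightarrow> norm (F R t z) = 1 \<longleftrightarrow> norm z = 1"
     "\<And>R t z. R \<in> \<R> \<Longrightarrow> t \<in> {0..1} \<Longrightarrow> z \<in> Z R \<Longrightarrow> F R t z = z"
    using F0 unfolding isotopy_def by blast+

  \<comment> \<open>The pieces and their motions\<close>
  define u where "u = (\<lambda>b t s. (1 - t) * r b s + t * s)"
  have u: "reparam (u b t)" if "b \<in> \<tau>" "t \<in> {0..1}" for b t
    unfolding u_def by (rule reparam_interpolate[OF r(1)[OF that(1)] that(2)])
  \<comment> \<open>Branches join the cells as pieces of their own, so the track is covered without
    asking which cells a branch bounds. All pieces have to live in one type, hence the unit interval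
    is placed in the complex plane.\<close>
  define I where "I = Inl ` \<R> \<union> Inr ` \<tau>"
  define K where "K = (\<lambda>i::'a set + (real \<Rightarrow> 'a). case i of Inl R \<Rightarrow> cball 0 1 | Inr b \<Rightarrow> complex_of_real ` {0..1})"
  define Q where "Q = (\<lambda>i::'a set + (real \<Rightarrow> 'a). case i of Inl R \<Rightarrow> q R | Inr b \<Rightarrow> \<lambda>z. b (Re z))"
  define G where "G = (\<lambda>i::'a set + (real \<Rightarrow> 'a). \<lambda>t z. case i of Inl R \<Rightarrow> F R t z | Inr b \<Rightarrow> complex_of_real (u b t (Re z)))"
  \<comment> \<open>A common description of boundary points of cells and points of branch pieces:
    both follow the motion \<open>u b\<close> of a branch, so their origin no longer
    matters.\<close>
  define on_branch where "on_branch = (\<lambda>i x. \<exists>b\<in>\<tau>. \<exists>s\<in>{0..1}. Q i x = b s \<and>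
     (\<forall>t\<in>{0..1}. Q i (G i t x) = b (u b t s)))"
  have classify: "on_branch i x \<or> (\<exists>R\<in>\<R>. i = Inl R \<and> x \<in> ball 0 1 - Z R) \<or> (\<exists>R\<in>\<R>. i = Inl R \<and> x \<in> Z R)"
    if i: "i \<in> I" and x: "x \<in> K i" for i x
  proof (cases i)
    case (Inr b)
    then have "b \<in> \<tau>" "Re x \<in> {0..1}"
      using i x by (auto simp: I_def K_def)
    moreover have "Q i x = b (Re x)" "\<And>t. Q i (G i t x) = b (u b t (Re x))"
      using Inr by (simp_all add: Q_def G_def)
    ultimately have "on_branch i x"
      unfolding on_branch_def by blast
    then show ?thesis
      by blast
  next
    case (Inl R)
    then have R: "R \<in> \<R>" and xc: "x \<in> cball 0 1"
      using i x by (auto simp: I_def K_def)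
    from xc show ?thesis
    proof (cases rule: cball_cases[of _ R])
      case 3
      then obtain j s where js: "j < m R" "s \<in> {0..<1}" "x = side R j s" "q R x = half_path (\<beta> R j) s"
        using boundary_point[OF R] by blast
      note \<beta> = cellD(6)[OF R js(1)]
      define b where "b = fst (\<beta> R j)"
      define e where "e = snd (\<beta> R j)"
      define s' where "s' = (if e then 1 - s else s)"
      have b: "b \<in> \<tau>" "s' \<in> {0..1}"
        using \<beta> js by (auto simp: b_def s'_def half_branches_def)
      have "Q i (G i t x) = b (u b t s')" if t: "t \<in> {0..1}" for t
      proof -
        define s2 where "s2 = (1 - t) * rh (\<beta> R j) s + t * s"
        have "s2 \<in> {0..1}"
          using reparam_bounds(1)[OF reparam_interpolate[OF rh[OF \<beta>] t], of s] js by (simp add: s2_def)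
        then have "Q i (G i t x) = half_path (\<beta> R j) s2"
          using F(4)[OF R t js(1), of s] js cellD(7)[OF R js(1), of s2] by (simp add: Inl Q_def G_def s2_def)
        \<comment> \<open>Linear interpolation commutes with reversing the interval, so both
          half-branches of a branch induce the same motion on it. This makes the isotopies on its
          two sides agree.\<close>
        moreover have "(if e then 1 - s2 else s2) = u b t s'"
          by (simp add: s2_def s'_def u_def rh_def half_reparam_def b_def e_def algebra_simps)
        ultimately show ?thesis
          by (simp add: half_path_def b_def e_def)
      qed
      moreover have "Q i x = b s'"
        using js by (simp add: Inl Q_def half_path_def b_def e_def s'_def)
      ultimately have "on_branch i x"
        using b unfolding on_branch_def by blast
      then show ?thesis
        by blast
    qed (use R Inl in auto)
  qed
  have Gcell: "Q (Inl R) x \<in> R" "Q (Inl R) (G (Inl R) t x) \<in> R" "G (Inl R) t x \<in> ball 0 1 - Z R"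
    if R: "R \<in> \<R>" and x: "x \<in> ball 0 1 - Z R" and t: "t \<in> {0..1}" for R x t
  proof -
    have xc: "x \<in> cball 0 1" "norm x \<noteq> 1"
      using x by auto
    have "F R t x \<in> cball 0 1"
      using F(2)[OF R t] xc(1) by (auto simp: bij_betw_def)
    then have "F R t x \<in> ball 0 1 - Z R"
    proof (cases rule: cball_cases[of _ R])
      \<comment> \<open>A point moved into \<open>Z R\<close> would have the same image as that
        fixed point of \<open>Z R\<close>, and so would coincide with it by injectivity.\<close>
      case 2
      have "Z R \<subseteq> cball 0 1"
        using cellD(1)[OF R] by auto
      then have "F R t x = x"
        using F(6)[OF R t 2] F(2)[OF R t] 2 xc(1) unfolding bij_betw_def by (meson inj_onD subsetD)
      then show ?thesis
        using 2 x by simp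
    next
      case 3
      then show ?thesis
        using F(5)[OF R t xc(1)] xc(2) by simp
    qed
    then show "G (Inl R) t x \<in> ball 0 1 - Z R" "Q (Inl R) (G (Inl R) t x) \<in> R" "Q (Inl R) x \<in> R"
      using cellD(9)[OF R] x by (auto simp: G_def Q_def)
  qed
  have Gpunct: "Q (Inl R) x \<notin> Y" "G (Inl R) t x = x" if "R \<in> \<R>" "x \<in> Z R" "t \<in> {0..1}" for R x t
    using F(6)[OF that(1,3,2)] cellD(2)[OF that(1)] that by (auto simp: Q_def G_def)
  have bsupp: "b s \<in> support \<tau>" if "b \<in> \<tau>" "s \<in> {0..1}" for b s
    using that unfolding support_def by blast
  have ub: "u b t s \<in> {0..1}" if "b \<in> \<tau>" "t \<in> {0..1}" "s \<in> {0..1}" for b t s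
    using reparam_bounds(1)[OF u[OF that(1,2)] that(3)] .
  have branch: "Q i x \<in> support \<tau>" "Q i (G i t x) \<in> support \<tau>" if on: "on_branch i x" and t: "t \<in> {0..1}" for i x t
  proof -
    obtain b s where "b \<in> \<tau>" "s \<in> {0..1}" "Q i x = b s" "Q i (G i t x) = b (u b t s)"
      using on t unfolding on_branch_def by blast
    then show "Q i x \<in> support \<tau>" "Q i (G i t x) \<in> support \<tau>"
      using bsupp ub t by auto
  qed
  \<comment> \<open>Branch points coincide only at one parameter inside one branch or when both are
    ends of branches. The motion is injective and keeps the inside in the first case, and fixes the
    points in the second.\<close>
  have u_iff: "b (u b t s) = b' (u b' t s') \<longleftrightarrow> b s = b' s'"
    if b: "b \<in> \<tau>" "b' \<in> \<tau>" and t: "t \<in> {0..1}" and s: "s \<in> {0..1}" "s' \<in> {0..1}" for b b' t s s'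
  proof -
    consider "s \<in> {0<..<1}" | "s' \<in> {0<..<1}" | "s \<in> {0, 1}" "s' \<in> {0, 1}"
      using s by fastforce
    then show ?thesis
    proof cases
      case 1
      then have "u b t s \<in> {0<..<1}"
        using reparam_bounds(4)[OF u[OF b(1) t] s(1)] by simp
      then show ?thesis
        using embedded_complexD(3)[OF embedded b 1 s(2)]
          embedded_complexD(3)[OF embedded b _ ub[OF b(2) t s(2)], of "u b t s"]
          reparam_eq_iff[OF u[OF b(1) t] s] by metis
    next
      case 2
      then have "u b' t s' \<in> {0<..<1}"
        using reparam_bounds(4)[OF u[OF b(2) t] s(2)] by simp
      then show ?thesis
        using embedded_complexD(3)[OF embedded b(2,1) 2 s(1)]
          embedded_complexD(3)[OF embedded b(2,1) _ ub[OF b(1) t s(1)], of "u b' t s'"]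
          reparam_eq_iff[OF u[OF b(2) t] s(2,1)] by metis
    next
      case 3
      have "u b t x = x" if "x \<in> {0, 1}" "b \<in> \<tau>" for b x
        using u[OF that(2) t] that(1) by (auto simp: reparam_def)
      then show ?thesis
        using 3 b by simp
    qed
  qed
  have suppY: "support \<tau> \<subseteq> Y"
    by (rule support_subset[OF embedded])

  \<comment> \<open>Compatibility of the motions with the identifications\<close>
  have compat: "Q i (G i t x) = Q j (G j t y) \<longleftrightarrow> Q i x = Q j y"
    if i: "i \<in> I" "j \<in> I" and t: "t \<in> {0..1}" and x: "x \<in> K i" "y \<in> K j" for i j t x y
  proof -
    have on_cell: "Q i x \<noteq> Q (Inl R) y \<and> Q i (G i t x) \<noteq> Q (Inl R) (G (Inl R) t y)"
      if "on_branch i x" "R \<in> \<R>" "y \<in> ball 0 1 - Z R" for i x R y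
      using branch[OF that(1) t] Gcell[OF that(2,3) t] regions_subset(2)[OF that(2)] by (metis IntI empty_iff)
    have in_Y: "Q i x \<in> Y \<and> Q i (G i t x) \<in> Y"
      if "on_branch i x \<or> (\<exists>R\<in>\<R>. i = Inl R \<and> x \<in> ball 0 1 - Z R)" for i x
      using that branch[OF _ t] Gcell[OF _ _ t] regions_subset(1) suppY by blast
    show ?thesis
      using classify[OF i(1) x(1)]
    proof (elim disjE bexE conjE)
      assume ix: "on_branch i x"
      show ?thesis
        using classify[OF i(2) x(2)]
      proof (elim disjE bexE conjE)
        assume jy: "on_branch j y"
        obtain b s where b: "b \<in> \<tau>" "s \<in> {0..1}" "Q i x = b s" "Q i (G i t x) = b (u b t s)"
          using ix t unfolding on_branch_def by blast
        obtain b' s' where b': "b' \<in> \<tau>" "s' \<in> {0..1}" "Q j y = b' s'" "Q j (G j t y) = b' (u b' t s')"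
          using jy t unfolding on_branch_def by blast
        show ?thesis
          using u_iff[OF b(1) b'(1) t b(2) b'(2)] b b' by simp
      next
        fix R assume "R \<in> \<R>" "j = Inl R" "y \<in> ball 0 1 - Z R"
        then show ?thesis
          using on_cell[OF ix] by blast
      next
        fix R assume R: "R \<in> \<R>" "j = Inl R" "y \<in> Z R"
        then show ?thesis
          using in_Y[of i x] ix Gpunct[OF R(1,3) t] by (metis (no_types, lifting))
      qed
    next
      fix R assume R: "R \<in> \<R>" "i = Inl R" "x \<in> ball 0 1 - Z R"
      show ?thesis
        using classify[OF i(2) x(2)]
      proof (elim disjE bexE conjE)
        assume "on_branch j y"
        then show ?thesis
          using on_cell[OF _ R(1,3)] R(2) by metis
      next
        fix R' assume R': "R' \<in> \<R>" "j = Inl R'" "y \<in> ball 0 1 - Z R'"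
        show ?thesis
        proof (cases "R = R'")
          case True
          have c: "x \<in> cball 0 1" "y \<in> cball 0 1"
            using R R' by auto
          have "Q i (G i t x) = Q j (G j t y) \<longleftrightarrow> G i t x = G j t y"
            using inj_on_eq_iff[OF cellD(8)[OF R(1)] Gcell(3)[OF R(1,3) t], of "G j t y"]
              Gcell(3)[OF R'(1,3) t] R(2) R'(2) True by (simp add: Q_def)
          also have "\<dots> \<longleftrightarrow> x = y"
            using inj_on_eq_iff[OF bij_betw_imp_inj_on[OF F(2)[OF R(1) t]] c] R(2) R'(2) True
            by (simp add: G_def)
          also have "\<dots> \<longleftrightarrow> Q i x = Q j y"
            using inj_on_eq_iff[OF cellD(8)[OF R(1)] R(3), of y] R(2) R' True by (simp add: Q_def)
          finally show ?thesis .
        next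
          case False
          then have "R \<inter> R' = {}"
            using connected_components_of_overlap R(1) R'(1) unfolding complementary_regions_def by blast
          then show ?thesis
            using Gcell(1,2)[OF R(1,3) t] Gcell(1,2)[OF R'(1,3) t] R(2) R'(2) by (metis IntI empty_iff)
        qed
      next
        fix R' assume R': "R' \<in> \<R>" "j = Inl R'" "y \<in> Z R'"
        then show ?thesis
          using in_Y[of i x] R Gpunct[OF R'(1,3) t] by (metis (no_types, lifting))
      qed
    next
      fix R assume R: "R \<in> \<R>" "i = Inl R" "x \<in> Z R"
      show ?thesis
        using classify[OF i(2) x(2)]
      proof (elim disjE bexE conjE)
        assume "on_branch j y"
        then show ?thesis
          using in_Y[of j y] Gpunct[OF R(1,3) t] R(2) by (metis (no_types, lifting))
      next
        fix R' assume R': "R' \<in> \<R>" "j = Inl R'" "y \<in> ball 0 1 - Z R'"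
        then show ?thesis
          using in_Y[of j y] Gpunct[OF R(1,3) t] R(2) by (metis (no_types, lifting))
      next
        fix R' assume R': "R' \<in> \<R>" "j = Inl R'" "y \<in> Z R'"
        then show ?thesis
          using Gpunct(2)[OF R(1,3) t] Gpunct(2)[OF R'(1,3) t] R(2) by simp
      qed
    qed
  qed
  have GY: "Q i (G i t x) \<in> Y \<longleftrightarrow> Q i x \<in> Y" if i: "i \<in> I" and t: "t \<in> {0..1}" and x: "x \<in> K i" for i t x
    using classify[OF i x]
  proof (elim disjE bexE conjE)
    assume "on_branch i x"
    then show ?thesis
      using branch[OF _ t] suppY by blast
  next
    fix R assume R: "R \<in> \<R>" "i = Inl R" "x \<in> ball 0 1 - Z R"
    then show ?thesis
      using Gcell[OF R(1,3) t] regions_subset(1)[OF R(1)] by blast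
  next
    fix R assume R: "R \<in> \<R>" "i = Inl R" "x \<in> Z R"
    then show ?thesis
      using Gpunct[OF R(1,3) t] by simp
  qed
  have cover: "Y \<subseteq> (\<Union>i\<in>I. Q i ` K i)"
  proof
    fix y assume y: "y \<in> Y"
    show "y \<in> (\<Union>i\<in>I. Q i ` K i)"
    proof (cases "y \<in> support \<tau>")
      case True
      then obtain b s where "b \<in> \<tau>" "s \<in> {0..1}" "y = b s"
        unfolding support_def by blast
      then have "y \<in> Q (Inr b) ` K (Inr b)" "Inr b \<in> I"
        by (auto simp: Q_def K_def I_def image_image)
      then show ?thesis
        by blast
    next
      case False
      then have "y \<in> topspace (subtopology (surf S) (Y - support \<tau>))"
        using y by simp
      then have "y \<in> \<Union>\<R>"
        unfolding complementary_regions_def Union_connected_components_of .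
      then obtain R where R: "R \<in> \<R>" "y \<in> R"
        by blast
      then have "y \<in> q R ` (ball 0 1 - Z R)"
        using cellD(9) by blast
      moreover have "ball 0 1 - Z R \<subseteq> cball 0 1"
        by auto
      ultimately have "y \<in> Q (Inl R) ` K (Inl R)" "Inl R \<in> I"
        using R(1) by (auto simp: Q_def K_def I_def)
      then show ?thesis
        by blast
    qed
  qed

  \<comment> \<open>The glued isotopy\<close>
  obtain H where
    H: "continuous_map (prod_topology (top_of_set {0..1}) (subtopology (closed_surf S) Y)) (subtopology (closed_surf S) Y)
       (\<lambda>(t, y). H t y)"
    and Hhom: "\<And>t. t \<in> {0..1} \<Longrightarrow> homeomorphic_map (subtopology (closed_surf S) Y) (subtopology (closed_surf S) Y) (H t)"
    and HQ: "\<And>i t x. i \<in> I \<Longrightarrow> t \<in> {0..1} \<Longrightarrow> x \<in> K i \<Longrightarrow> Q i x \<in> Y \<Longrightarrow> H t (Q i x) = Q i (G i t x)"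
  proof (rule glue_isotopy[where M = "closed_surf S" and Y = Y and I = I and K = K and q = Q and F = G])
    show "Hausdorff_space (closed_surf S)"
      by (rule Hausdorff)
    show "Y \<subseteq> topspace (closed_surf S)"
      by (auto simp: topspace_surf)
    show "finite I"
      unfolding I_def using finite_cells embedded_complexD(1)[OF embedded] by blast
    show "compact (K i)" for i
      by (cases i) (auto simp: K_def intro!: compact_continuous_image continuous_intros)
    show "continuous_map (top_of_set (K i)) (closed_surf S) (Q i)" if i: "i \<in> I" for i
    proof (cases i)
      case (Inl R)
      then show ?thesis
        using cellD(3) i by (auto simp: I_def K_def Q_def)
    next
      case (Inr b)
      then have "b \<in> \<tau>"
        using i by (auto simp: I_def)
      then have b: "continuous_map (top_of_set {0..1}) (closed_surf S) b"
        using embedded_complexD(2)[OF embedded] by (auto simp: surf_def continuous_map_in_subtopology)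
      have "continuous_map (top_of_set (complex_of_real ` {0..1})) (top_of_set {0..1}) Re"
        by (auto intro!: continuous_intros)
      from continuous_map_compose[OF this b] show ?thesis
        by (simp add: Inr K_def Q_def o_def)
    qed
    show "continuous_on ({0..1} \<times> K i) (\<lambda>(t, x). G i t x)" if i: "i \<in> I" for i
    proof (cases i)
      case (Inl R)
      then show ?thesis
        using F(1) i by (auto simp: I_def K_def G_def)
    next
      case (Inr b)
      then have "continuous_on {0..1} (r b)"
        using r(1) i by (auto simp: I_def reparam_def)
      then have "continuous_on ({0..1} \<times> K i) (\<lambda>p. r b (Re (snd p)))"
        by (rule continuous_on_compose2) (auto simp: Inr K_def intro!: continuous_intros)
      then show ?thesis
        unfolding case_prod_beta Inr G_def u_def by (simp add: Inr) (intro continuous_intros)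
    qed
    show "bij_betw (G i t) (K i) (K i)" if i: "i \<in> I" and t: "t \<in> {0..1}" for i t
    proof (cases i)
      case (Inl R)
      then have "bij_betw (F R t) (cball 0 1) (cball 0 1)"
        using F(2) i t by (auto simp: I_def)
      then show ?thesis
        by (simp add: Inl K_def G_def)
    next
      case (Inr b)
      then have "b \<in> \<tau>"
        using i by (auto simp: I_def)
      have e: "bij_betw complex_of_real {0..1} (complex_of_real ` {0..1})"
        by (auto simp: bij_betw_def inj_on_def)
      have e': "bij_betw Re (complex_of_real ` {0..1}) {0..1}"
        by (auto simp: bij_betw_def inj_on_def image_image)
      have "bij_betw (complex_of_real \<circ> (u b t \<circ> Re)) (complex_of_real ` {0..1}) (complex_of_real ` {0..1})"
        by (rule bij_betw_trans[OF bij_betw_trans[OF e' reparam_bij[OF u[OF \<open>b \<in> \<tau>\<close> t]]] e])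
      then show ?thesis
        by (simp add: Inr K_def G_def o_def)
    qed
    show "Y \<subseteq> (\<Union>i\<in>I. Q i ` K i)"
      by (rule cover)
    show "Q i (G i t x) = Q j (G j t y) \<longleftrightarrow> Q i x = Q j y"
      if "i \<in> I" "j \<in> I" "t \<in> {0..1}" "x \<in> K i" "y \<in> K j" for i j t x y
      by (rule compat[OF that])
    show "Q i (G i t x) \<in> Y \<longleftrightarrow> Q i x \<in> Y" if "i \<in> I" "t \<in> {0..1}" "x \<in> K i" for i t x
      by (rule GY[OF that])
  next
    fix H :: "real \<Rightarrow> 'a \<Rightarrow> 'a"
    assume "continuous_map (prod_topology (top_of_set {0..1}) (subtopology (closed_surf S) Y)) (subtopology (closed_surf S) Y)
       (\<lambda>(t, y). H t y)"
     "\<And>t. t \<in> {0..1} \<Longrightarrow> homeomorphic_map (subtopology (closed_surf S) Y) (subtopology (closed_surf S) Y) (H t)"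
     "\<And>i t x. i \<in> I \<Longrightarrow> t \<in> {0..1} \<Longrightarrow> x \<in> K i \<Longrightarrow> Q i x \<in> Y \<Longrightarrow> H t (Q i x) = Q i (G i t x)"
    then show thesis
      by (rule that)
  qed
  have ends: "H 0 y = g y" "H 1 y = y" if y: "y \<in> Y" for y
  proof -
    obtain i x where ix: "i \<in> I" "x \<in> K i" "y = Q i x"
      using cover y by blast
    have "Q i (G i 0 x) = g (Q i x) \<and> Q i (G i 1 x) = Q i x"
      using classify[OF ix(1,2)]
    proof (elim disjE bexE conjE)
      assume "on_branch i x"
      then obtain b s where "b \<in> \<tau>" "s \<in> {0..1}" "Q i x = b s" "\<And>t. t \<in> {0..1} \<Longrightarrow> Q i (G i t x) = b (u b t s)"
        unfolding on_branch_def by blast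
      then show ?thesis
        using r(2) by (simp add: u_def)
    next
      fix R assume R: "R \<in> \<R>" "i = Inl R" "x \<in> ball 0 1 - Z R"
      then have "x \<in> cball 0 1 - Z R"
        by auto
      then show ?thesis
        using F(3)[OF R(1), of x] h[OF R(1)] R(2) by (simp add: Q_def G_def lift_def)
    next
      fix R assume R: "R \<in> \<R>" "i = Inl R" "x \<in> Z R"
      then show ?thesis
        using Gpunct(1)[OF R(1,3), of 0] y ix(3) by simp
    qed
    then show "H 0 y = g y" "H 1 y = y"
      using HQ[OF ix(1) _ ix(2)] y ix(3) by auto
  qed
  have "homotopic_with (homeomorphic_map (surf S) (surf S)) (surf S) (surf S) (H 0) (H 1)"
    unfolding homotopic_with_def
  proof (intro exI conjI)
    show "continuous_map (prod_topology (top_of_set {0..1}) (surf S)) (surf S) (\<lambda>(t, y). H t y)"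
      using H by (simp only: surf_eq_subtopology[of S, symmetric])
    show "\<forall>t\<in>{0..1}. homeomorphic_map (surf S) (surf S) (\<lambda>y. (\<lambda>(t, y). H t y) (t, y))"
      using Hhom by (simp add: surf_eq_subtopology[of S, symmetric])
  qed auto
  then show ?thesis
    unfolding isotopic_homeos_def
  \<comment> \<open>The ends of the isotopy are known to agree with \<open>g\<close> and
    \<open>id\<close> on the surface only.\<close>
  proof (rule homotopic_with_eq)
    show "homeomorphic_map (surf S) (surf S) f \<longleftrightarrow> homeomorphic_map (surf S) (surf S) f'"
      if "\<And>y. y \<in> Y \<Longrightarrow> f y = f' y" for f f'
      using homeomorphic_map_eq[of "surf S" "surf S" f f'] homeomorphic_map_eq[of "surf S" "surf S" f' f] that
      by auto
  qed (use ends in simp_all)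
qed

end


section \<open>Finiteness of the transporters\<close>


lemma maps_half_reparam:
  "maps_half f h h' \<longleftrightarrow> (\<exists>\<rho>. reparam \<rho> \<and> (\<forall>s\<in>{0..1}. f (half_path h s) = half_path h' (\<rho> s)))"
  by (auto simp: maps_half_def reparam_def)

lemma maps_half_compose:
  assumes "maps_half f h h'" "maps_half g h' h''"
  shows "maps_half (g \<circ> f) h h''"
proof -
  obtain \<rho> \<rho>' where \<rho>: "reparam \<rho>" "\<And>s. s \<in> {0..1} \<Longrightarrow> f (half_path h s) = half_path h' (\<rho> s)"
    and \<rho>': "reparam \<rho>'" "\<And>s. s \<in> {0..1} \<Longrightarrow> g (half_path h' s) = half_path h'' (\<rho>' s)"
    using assms unfolding maps_half_reparam by metis
  have "(g \<circ> f) (half_path h s) = half_path h'' ((\<rho>' \<circ> \<rho>) s)" if "s \<in> {0..1}" for s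
    using \<rho>(2)[OF that] \<rho>'(2)[OF reparam_bounds(1)[OF \<rho>(1) that]] by simp
  then show ?thesis
    unfolding maps_half_reparam using reparam_compose[OF \<rho>(1) \<rho>'(1)] by blast
qed

text \<open>Recording the image of \<open>(b, False)\<close> fixes the image of the branch together
  with its direction: \<open>(b, True)\<close> then goes to the other half of the image.\<close>

definition carries ::
    "'a punctured_surface \<Rightarrow> ('a \<Rightarrow> 'a) \<Rightarrow> 'a track \<Rightarrow> 'a track \<Rightarrow> bool" where
  "carries S f \<tau> \<tau>' \<longleftrightarrow> homeomorphic_map (surf S) (surf S) f \<and> f ` support \<tau> = support \<tau>' \<and>
     (\<forall>b\<in>\<tau>. \<exists>h\<in>half_branches \<tau>'. maps_half f (b, False) h)"

lemma carries_ontoD: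
  assumes "carries_onto S f \<tau> \<tau>'"
  shows "homeomorphic_map (surf S) (surf S) f" "f ` support \<tau> = support \<tau>'"
    "h \<in> half_branches \<tau> \<Longrightarrow> \<exists>h'\<in>half_branches \<tau>'. maps_half f h h'"
  using assms unfolding carries_onto_def by simp_all

lemma carries_compose:
  assumes "carries_onto S f \<tau> \<tau>'" "carries_onto S f' \<tau>' \<tau>''"
  shows "carries S (f' \<circ> f) \<tau> \<tau>''"
  unfolding carries_def
proof (intro conjI ballI)
  show "homeomorphic_map (surf S) (surf S) (f' \<circ> f)"
    using assms[THEN carries_ontoD(1)] by (rule homeomorphic_map_compose)
  show "(f' \<circ> f) ` support \<tau> = support \<tau>''"
    using assms[THEN carries_ontoD(2)] by (simp only: image_comp[symmetric])
  fix b assume "b \<in> \<tau>"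
  then have "(b, False) \<in> half_branches \<tau>"
    by (simp add: half_branches_def)
  then obtain h h' where "h' \<in> half_branches \<tau>''" "maps_half f (b, False) h" "maps_half f' h h'"
    using carries_ontoD(3)[OF assms(1)] carries_ontoD(3)[OF assms(2)] by blast
  then show "\<exists>h\<in>half_branches \<tau>''. maps_half (f' \<circ> f) (b, False) h"
    using maps_half_compose by blast
qed

context celled_surface
begin

lemma carries_region:
  assumes f: "carries S f \<tau> \<tau>'" and R: "R \<in> \<R>"
  shows "f ` R \<in> complementary_regions S (support \<tau>')"
proof -
  have hom: "homeomorphic_map (surf S) (surf S) f" and supp: "f ` support \<tau> = support \<tau>'"
    using f by (auto simp: carries_def)
  have "f ` (Y - support \<tau>) = f ` Y - f ` support \<tau>"
    by (rule inj_on_image_set_diff[OF homeomorphic_imp_injective_map[OF hom]])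
      (use support_subset[OF embedded] in auto)
  then have "f ` (Y \<inter> (Y - support \<tau>)) = Y \<inter> (Y - support \<tau>')"
    using homeomorphic_imp_surjective_map[OF hom] supp by (simp add: Int_absorb1)
  from homeomorphic_map_connected_components_of[OF homeomorphic_map_subtopologies[OF hom this]]
  show ?thesis
    using R unfolding complementary_regions_def by blast
qed

text \<open>Relations instead of functions: no image half-branch has to be chosen, and both
  components are subsets of fixed finite sets once the two tracks have finitely many branches and
  regions.\<close>

definition action_data :: "'a track \<Rightarrow> ('a \<Rightarrow> 'a) \<Rightarrow> ((real \<Rightarrow> 'a) \<times> 'a half_branch) set \<times> ('a set \<times> 'a set) set" where
  "action_data \<tau>' f = ({(b, h). b \<in> \<tau> \<and> h \<in> half_branches \<tau>' \<and> maps_half f (b, False) h}, (\<lambda>R. (R, f ` R)) ` \<R>)"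

text \<open>If \<open>f1\<close> and \<open>f2\<close> take \<open>b\<close> to the same half-branch
  with reparametrisations \<open>\<rho>1\<close> and \<open>\<rho>2\<close>, then the quotient moves
  \<open>b\<close> by \<open>\<rho>1\<close> followed by the inverse of \<open>\<rho>2\<close>,
  which is again a reparametrisation.\<close>

lemma quotient_automorphism:
  assumes f1: "carries S f1 \<tau> \<tau>'" and f2: "carries S f2 \<tau> \<tau>'"
    and same: "action_data \<tau>' f1 = action_data \<tau>' f2"
    and inv: "homeomorphic_maps (surf S) (surf S) f2 f2'"
  shows "automorphism (f2' \<circ> f1)"
  unfolding automorphism_def
proof (intro conjI ballI)
  have f2'f2: "f2' (f2 y) = y" if "y \<in> Y" for y
    using inv that by (simp add: homeomorphic_maps_def)
  have "homeomorphic_map (surf S) (surf S) f2'"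
    using inv homeomorphic_maps_sym homeomorphic_map_maps by metis
  then show "homeomorphic_map (surf S) (surf S) (f2' \<circ> f1)"
    using f1 homeomorphic_map_compose unfolding carries_def by blast
  show "preserves_branches \<tau> (f2' \<circ> f1)"
    unfolding preserves_branches_def
  proof
    fix b assume b: "b \<in> \<tau>"
    obtain h where h: "h \<in> half_branches \<tau>'" "maps_half f1 (b, False) h"
      using f1 b unfolding carries_def by blast
    then have "(b, h) \<in> fst (action_data \<tau>' f1)"
      using b by (simp add: action_data_def)
    then have "maps_half f2 (b, False) h"
      unfolding same by (simp add: action_data_def)
    then obtain \<rho>1 \<rho>2 where \<rho>1: "reparam \<rho>1" "\<And>s. s \<in> {0..1} \<Longrightarrow> f1 (b s) = half_path h (\<rho>1 s)"
      and \<rho>2: "reparam \<rho>2" "\<And>s. s \<in> {0..1} \<Longrightarrow> f2 (b s) = half_path h (\<rho>2 s)"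
      using h(2) unfolding maps_half_reparam by (auto simp: half_path_def)
    obtain \<rho>' where \<rho>': "reparam \<rho>'" "\<And>s. s \<in> {0..1} \<Longrightarrow> \<rho>' (\<rho>2 s) = s"
      using reparam_inverse[OF \<rho>2(1)] by blast
    have "(f2' \<circ> f1) (b s) = b ((\<rho>' \<circ> \<rho>1) s)" if s: "s \<in> {0..1}" for s
    proof -
      obtain s' where s': "s' \<in> {0..1}" "\<rho>1 s = \<rho>2 s'"
        using reparam_bounds(1)[OF \<rho>1(1) s] reparam_bij[OF \<rho>2(1)] unfolding bij_betw_def by blast
      have "b s' \<in> Y"
        using b s' support_subset[OF embedded] unfolding support_def by blast
      then have "f2' (f1 (b s)) = b s'"
        using \<rho>1(2)[OF s] \<rho>2(2)[OF s'(1)] s'(2) f2'f2 by metis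
      then show ?thesis
        using s' \<rho>'(2) by simp
    qed
    then show "\<exists>\<rho>. reparam \<rho> \<and> (\<forall>s\<in>{0..1}. (f2' \<circ> f1) (b s) = b (\<rho> s))"
      using reparam_compose[OF \<rho>1(1) \<rho>'(1)] by blast
  qed
  fix R assume R: "R \<in> \<R>"
  then have "(R, f1 ` R) \<in> snd (action_data \<tau>' f1)"
    by (simp add: action_data_def)
  then have "f1 ` R = f2 ` R"
    unfolding same by (auto simp: action_data_def)
  then have "(f2' \<circ> f1) ` R = f2' ` f2 ` R"
    by (simp only: image_comp[symmetric])
  also have "\<dots> = (\<lambda>y. y) ` R"
    unfolding image_image by (rule image_cong[OF refl]) (use f2'f2 regions_subset(1)[OF R] in blast)
  finally show "(f2' \<circ> f1) ` R = R"
    by simp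
qed

text \<open>The pigeonhole principle is applied twice. After the first time, maps with equal
  \<open>action_data\<close> are divided by one of them, \<open>f0\<close>, and become
  automorphisms, which have lifts; the second time, two of these permute the sides alike. Their
  quotient \<open>g\<close> is then isotopic to the identity, and composing with \<open>f2\<close>
  gives the isotopy.\<close>

lemma infinite_carriers_isotopic:
  assumes \<tau>': "finite \<tau>'" "finite (complementary_regions S (support \<tau>'))"
    and B: "infinite B" "\<And>f. f \<in> B \<Longrightarrow> carries S f \<tau> \<tau>'"
  obtains f1 f2 where "f1 \<in> B" "f2 \<in> B" "f1 \<noteq> f2" "isotopic_homeos S f1 f2"
proof -
  have "action_data \<tau>' ` B \<subseteq> Pow (\<tau> \<times> half_branches \<tau>') \<times> Pow (\<R> \<times> complementary_regions S (support \<tau>'))"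
    using B(2) carries_region by (fastforce simp: action_data_def)
  moreover have "finite (half_branches \<tau>')"
    using \<tau>'(1) by (simp add: half_branches_def)
  ultimately have "finite (action_data \<tau>' ` B)"
    using \<tau>'(2) finite_cells embedded_complexD(1)[OF embedded] by (meson finite_Pow_iff finite_SigmaI finite_subset)
  then obtain f0 where f0: "f0 \<in> B" "infinite {f \<in> B. action_data \<tau>' f = action_data \<tau>' f0}"
    using pigeonhole_infinite[OF B(1)] by blast
  define B1 where "B1 = {f \<in> B. action_data \<tau>' f = action_data \<tau>' f0}"
  obtain f0' where f0': "homeomorphic_maps (surf S) (surf S) f0 f0'"
    using B(2)[OF f0(1)] unfolding carries_def homeomorphic_map_maps by blast
  have auto: "automorphism (f0' \<circ> f)" if "f \<in> B1" for f
    using that by (intro quotient_automorphism[OF B(2) B(2)[OF f0(1)] _ f0']) (auto simp: B1_def)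
  then have "\<forall>f\<in>B1. \<forall>R\<in>\<R>. \<exists>h. lift R (f0' \<circ> f) h"
    using lift_exists by blast
  then obtain L where L: "\<And>f R. f \<in> B1 \<Longrightarrow> R \<in> \<R> \<Longrightarrow> lift R (f0' \<circ> f) (L f R)"
    by metis
  \<comment> \<open>The lift sends the midpoint of a side into exactly one open side, so this finite
    relation is the permutation of the sides.\<close>
  define d where "d = (\<lambda>f. {(R, j, i). R \<in> \<R> \<and> j < m R \<and> i < m R \<and>
    L f R (side R j (1/2)) \<in> open_arc R i})"
  have "d ` B1 \<subseteq> Pow (SIGMA R:\<R>. {..<m R} \<times> {..<m R})"
    by (auto simp: d_def)
  moreover have "finite (Pow (SIGMA R:\<R>. {..<m R} \<times> {..<m R}))"
    using finite_cells by (simp add: finite_SigmaI)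
  ultimately have "finite (d ` B1)"
    by (rule finite_subset)
  moreover have "infinite B1"
    using f0(2) by (simp add: B1_def)
  ultimately obtain f2 where f2: "f2 \<in> B1" "infinite {f \<in> B1. d f = d f2}"
    using pigeonhole_infinite by blast
  have "infinite ({f \<in> B1. d f = d f2} - {f2})"
    using f2(2) by (rule infinite_remove)
  then have "{f \<in> B1. d f = d f2} - {f2} \<noteq> {}"
    by (rule infinite_imp_nonempty)
  then obtain f1 where f1: "f1 \<in> B1" "d f1 = d f2" "f1 \<noteq> f2"
    by blast
  have c: "carries S f1 \<tau> \<tau>'" "carries S f2 \<tau> \<tau>'"
    using f1 f2 B(2) by (auto simp: B1_def)
  then have hom: "homeomorphic_map (surf S) (surf S) f1" "homeomorphic_map (surf S) (surf S) f2"
    by (auto simp: carries_def)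
  then obtain f2' where f2': "homeomorphic_maps (surf S) (surf S) f2 f2'"
    unfolding homeomorphic_map_maps by blast
  define g where "g = f2' \<circ> f1"
  have g: "automorphism g"
    unfolding g_def using f1(1) f2(1) by (intro quotient_automorphism[OF c _ f2']) (simp add: B1_def)
  have f2g: "f2 (g y) = f1 y" if "y \<in> Y" for y
  proof -
    have "f1 y \<in> Y"
      using that homeomorphic_imp_surjective_map[OF hom(1)] by blast
    then show ?thesis
      using f2' by (simp add: g_def homeomorphic_maps_def)
  qed
  obtain h where h: "\<And>R. R \<in> \<R> \<Longrightarrow> lift R g (h R)"
    using lift_exists[OF g] by metis
  have arcs: "h R ` open_arc R j \<subseteq> open_arc R j" if R: "R \<in> \<R>" and j: "j < m R" for R j
  proof (rule lift_fixes_arcs[OF R auto[OF f1(1)] auto[OF f2(1)] g _ L[OF f1(1) R] L[OF f2(1) R] h[OF R] _ j])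
    show "(f0' \<circ> f2) (g y) = (f0' \<circ> f1) y" if "y \<in> Y" for y
      using f2g[OF that] by simp
    show "L f1 R (side R j (1/2)) \<in> open_arc R i \<longleftrightarrow> L f2 R (side R j (1/2)) \<in> open_arc R i"
      if "i < m R" "j < m R" for i j
    proof -
      have "(R, j, i) \<in> d f1 \<longleftrightarrow> (R, j, i) \<in> d f2"
        using f1(2) by simp
      then show ?thesis
        using that R by (simp add: d_def)
    qed
  qed
  have "isotopic_homeos S g id"
    by (rule isotopic_id[OF g h arcs])
  then have "homotopic_with (homeomorphic_map (surf S) (surf S)) (surf S) (surf S) (f2 \<circ> g) (f2 \<circ> id)"
    unfolding isotopic_homeos_def
    by (rule homotopic_with_compose_continuous_map_left[OF _ homeomorphic_imp_continuous_map[OF hom(2)]])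
      (use hom(2) homeomorphic_map_compose in blast)
  then have "isotopic_homeos S f1 f2"
    unfolding isotopic_homeos_def
  proof (rule homotopic_with_eq)
    show "homeomorphic_map (surf S) (surf S) f \<longleftrightarrow> homeomorphic_map (surf S) (surf S) f'"
      if "\<And>y. y \<in> Y \<Longrightarrow> f y = f' y" for f f'
      using homeomorphic_map_eq[of "surf S" "surf S" f f'] homeomorphic_map_eq[of "surf S" "surf S" f' f] that
      by auto
  qed (use f2g in simp_all)
  moreover have "f1 \<in> B" "f2 \<in> B"
    using f1(1) f2(1) by (simp_all add: B1_def)
  ultimately show thesis
    using that f1(3) by blast
qed

end

lemma complete_track_celled:
  assumes S: "oriented_surface S g k" and \<tau>: "complete_track S \<tau>"
  shows "\<exists>Z q m \<beta>. celled_surface S \<tau> Z q m \<beta>"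
proof -
  let ?\<R> = "complementary_regions S (support \<tau>)"
  have emb: "embedded_complex S \<tau>" and max: "maximal S \<tau>"
    using \<tau> by (auto simp: complete_track_def train_track_def)
  have "\<forall>R\<in>?\<R>. \<exists>Z q m \<beta>. cell S \<tau> R Z q m \<beta>"
    using cell_exists[OF max] by blast
  then obtain Z q m \<beta> where cell: "\<And>R. R \<in> ?\<R> \<Longrightarrow> cell S \<tau> R (Z R) (q R) (m R) (\<beta> R)"
    by metis
  have "finite ?\<R>"
    by (rule finite_regions[OF S emb]) (rule cell_closure[OF cell])
  then have "celled_surface S \<tau> Z q m \<beta>"
    using S emb cell by unfold_locales (auto simp: oriented_surface_def)
  then show ?thesis
    by blast
qed

lemma maps_half_id_unique:
  assumes \<tau>: "embedded_complex S \<tau>" and h: "h \<in> half_branches \<tau>" "h' \<in> half_branches \<tau>"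
    and map: "maps_half id h h'"
  shows "h = h'"
proof -
  obtain \<rho> where \<rho>: "reparam \<rho>" "\<And>s. s \<in> {0..1} \<Longrightarrow> half_path h s = half_path h' (\<rho> s)"
    using map unfolding maps_half_reparam by auto
  have eq: "fst h = fst h' \<and> (if snd h then 1 - s else s) = (if snd h' then 1 - \<rho> s else \<rho> s)"
    if s: "s \<in> {0<..<1}" for s
    using \<rho>(2)[of s] s h reparam_bounds(1)[OF \<rho>(1), of s]
    by (intro embedded_complexD(3)[OF \<tau>]) (auto simp: half_path_def half_branches_def)
  \<comment> \<open>Opposite directions would force \<open>\<rho> s = 1 - s\<close>, which
    decreases; two parameters are enough to exclude it.\<close>
  have "\<rho> (1/4) < \<rho> (3/4)"
    using reparam_less[OF \<rho>(1)] by simp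
  then have "snd h = snd h'"
    using eq[of "1/4"] eq[of "3/4"] by (auto split: if_splits)
  then show ?thesis
    using eq[of "1/4"] by (simp add: prod_eq_iff)
qed

text \<open>This places a track in its own class. Under \<open>id\<close> a half-branch corresponds
  to itself only, which settles the clause on \<open>same_class\<close>.\<close>

lemma isotopic_tracks_refl:
  assumes "embedded_complex S \<tau>"
  shows "isotopic_tracks S \<tau> \<tau>"
proof -
  have refl: "maps_half id h h" for h :: "'a half_branch"
    unfolding maps_half_def
    by (intro exI[of _ id]) (auto simp: strict_mono_on_def)
  have "carries_onto S id \<tau> \<tau>"
    unfolding carries_onto_def
  proof (intro conjI ballI impI)
    show "homeomorphic_map (surf S) (surf S) id" "id ` support \<tau> = support \<tau>"
      by (simp_all add: homeomorphic_map_id)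
    show "\<exists>h'\<in>half_branches \<tau>. maps_half id h h'" if "h \<in> half_branches \<tau>" for h
      using refl that by blast
    show "same_class S h1 h2 \<longleftrightarrow> same_class S h1' h2'"
      if "h1 \<in> half_branches \<tau>" "h2 \<in> half_branches \<tau>" "h1' \<in> half_branches \<tau>" "h2' \<in> half_branches \<tau>"
        "maps_half id h1 h1' \<and> maps_half id h2 h2'" for h1 h2 h1' h2'
      using that maps_half_id_unique[OF assms] by metis
  qed
  moreover have "isotopic_homeos S id id"
    unfolding isotopic_homeos_def by (simp add: homotopic_with_refl homeomorphic_map_id)
  ultimately show ?thesis
    unfolding isotopic_tracks_def by blast
qed

lemma isotopic_homeos_sym: "isotopic_homeos S f g \<Longrightarrow> isotopic_homeos S g f"
  unfolding isotopic_homeos_def by (rule homotopic_with_symD)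

lemma isotopic_homeos_trans: "isotopic_homeos S f g \<Longrightarrow> isotopic_homeos S g h \<Longrightarrow> isotopic_homeos S f h"
  unfolding isotopic_homeos_def by (rule homotopic_with_trans)

text \<open>Every mapping class taking \<open>v\<close> to \<open>w\<close> has a representative
  that carries one fixed track \<open>\<tau>\<close> onto one fixed \<open>\<tau>'\<close>: a member
  of the class starts at some track isotopic to \<open>\<tau>\<close>, and is preceded by a map
  isotopic to the identity that leads there. Different classes have non-isotopic representatives, so
  infinitely many classes would contradict \<open>infinite_carriers_isotopic\<close>.\<close>

lemma finite_vertex_transporter:
  assumes S: "oriented_surface S g k" and v: "v \<in> TT_vertices S" and w: "w \<in> TT_vertices S"
  shows "finite {\<gamma> \<in> MCG S. TT_vertex_action S \<gamma> v = w}" (is "finite ?\<Gamma>")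
proof (rule ccontr)
  assume inf: "infinite ?\<Gamma>"
  let ?r = "{(\<tau>, \<tau>'). complete_track S \<tau> \<and> complete_track S \<tau>' \<and> isotopic_tracks S \<tau> \<tau>'}"
  let ?i = "{(f, g). isotopic_homeos S f g}"
  obtain \<tau> where \<tau>: "complete_track S \<tau>" "v = ?r `` {\<tau>}"
    using v unfolding TT_vertices_def by (auto elim!: quotientE)
  obtain \<tau>' where \<tau>': "complete_track S \<tau>'" "w = ?r `` {\<tau>'}"
    using w unfolding TT_vertices_def by (auto elim!: quotientE)
  have "isotopic_tracks S \<tau>' \<tau>'"
    using \<tau>'(1) by (intro isotopic_tracks_refl) (auto simp: complete_track_def train_track_def)
  then have \<tau>'w: "\<tau>' \<in> w"
    using \<tau>' by simp
  define P where "P = (\<lambda>\<gamma> \<phi>. carries S \<phi> \<tau> \<tau>' \<and> (\<exists>f. isotopic_homeos S f \<phi> \<and> \<gamma> = ?i `` {f}))"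
  have "\<exists>\<phi>. P \<gamma> \<phi>" if \<gamma>: "\<gamma> \<in> ?\<Gamma>" for \<gamma>
  proof -
    obtain f where f: "\<gamma> = ?i `` {f}"
      using \<gamma> unfolding MCG_def by (auto elim!: quotientE)
    have "\<tau>' \<in> TT_vertex_action S \<gamma> v"
      using \<gamma> \<tau>'w by blast
    then obtain f1 \<tau>1 where f1: "f1 \<in> \<gamma>" "\<tau>1 \<in> v" "carries_onto S f1 \<tau>1 \<tau>'"
      unfolding TT_vertex_action_def by blast
    then obtain f0 where f0: "isotopic_homeos S id f0" "carries_onto S f0 \<tau> \<tau>1"
      using \<tau>(2) unfolding isotopic_tracks_def by blast
    have hom: "homeomorphic_map (surf S) (surf S) f1"
      using f1(3) by (simp add: carries_onto_def)
    have "isotopic_homeos S (f1 \<circ> id) (f1 \<circ> f0)"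
      using f0(1) unfolding isotopic_homeos_def
      by (rule homotopic_with_compose_continuous_map_left[OF _ homeomorphic_imp_continuous_map[OF hom]])
        (use hom homeomorphic_map_compose in blast)
    moreover have "isotopic_homeos S f f1"
      using f1(1) f by simp
    ultimately have "isotopic_homeos S f (f1 \<circ> f0)"
      using isotopic_homeos_trans by fastforce
    then show ?thesis
      unfolding P_def using carries_compose[OF f0(2) f1(3)] f by blast
  qed
  then have "\<forall>\<gamma>\<in>?\<Gamma>. \<exists>\<phi>. P \<gamma> \<phi>"
    by blast
  then obtain \<phi> where "\<forall>\<gamma>\<in>?\<Gamma>. P \<gamma> (\<phi> \<gamma>)"
    by (rule bchoice[THEN exE])
  then have \<phi>: "\<And>\<gamma>. \<gamma> \<in> ?\<Gamma> \<Longrightarrow> carries S (\<phi> \<gamma>) \<tau> \<tau>'"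
    "\<And>\<gamma>. \<gamma> \<in> ?\<Gamma> \<Longrightarrow> \<exists>f. isotopic_homeos S f (\<phi> \<gamma>) \<and> \<gamma> = ?i `` {f}"
    unfolding P_def by blast+
  have eq: "\<gamma>1 = \<gamma>2" if \<gamma>: "\<gamma>1 \<in> ?\<Gamma>" "\<gamma>2 \<in> ?\<Gamma>" "isotopic_homeos S (\<phi> \<gamma>1) (\<phi> \<gamma>2)" for \<gamma>1 \<gamma>2
  proof -
    obtain f1 f2 where f: "isotopic_homeos S f1 (\<phi> \<gamma>1)" "\<gamma>1 = ?i `` {f1}"
      "isotopic_homeos S f2 (\<phi> \<gamma>2)" "\<gamma>2 = ?i `` {f2}"
      using \<phi>(2)[OF \<gamma>(1)] \<phi>(2)[OF \<gamma>(2)] by blast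
    have 12: "isotopic_homeos S f1 f2"
      using f(1,3) \<gamma>(3) isotopic_homeos_sym isotopic_homeos_trans by blast
    then have "isotopic_homeos S f1 x \<longleftrightarrow> isotopic_homeos S f2 x" for x
      using isotopic_homeos_sym isotopic_homeos_trans by blast
    then show ?thesis
      using f(2,4) by auto
  qed
  \<comment> \<open>\<open>isotopic_homeos\<close> is reflexive on homeomorphisms only; here
    reflexivity is obtained by passing to \<open>f\<close> and back.\<close>
  have "isotopic_homeos S (\<phi> \<gamma>) (\<phi> \<gamma>)" if "\<gamma> \<in> ?\<Gamma>" for \<gamma>
    using \<phi>(2)[OF that] isotopic_homeos_sym isotopic_homeos_trans by blast
  then have "inj_on \<phi> ?\<Gamma>"
    by (intro inj_onI eq) auto
  then have infB: "infinite (\<phi> ` ?\<Gamma>)"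
    using inf finite_imageD by blast
  obtain Z q m \<beta> where "celled_surface S \<tau> Z q m \<beta>"
    using complete_track_celled[OF S \<tau>(1)] by blast
  then interpret celled_surface S \<tau> Z q m \<beta> .
  obtain Z' q' m' \<beta>' where celled': "celled_surface S \<tau>' Z' q' m' \<beta>'"
    using complete_track_celled[OF S \<tau>'(1)] by blast
  have carr: "carries S f \<tau> \<tau>'" if "f \<in> \<phi> ` ?\<Gamma>" for f
    using that \<phi>(1) by blast
  obtain f1 f2 where "f1 \<in> \<phi> ` ?\<Gamma>" "f2 \<in> \<phi> ` ?\<Gamma>" "f1 \<noteq> f2" "isotopic_homeos S f1 f2"
    by (rule infinite_carriers_isotopic[OF embedded_complexD(1)[OF celled_surface.embedded[OF celled']]
          celled_surface.finite_cells[OF celled'] infB carr])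
  then show False
    using eq by blast
qed

theorem lemma4p3:
  fixes S :: "'a punctured_surface" and g k :: nat
  assumes "oriented_surface S g k"
    and "3 * int g - 3 + int k \<ge> 2"
  shows "proper_action (MCG S) (TT_action S) (TT S)"
proof -
  have "proper_action (MCG S) (\<lambda>\<gamma>. map_graph_point (TT_vertex_action S \<gamma>)) (graph_topology (TT_vertices S) (TT_edges S))"
  proof (rule proper_action_graph)
    show "TT_edges S \<subseteq> TT_vertices S \<times> TT_vertices S"
      by (auto simp: TT_edges_def)
  qed (rule finite_vertex_transporter[OF assms(1)])
  moreover have "TT_action S = (\<lambda>\<gamma>. map_graph_point (TT_vertex_action S \<gamma>))"
    by (simp add: TT_action_def fun_eq_iff)
  ultimately show ?thesis
    by (simp add: TT_def)
qed

end
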